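(* Let $M$ be the interior of a compact 3-manifold with non-empty boundary and let $\mathcal{T}$ be an ideal triangulation of $M$. Assume that each boundary component is a torus or a Klein bottle. Let $V_1,\dots,V_m$ be the vertex solutions. Then the following are equivalent: (1) $(M;\mathcal{T})$ admits a semi-angle structure; (2) for all $s\in C(M;\mathcal{T})$ with all quadrilateral coordinates non-negative, one has $\chi^*(s)\le 0$; (3) for all $s\in PC(M;\mathcal{T})$, $\chi^*(s)\le 0$; (4) $\chi^*(V_i)\le 0$ for all vertex solutions $V_i$, $i=1,\dots,m$.
   Context: **Ideal triangulation.** Let $X$ be a disjoint union of compact 3-simplices $\sigma^3_1,\dots,\sigma^3_t$ and let $\Phi$ be a collection of affine isomorphisms pairing the codimension-one faces of these simplices (each $\phi\in\Phi$ identifies two distinct faces, each face belonging to exactly one pairing). The quotient $K=X/\Phi$ is a closed 3-dimensional pseudo-manifold; the images of the simplices and their sub-simplices are its vertices, edges, triangles and tetrahedra. An ideal triangulation $\mathcal{T}$ of a non-compact 3-manifold $M$ is such a $K$, with non-manifold points at most at its vertices, together with an identification of $M$ with $K$ minus all of its vertices. The (ideal) edges, triangles and tetrahedra of $\mathcal{T}$ are the corresponding cells of $K$ with vertices removed. "Boundary components" means the boundary components of the compact 3-manifold of which $M$ is the interior. **Normal disc types.** A normal arc in a triangle is a properly embedded arc joining the interiors of two distinct edges; a normal disc in a tetrahedron is a properly embedded disc meeting each face in one normal arc or not at all. Up to normal isotopy (isotopy preserving each cell) each tetrahedron has seven normal disc types: four normal triangles (each cutting off one corner, meeting the three edges at that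 corner) and three normal quadrilaterals (each separating a pair of opposite edges and meeting the other four edges). A quadrilateral type in a tetrahedron faces the two edges of that tetrahedron disjoint from it. Let $q_1,\dots,q_{3t}$ be all quadrilateral types and $p_1,\dots,p_{4t}$ all triangle types of $\mathcal{T}$. The degree $d(e)$ of an edge $e$ is the number of edges of the unglued tetrahedra which are glued to form $e$; each of these contributes one quadrilateral type facing $e$. **Solution spaces.** $C(M;\mathcal{T})\subset\mathbb{R}^{7t}$ is the vector space of all $(x_1,\dots,x_{3t},y_1,\dots,y_{4t})$ satisfying the compatibility equations: for each triangle of $\mathcal{T}$, arising by gluing a face $\tau$ of $\sigma^3_i$ to a face $\delta$ of $\sigma^3_j$ (possibly $i=j$), and each of the three normal arc types in it, $x_q+y_p=x_{q'}+y_{p'}$, where $q,p$ are the unique quadrilateral and triangle types in $\sigma^3_i$ meeting $\tau$ in this arc type, and $q',p'$ are the unique quadrilateral and triangle types in $\sigma^3_j$ meeting $\delta$ in this arc type. The $x_i$ are the quadrilateral coordinates. $PC(M;\mathcal{T})$ is the convex polytope $C(M;\mathcal{T})\cap\{x\in\mathbb{R}^{7t}: x_i\ge 0,\ \sum_{i=1}^{7t}x_i=1\}$, and the vertex solutions $V_1,\dots,V_m$ are its vertices. **Generalised Euler characteristic.** $\chi^*:\mathbb{R}^{7t}\to\mathbb{R}$ is the linear function $\chi^*(x,y)=\sum_i x_i\chi^*(q_i)+\sum_j y_j\chi^*(p_j)$, where $\chi^*(p)=-\tfrac12+\sum_{a=0}^2\tfrac1{d(e_a)}$ for a triangle type $p$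 meeting edges $e_0,e_1,e_2$ (with multiplicity), and $\chi^*(q)=-1+\sum_{a=0}^3\tfrac1{d(e_a)}$ for a quadrilateral type $q$ meeting edges $e_0,\dots,e_3$ (with multiplicity). **Semi-angle structure.** A function $\alpha:\{q_1,\dots,q_{3t}\}\to\mathbb{R}$ with all values non-negative such that: (i) for each tetrahedron, the sum of $\alpha$ over its three quadrilateral types is $\pi$; (ii) for each edge $e$, the sum of $\alpha$ over the $d(e)$ quadrilateral types facing $e$ (with multiplicity) is $2\pi$. *)

theory Defs
  imports "HOL-Analysis.Analysis"
begin

subsection \<open>Quotient spaces\<close>

definition class_of :: "('a \<Rightarrow> 'a \<Rightarrow> bool) \<Rightarrow> 'a \<Rightarrow> 'a set" where
  "class_of r x = {y. equivclp r x y}"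

text \<open>
  The quotient of \<open>X\<close> by the equivalence relation generated by \<open>r\<close>. It is meant for
  relations \<open>r\<close> that only relate points of \<open>X\<close>.
\<close>

definition quotient_topology :: "'a topology \<Rightarrow> ('a \<Rightarrow> 'a \<Rightarrow> bool) \<Rightarrow> 'a set topology" where
  "quotient_topology X r = topology (\<lambda>U. U \<subseteq> class_of r ` topspace X
     \<and> openin X {x \<in> topspace X. class_of r x \<in> U})"

lemma openin_quotient_topology:
  "openin (quotient_topology X r) U \<longleftrightarrow>
     U \<subseteq> class_of r ` topspace X \<and> openin X {x \<in> topspace X. class_of r x \<in> U}"
proof -
  have "istopology (\<lambda>U. U \<subseteq> class_of r ` topspace X
     \<and> openin X {x \<in> topspace X. class_of r x \<in> U})" (is "istopology ?P")
    unfolding istopology_def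
  proof (intro conjI allI impI)
    fix S T assume "?P S" "?P T"
    moreover have "{x \<in> topspace X. class_of r x \<in> S \<inter> T} =
        {x \<in> topspace X. class_of r x \<in> S} \<inter> {x \<in> topspace X. class_of r x \<in> T}" by auto
    ultimately show "S \<inter> T \<subseteq> class_of r ` topspace X"
      "openin X {x \<in> topspace X. class_of r x \<in> S \<inter> T}" by auto
  next
    fix \<K> assume *: "\<forall>K\<in>\<K>. ?P K"
    then show "\<Union>\<K> \<subseteq> class_of r ` topspace X" by blast
    have "{x \<in> topspace X. class_of r x \<in> \<Union>\<K>} =
        (\<Union>K\<in>\<K>. {x \<in> topspace X. class_of r x \<in> K})" by auto
    then show "openin X {x \<in> topspace X. class_of r x \<in> \<Union>\<K>}" using * by auto
  qed
  then show ?thesis unfolding quotient_topology_def by (simp add: topology_inverse')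
qed

lemma topspace_quotient_topology: "topspace (quotient_topology X r) = class_of r ` topspace X"
proof
  show "topspace (quotient_topology X r) \<subseteq> class_of r ` topspace X"
    using openin_quotient_topology[of X r] by (metis openin_topspace)
  have "{x \<in> topspace X. class_of r x \<in> class_of r ` topspace X} = topspace X" by auto
  then have "openin (quotient_topology X r) (class_of r ` topspace X)"
    by (simp add: openin_quotient_topology)
  then show "class_of r ` topspace X \<subseteq> topspace (quotient_topology X r)"
    by (rule openin_subset)
qed

lemma quotient_map_class_of: "quotient_map X (quotient_topology X r) (class_of r)"
  unfolding quotient_map_def by (auto simp: topspace_quotient_topology openin_quotient_topology)


subsection \<open>Torus and Klein bottle\<close>

definition torus :: "(complex \<times> complex) topology" where
  "torus = prod_topology (top_of_set (sphere 0 1)) (top_of_set (sphere 0 1))"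

definition klein_glue :: "real \<times> real \<Rightarrow> real \<times> real \<Rightarrow> bool" where
  "klein_glue a b \<longleftrightarrow> (\<exists>s\<in>{0..1}. a = (s, 0) \<and> b = (s, 1) \<or> a = (0, s) \<and> b = (1, 1 - s))"

definition klein_bottle :: "(real \<times> real) set topology" where
  "klein_bottle = quotient_topology (top_of_set ({0..1} \<times> {0..1})) klein_glue"


subsection \<open>Compact 3-manifolds with boundary\<close>

definition euclidean3_points :: "'a topology \<Rightarrow> 'a set" where
  "euclidean3_points X = {p \<in> topspace X. \<exists>U. openin X U \<and> p \<in> U \<and>
     (\<exists>W :: (real^3) set. open W \<and> subtopology X U homeomorphic_space top_of_set W)}"

text \<open>
  Second countability is not required explicitly, since it follows from compactness and the
  existence of charts.
\<close>

definition compact_3manifold_with_boundary :: "'a topology \<Rightarrow> bool" where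
  "compact_3manifold_with_boundary N \<longleftrightarrow> compact_space N \<and> Hausdorff_space N \<and>
     (\<forall>p\<in>topspace N. \<exists>U. openin N U \<and> p \<in> U \<and>
        (\<exists>W. openin (top_of_set {x :: real^3. 0 \<le> x $ 1}) W \<and>
             subtopology N U homeomorphic_space top_of_set W))"

definition manifold_interior :: "'a topology \<Rightarrow> 'a topology" where
  "manifold_interior N = subtopology N (euclidean3_points N)"

definition manifold_boundary :: "'a topology \<Rightarrow> 'a topology" where
  "manifold_boundary N = subtopology N (topspace N - euclidean3_points N)"


subsection \<open>Ideal triangulations\<close>

text \<open>
  The 3-simplices are indexed by a finite type, and the vertices of each of them by the type
  \<open>4\<close>. Face \<open>f\<close> of a simplex is the one opposite to vertex \<open>f\<close>. An affine isomorphism of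
  triangles is determined by the induced bijection of vertices: face \<open>f\<close> of simplex \<open>i\<close> is
  glued to a face of simplex \<open>adj T i f\<close>, vertex \<open>v \<noteq> f\<close> going to vertex \<open>glue T i f v\<close>.
  This bijection is extended to a permutation of \<open>4\<close>, so that \<open>glue T i f f\<close> is
  the number of the target face.
\<close>

record 'n gluing =
  adj :: "'n \<Rightarrow> 4 \<Rightarrow> 'n"
  glue :: "'n \<Rightarrow> 4 \<Rightarrow> 4 \<Rightarrow> 4"

definition face_pairing :: "'n gluing \<Rightarrow> bool" where
  "face_pairing T \<longleftrightarrow> (\<forall>i f. bij (glue T i f)
     \<and> (adj T i f, glue T i f f) \<noteq> (i, f)
     \<and> adj T (adj T i f) (glue T i f f) = i
     \<and> glue T (adj T i f) (glue T i f f) = inv (glue T i f))"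

definition simplex3 :: "(real^4) set" where
  "simplex3 = {x. (\<forall>v. 0 \<le> x $ v) \<and> (\<Sum>v\<in>UNIV. x $ v) = 1}"

definition disjoint_simplices :: "('n \<times> (real^4)) topology" where
  "disjoint_simplices = prod_topology (discrete_topology UNIV) (top_of_set simplex3)"

definition glued :: "'n gluing \<Rightarrow> 'n \<times> (real^4) \<Rightarrow> 'n \<times> (real^4) \<Rightarrow> bool" where
  "glued T = (\<lambda>(i, x) (j, y). x \<in> simplex3 \<and> y \<in> simplex3 \<and>
     (\<exists>f. x $ f = 0 \<and> j = adj T i f \<and> (\<forall>v. y $ glue T i f v = x $ v)))"

definition pseudo_manifold :: "'n gluing \<Rightarrow> ('n \<times> (real^4)) set topology" where
  "pseudo_manifold T = quotient_topology disjoint_simplices (glued T)"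

definition vertex_points :: "'n gluing \<Rightarrow> ('n \<times> (real^4)) set set" where
  "vertex_points T = {class_of (glued T) (i, axis v 1) | i v. True}"

definition ideal_triangulation ::
  "'m topology \<Rightarrow> 'n::finite gluing \<Rightarrow> ('m \<Rightarrow> ('n \<times> (real^4)) set) \<Rightarrow> bool" where
  "ideal_triangulation M T h \<longleftrightarrow> face_pairing T
     \<and> topspace (pseudo_manifold T) - euclidean3_points (pseudo_manifold T) \<subseteq> vertex_points T
     \<and> homeomorphic_map M
         (subtopology (pseudo_manifold T) (topspace (pseudo_manifold T) - vertex_points T)) h"

text \<open>
  An edge of a simplex is given by its set of two vertices; an edge of the triangulation is
  the set of all edges of the unglued simplices forming it.
\<close>

definition edge_glued :: "'n gluing \<Rightarrow> 'n \<times> 4 set \<Rightarrow> 'n \<times> 4 set \<Rightarrow> bool" where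
  "edge_glued T = (\<lambda>(i, A) (j, B). \<exists>f. f \<notin> A \<and> j = adj T i f \<and> B = glue T i f ` A)"

definition edge_class :: "'n gluing \<Rightarrow> 'n \<Rightarrow> 4 set \<Rightarrow> ('n \<times> 4 set) set" where
  "edge_class T i A = class_of (edge_glued T) (i, A)"

definition edges :: "'n gluing \<Rightarrow> ('n \<times> 4 set) set set" where
  "edges T = {edge_class T i A | i A. card A = 2}"

definition degree :: "('n \<times> 4 set) set \<Rightarrow> nat" where
  "degree e = card e"


subsection \<open>Normal disc types\<close>

text \<open>
  A triangle type is identified with the vertex it cuts off. A quadrilateral type is identified
  with the pair of opposite edges it separates, that is, with the two edges it faces; it meets the
  other four edges.
\<close>

typedef quad = "{{A, - A} | A :: 4 set. card A = 2}"
proof -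
  have "card {1, 2 :: 4} = 2" by (simp add: card_insert_if)
  then show ?thesis by blast
qed

instance quad :: finite
proof
  have "inj Rep_quad" by (simp add: inj_def Rep_quad_inject)
  then show "finite (UNIV :: quad set)" by (rule finite_imageD[rotated]) simp
qed

definition quad_faces :: "quad \<Rightarrow> 4 set \<Rightarrow> bool" where
  "quad_faces q A \<longleftrightarrow> A \<in> Rep_quad q"

definition quad_meets :: "quad \<Rightarrow> 4 set \<Rightarrow> bool" where
  "quad_meets q A \<longleftrightarrow> card A = 2 \<and> A \<notin> Rep_quad q"

definition quad_facing :: "4 set \<Rightarrow> quad" where
  "quad_facing A = (THE q. quad_faces q A)"

text \<open>
  The normal arc type of face \<open>f\<close> around a vertex \<open>v \<noteq> f\<close> joins the two edges of the face
  at \<open>v\<close>. The triangle type containing it is \<open>v\<close>.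
\<close>

definition arc_quad :: "4 \<Rightarrow> 4 \<Rightarrow> quad" where
  "arc_quad f v = (THE q. \<forall>w. w \<noteq> v \<and> w \<noteq> f \<longrightarrow> quad_meets q {v, w})"

lemma quad_faces_iff:
  assumes "card A = 2"
  shows "quad_faces q A \<longleftrightarrow> Rep_quad q = {A, - A}"
  using Rep_quad[of q] by (auto simp: quad_faces_def)

lemma quad_faces_unique: "card A = 2 \<Longrightarrow> \<exists>!q. quad_faces q A"
proof (rule ex1I[of _ "Abs_quad {A, - A}"])
  assume A: "card A = 2"
  then have "Rep_quad (Abs_quad {A, - A}) = {A, - A}"
    by (intro Abs_quad_inverse) auto
  then show "quad_faces (Abs_quad {A, - A}) A" using A by (simp add: quad_faces_iff)
  show "q = Abs_quad {A, - A}" if "quad_faces q A" for q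
    using that A by (metis quad_faces_iff Rep_quad_inverse)
qed

lemma quad_faces_quad_facing: "card A = 2 \<Longrightarrow> quad_faces (quad_facing A) A"
  unfolding quad_facing_def by (rule theI'[OF quad_faces_unique])

lemma quad_facing_eqI: "card A = 2 \<Longrightarrow> quad_faces q A \<Longrightarrow> quad_facing A = q"
  using quad_faces_unique quad_faces_quad_facing by blast

lemma card_Compl_4: "card A = 2 \<Longrightarrow> card (- A :: 4 set) = 2"
  by (simp add: Compl_eq_Diff_UNIV card_Diff_subset)

lemma quad_facing_eq_iff:
  assumes "card A = 2" "card B = 2"
  shows "quad_facing A = quad_facing B \<longleftrightarrow> A = B \<or> A = - B"
proof
  assume "quad_facing A = quad_facing B"
  then have "quad_faces (quad_facing B) A" using quad_faces_quad_facing[OF assms(1)] by simp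
  moreover have "Rep_quad (quad_facing B) = {B, - B}"
    using quad_faces_quad_facing[OF assms(2)] quad_faces_iff[OF assms(2)] by blast
  ultimately show "A = B \<or> A = - B" by (simp add: quad_faces_def)
next
  assume *: "A = B \<or> A = - B"
  have "Rep_quad (quad_facing B) = {B, - B}"
    using quad_faces_quad_facing[OF assms(2)] quad_faces_iff[OF assms(2)] by blast
  then have "quad_faces (quad_facing B) A" using * by (auto simp: quad_faces_def)
  then show "quad_facing A = quad_facing B" by (rule quad_facing_eqI[OF assms(1)])
qed

lemma quad_obtain_edge:
  obtains w where "w \<noteq> v" "quad_faces q {v, w}"
proof -
  obtain A :: "4 set" where A: "card A = 2" "Rep_quad q = {A, - A}" using Rep_quad[of q] by blast
  define B where "B = (if v \<in> A then A else - A)"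
  have B: "card B = 2" "quad_faces q B" "v \<in> B"
    using A card_Compl_4[OF A(1)] by (simp_all add: B_def quad_faces_def)
  from B(1) obtain a b where ab: "B = {a, b}" "a \<noteq> b" by (auto simp: card_2_iff)
  show thesis
  proof (cases "v = a")
    case True
    then show ?thesis using that[of b] ab B(2) by simp
  next
    case False
    then have "B = {v, a}" using ab B(3) by blast
    then show ?thesis using that[of a] False B(2) by simp
  qed
qed

lemma UNIV_quad: "UNIV = {quad_facing {1, 2}, quad_facing {1, 3}, quad_facing {1, 4}}"
proof -
  have "q \<in> {quad_facing {1, 2}, quad_facing {1, 3}, quad_facing {1, 4}}" for q
  proof -
    obtain w :: 4 where w: "w \<noteq> 1" "quad_faces q {1, w}" by (rule quad_obtain_edge)
    then have "quad_facing {1, w} = q" by (intro quad_facing_eqI) auto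
    then show ?thesis using exhaust_4[of w] w(1) by auto
  qed
  then show ?thesis by blast
qed

lemma card_quad: "CARD(quad) = 3"
proof -
  have "quad_facing {1, a} \<noteq> quad_facing {1, b}" if "a \<noteq> b" "a \<noteq> 1" "b \<noteq> 1" for a b :: 4
  proof -
    have "{1, a} \<noteq> {1, b}" using that(1) by (auto simp: doubleton_eq_iff)
    moreover have "{1, a} \<noteq> - {1, b}" by blast
    ultimately show ?thesis using that by (subst quad_facing_eq_iff) auto
  qed
  then show ?thesis unfolding UNIV_quad by simp
qed

lemma meets_arc_iff:
  assumes "v \<noteq> f"
  shows "(\<forall>w. w \<noteq> v \<and> w \<noteq> f \<longrightarrow> quad_meets q {v, w}) \<longleftrightarrow> quad_faces q {v, f}"
proof
  assume *: "\<forall>w. w \<noteq> v \<and> w \<noteq> f \<longrightarrow> quad_meets q {v, w}"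
  obtain w where w: "w \<noteq> v" "quad_faces q {v, w}" by (rule quad_obtain_edge)
  then have "\<not> quad_meets q {v, w}" by (simp add: quad_faces_def quad_meets_def)
  then show "quad_faces q {v, f}" using * w by blast
next
  assume *: "quad_faces q {v, f}"
  then have "Rep_quad q = {{v, f}, - {v, f}}" using assms by (simp add: quad_faces_iff)
  then show "\<forall>w. w \<noteq> v \<and> w \<noteq> f \<longrightarrow> quad_meets q {v, w}"
  proof (intro allI impI)
    fix w assume w: "w \<noteq> v \<and> w \<noteq> f"
    then have "w \<in> {v, w}" "w \<notin> {v, f}" "v \<in> {v, w}" "v \<notin> - {v, f}" by blast+
    then have "{v, w} \<noteq> {v, f}" "{v, w} \<noteq> - {v, f}" by metis+
    moreover have "card {v, w} = 2" using w by auto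
    ultimately show "quad_meets q {v, w}" using \<open>Rep_quad q = _\<close> by (simp add: quad_meets_def)
  qed
qed

lemma arc_quad_eq: "v \<noteq> f \<Longrightarrow> arc_quad f v = quad_facing {v, f}"
  by (simp add: arc_quad_def quad_facing_def meets_arc_iff)


subsection \<open>Normal surface solution spaces\<close>

text \<open>Quadrilateral coordinates come first, triangle coordinates second.\<close>

type_synonym 'n normal_coords = "(real ^ ('n \<times> quad)) \<times> (real ^ ('n \<times> 4))"

definition C_space :: "'n::finite gluing \<Rightarrow> 'n normal_coords set" where
  "C_space T = {(x, y). \<forall>i f v. v \<noteq> f \<longrightarrow>
     x $ (i, arc_quad f v) + y $ (i, v) =
     x $ (adj T i f, arc_quad (glue T i f f) (glue T i f v)) + y $ (adj T i f, glue T i f v)}"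

definition PC_space :: "'n::finite gluing \<Rightarrow> 'n normal_coords set" where
  "PC_space T = C_space T \<inter> {(x, y). (\<forall>k. 0 \<le> x $ k) \<and> (\<forall>k. 0 \<le> y $ k) \<and>
     (\<Sum>k\<in>UNIV. x $ k) + (\<Sum>k\<in>UNIV. y $ k) = 1}"

definition vertex_solutions :: "'n::finite gluing \<Rightarrow> 'n normal_coords set" where
  "vertex_solutions T = {V. V extreme_point_of PC_space T}"

definition chi_tri :: "'n gluing \<Rightarrow> 'n \<times> 4 \<Rightarrow> real" where
  "chi_tri T = (\<lambda>(i, v). - 1 / 2 + (\<Sum>A | card A = 2 \<and> v \<in> A. 1 / degree (edge_class T i A)))"

definition chi_quad :: "'n gluing \<Rightarrow> 'n \<times> quad \<Rightarrow> real" where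
  "chi_quad T = (\<lambda>(i, q). - 1 + (\<Sum>A | quad_meets q A. 1 / degree (edge_class T i A)))"

definition chi_star :: "'n::finite gluing \<Rightarrow> 'n normal_coords \<Rightarrow> real" where
  "chi_star T = (\<lambda>(x, y). (\<Sum>k\<in>UNIV. x $ k * chi_quad T k) + (\<Sum>k\<in>UNIV. y $ k * chi_tri T k))"


subsection \<open>Semi-angle structures\<close>

definition semi_angle_structure :: "'n gluing \<Rightarrow> ('n \<times> quad \<Rightarrow> real) \<Rightarrow> bool" where
  "semi_angle_structure T \<alpha> \<longleftrightarrow> (\<forall>k. 0 \<le> \<alpha> k)
     \<and> (\<forall>i. (\<Sum>q\<in>UNIV. \<alpha> (i, q)) = pi)
     \<and> (\<forall>e\<in>edges T. (\<Sum>(i, A)\<in>e. \<alpha> (i, quad_facing A)) = 2 * pi)"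

end

theory Submission
  imports Defs "HOL-Library.Z2" "HOL-Library.Function_Algebras"
begin

text \<open>
  Up to one inequality the theorem is linear programming duality. Let \<open>t\<close> be the number of
  tetrahedra and \<open>e\<close> the number of edges. The edge weight of a solution at an edge of a
  tetrahedron, which for a normal surface counts the points of intersection, only depends on the edge
  of the triangulation (\<open>edge_weight_glued\<close>). Together with one number per tetrahedron it
  determines the quadrilateral coordinates (\<open>quad_coordinate_weights\<close>), every choice of these
  weights occurs (\<open>weights_solution\<close>), and \<open>\<chi>\<^sup>*\<close> is the sum of the edge weights minus the sum of
  the tetrahedron weights (\<open>chi_star_edges\<close>). So pairing a semi-angle structure \<open>\<alpha>\<close> with the
  quadrilateral coordinates of \<open>s\<close> yields \<open>- \<pi> \<chi>\<^sup>*(s)\<close> (\<open>semi_angle_pairing\<close>), which shows that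
  (1) implies (2). Conversely, if there is no semi-angle structure, then the point with all
  coordinates \<open>2 \<pi>\<close> is not among the vectors of edge sums of the non-negative \<open>\<alpha>\<close> with all
  tetrahedron sums \<open>\<pi>\<close>; these vectors form a compact convex set, and a separating functional is a
  choice of edge weights that violates (2) (\<open>semi_angle_structure_exists\<close>). That (4) implies
  (3) is the theorem of Krein and Milman.

  For (3) implies (2), triangle coordinates are made non-negative by adding a multiple of the total
  link, the solution with all triangle coordinates 1 and all quadrilateral coordinates 0. This is
  harmless if \<open>\<chi>\<^sup>*\<close> of the total link, which is \<open>2 e - 2 t\<close>, is not negative. Only the
  inequality \<open>t \<le> e\<close> (\<open>ideal_triangulation_tetrahedra_le_edges\<close>) needs topology.

  The inequality comes from computing the first cohomology with coefficients in \<open>\<int>/2\<close> of a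
  neighbourhood of the ends of \<open>M\<close> in two ways. A cohomology class is represented by a family of
  functions on open sets that differ by locally constant functions (\<open>cocycle\<close>), and it vanishes if
  one function differs locally from all of them by constants (\<open>trivializes\<close>).

  On the side of the triangulation, the links of the ideal vertices are glued from \<open>4 t\<close> triangles
  along \<open>6 t\<close> arcs. Counting cellular cochains shows that their group \<open>Z\<close> of 1-cocycles has at
  least \<open>4\<^sup>t k\<close> elements, where \<open>k\<close> is the number of 0-cocycles (\<open>arc_cocycles_large\<close>), and
  that the group \<open>B\<close> of coboundaries has at most \<open>4\<^sup>e / k\<close> elements (\<open>coboundaries_small\<close>,
  \<open>edge_end_functions_small\<close>). Each element of \<open>Z\<close> spreads out to a cocycle on the ends of \<open>M\<close>
  (\<open>end_cocycle\<close>), and this cocycle is trivial near infinity only if it comes from \<open>B\<close>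
  (\<open>trivial_near_end\<close>).

  On the side of the compact manifold \<open>N\<close>, a cocycle near infinity extends over the boundary, since
  removing the boundary from a small half ball leaves a simply connected set
  (\<open>boundary_cocycle\<close>), and it is trivial near the boundary if its extension is trivial on the
  boundary (\<open>germs_glue\<close>). A torus or a Klein bottle is a square with identified sides, so that a
  class on it is determined by two elements of \<open>\<int>/2\<close> (\<open>square_quotient_holonomy\<close>). Hence
  \<open>|Z| \<le> 4\<^sup>n |B|\<close> if the boundary has \<open>n\<close> components (\<open>arc_cocycles_small\<close>). Moreover
  \<open>2\<^sup>n \<le> k\<close>, since locally constant functions on the boundary extend inwards
  (\<open>components_le_corner_functions\<close>). Altogether
  \<open>4\<^sup>t k\<^sup>2 \<le> k |Z| \<le> 4\<^sup>n k |B| \<le> 4\<^sup>n 4\<^sup>e \<le> k\<^sup>2 4\<^sup>e\<close>.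
\<close>

section \<open>Locally constant functions and cocycles\<close>

text \<open>
  Relative to the subspace \<open>S\<close>, so that local sections can be total functions with arbitrary values
  outside their domains.
\<close>

definition locally_constant_on :: "'a topology \<Rightarrow> 'a set \<Rightarrow> ('a \<Rightarrow> 'b) \<Rightarrow> bool" where
  "locally_constant_on X S f \<longleftrightarrow>
     (\<forall>x\<in>topspace X \<inter> S. \<exists>V. openin X V \<and> x \<in> V \<and> (\<forall>y\<in>V \<inter> S. f y = f x))"

lemma locally_constant_onI:
  assumes "\<And>x. x \<in> topspace X \<Longrightarrow> x \<in> S \<Longrightarrow> \<exists>V. openin X V \<and> x \<in> V \<and> (\<forall>y\<in>V \<inter> S. f y = f x)"
  shows "locally_constant_on X S f"
  unfolding locally_constant_on_def
proof
  fix x assume "x \<in> topspace X \<inter> S"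
  then show "\<exists>V. openin X V \<and> x \<in> V \<and> (\<forall>y\<in>V \<inter> S. f y = f x)" by (intro assms) auto
qed

lemma locally_constant_onE:
  assumes "locally_constant_on X S f" "x \<in> topspace X" "x \<in> S"
  obtains V where "openin X V" "x \<in> V" "\<forall>y\<in>V \<inter> S. f y = f x"
proof -
  have "\<exists>V. openin X V \<and> x \<in> V \<and> (\<forall>y\<in>V \<inter> S. f y = f x)"
    using assms(1) unfolding locally_constant_on_def by (rule bspec) (use assms(2,3) in simp)
  then show ?thesis using that by (elim exE conjE) simp
qed

lemma locally_constant_on_subset:
  "locally_constant_on X S f \<Longrightarrow> S' \<subseteq> S \<Longrightarrow> locally_constant_on X S' f"
  unfolding locally_constant_on_def by (metis IntE IntI subsetD)

lemma locally_constant_on_const: "locally_constant_on X S (\<lambda>x. c)"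
  unfolding locally_constant_on_def by (metis IntE openin_topspace)

lemma locally_constant_on_combine:
  assumes "locally_constant_on X S f" "locally_constant_on X S g"
  shows "locally_constant_on X S (\<lambda>x. G (f x) (g x))"
proof (rule locally_constant_onI)
  fix x assume x: "x \<in> topspace X" "x \<in> S"
  obtain V where V: "openin X V" "x \<in> V" "\<forall>y\<in>V \<inter> S. f y = f x"
    by (rule locally_constant_onE[OF assms(1) x]) (rule that, assumption+)
  obtain W where W: "openin X W" "x \<in> W" "\<forall>y\<in>W \<inter> S. g y = g x"
    by (rule locally_constant_onE[OF assms(2) x]) (rule that, assumption+)
  show "\<exists>V. openin X V \<and> x \<in> V \<and> (\<forall>y\<in>V \<inter> S. G (f y) (g y) = G (f x) (g x))"
    using V W by (intro exI[of _ "V \<inter> W"]) auto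
qed

lemma locally_constant_on_cong:
  assumes "\<And>x. x \<in> topspace X \<Longrightarrow> x \<in> S \<Longrightarrow> f x = g x"
  shows "locally_constant_on X S f \<longleftrightarrow> locally_constant_on X S g"
proof -
  have *: "locally_constant_on X S g" if f: "locally_constant_on X S f"
    and eq: "\<And>x. x \<in> topspace X \<Longrightarrow> x \<in> S \<Longrightarrow> f x = g x" for f g
  proof (rule locally_constant_onI)
    fix x assume x: "x \<in> topspace X" "x \<in> S"
    obtain V where V: "openin X V" "x \<in> V" "\<forall>y\<in>V \<inter> S. f y = f x"
      by (rule locally_constant_onE[OF f x]) (rule that, assumption+)
    have "g y = g x" if "y \<in> V \<inter> S" for y
    proof -
      have "y \<in> topspace X" using that openin_subset[OF V(1)] by blast
      moreover have "f y = f x" using V(3) that by blast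
      ultimately show ?thesis using eq[of y] eq[OF x] that by auto
    qed
    then show "\<exists>V. openin X V \<and> x \<in> V \<and> (\<forall>y\<in>V \<inter> S. g y = g x)" using V by blast
  qed
  show ?thesis using *[of f g] *[of g f] assms by auto
qed

lemma locally_constant_on_pullback:
  assumes "locally_constant_on Y S f" "continuous_map X Y p" "S' \<subseteq> {x. p x \<in> S}"
  shows "locally_constant_on X S' (\<lambda>x. f (p x))"
proof (rule locally_constant_onI)
  fix x assume x: "x \<in> topspace X" "x \<in> S'"
  then have "p x \<in> topspace Y" "p x \<in> S"
    using assms(2,3) by (auto simp: continuous_map_def)
  then obtain V where V: "openin Y V" "p x \<in> V" "\<forall>y\<in>V \<inter> S. f y = f (p x)"
    by (rule locally_constant_onE[OF assms(1)]) (rule that, assumption+)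
  have "openin X {x \<in> topspace X. p x \<in> V}"
    using openin_continuous_map_preimage[OF assms(2) V(1)] .
  then show "\<exists>V. openin X V \<and> x \<in> V \<and> (\<forall>y\<in>V \<inter> S'. f (p y) = f (p x))"
    using V x assms(3) by (intro exI[of _ "{x \<in> topspace X. p x \<in> V}"]) auto
qed

lemma locally_constant_on_subtopology:
  assumes "S \<subseteq> D"
  shows "locally_constant_on (subtopology X D) S f \<longleftrightarrow> locally_constant_on X S f"
proof
  assume L: "locally_constant_on (subtopology X D) S f"
  show "locally_constant_on X S f"
  proof (rule locally_constant_onI)
    fix x assume x: "x \<in> topspace X" "x \<in> S"
    then have "x \<in> topspace (subtopology X D)" using assms by auto
    then obtain V where V: "openin (subtopology X D) V" "x \<in> V"
      "\<forall>y\<in>V \<inter> S. f y = f x"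
      by (rule locally_constant_onE[OF L _ x(2)]) (rule that, assumption+)
    then obtain V' where "openin X V'" "V = V' \<inter> D" by (auto simp: openin_subtopology)
    then show "\<exists>V. openin X V \<and> x \<in> V \<and> (\<forall>y\<in>V \<inter> S. f y = f x)"
      using V assms by (intro exI[of _ V']) auto
  qed
next
  assume L: "locally_constant_on X S f"
  show "locally_constant_on (subtopology X D) S f"
  proof (rule locally_constant_onI)
    fix x assume x: "x \<in> topspace (subtopology X D)" "x \<in> S"
    then have xX: "x \<in> topspace X" "x \<in> D" by auto
    obtain V where V: "openin X V" "x \<in> V" "\<forall>y\<in>V \<inter> S. f y = f x"
      by (rule locally_constant_onE[OF L xX(1) x(2)]) (rule that, assumption+)
    then show "\<exists>V. openin (subtopology X D) V \<and> x \<in> V \<and> (\<forall>y\<in>V \<inter> S. f y = f x)"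
      using xX by (intro exI[of _ "V \<inter> D"]) (auto simp: openin_subtopology)
  qed
qed

text \<open>
  The neighbourhoods on which the function keeps the value \<open>f x\<close>, and those on which it takes
  some other value, are two open sets that would disconnect \<open>C\<close>.
\<close>

lemma locally_constant_on_connectedin:
  assumes "locally_constant_on X S f" "connectedin X C" "C \<subseteq> S" "x \<in> C" "y \<in> C"
  shows "f x = f y"
proof (rule ccontr)
  assume ne: "f x \<noteq> f y"
  have CX: "C \<subseteq> topspace X" using assms(2) by (rule connectedin_subset_topspace)
  have "\<forall>z\<in>C. \<exists>V. openin X V \<and> z \<in> V \<and> (\<forall>y\<in>V \<inter> S. f y = f z)"
    using assms(1,3) CX unfolding locally_constant_on_def by blast
  then obtain V where V: "\<And>z. z \<in> C \<Longrightarrow> openin X (V z)" "\<And>z. z \<in> C \<Longrightarrow> z \<in> V z"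
    "\<And>z y. z \<in> C \<Longrightarrow> y \<in> V z \<Longrightarrow> y \<in> S \<Longrightarrow> f y = f z" by (metis IntI)
  define A where "A = (\<Union>z\<in>{z \<in> C. f z = f x}. V z)"
  define B where "B = (\<Union>z\<in>{z \<in> C. f z \<noteq> f x}. V z)"
  have "openin X A" "openin X B" unfolding A_def B_def using V(1) by auto
  moreover have "C \<subseteq> A \<union> B" unfolding A_def B_def using V(2) by blast
  moreover have "A \<inter> B \<inter> C = {}"
  proof -
    have "f z = f x" if "z \<in> A" "z \<in> C" for z
      using that V(3) assms(3) unfolding A_def by auto
    moreover have "f z \<noteq> f x" if "z \<in> B" "z \<in> C" for z
      using that V(3) assms(3) unfolding B_def by auto
    ultimately show ?thesis by blast
  qed
  moreover have "x \<in> A \<inter> C" using V(2)[OF assms(4)] assms(4) by (auto simp: A_def)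
  then have "A \<inter> C \<noteq> {}" by blast
  moreover have "y \<in> B \<inter> C"
    using V(2)[OF assms(5)] assms(5) ne by (auto simp: B_def intro!: bexI[of _ y])
  then have "B \<inter> C \<noteq> {}" by blast
  ultimately show False using assms(2) unfolding connectedin by metis
qed

lemma locally_constant_on_quotient:
  assumes q: "quotient_map X Y p" and S: "openin Y S"
    and L: "locally_constant_on X {x \<in> topspace X. p x \<in> S} (\<lambda>x. f (p x))"
  shows "locally_constant_on Y S f"
proof (rule locally_constant_onI)
  fix y assume y: "y \<in> topspace Y" "y \<in> S"
  define V where "V = {z \<in> S. f z = f y}"
  have VY: "V \<subseteq> topspace Y" using openin_subset[OF S] by (auto simp: V_def)
  have "openin X {x \<in> topspace X. p x \<in> V}"
  proof (subst openin_subopen, intro ballI)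
    fix x assume "x \<in> {x \<in> topspace X. p x \<in> V}"
    then have x: "x \<in> topspace X" "p x \<in> S" "f (p x) = f y" by (auto simp: V_def)
    have "x \<in> {x \<in> topspace X. p x \<in> S}" using x by simp
    then obtain O' where O': "openin X O'" "x \<in> O'"
      "\<forall>z\<in>O' \<inter> {x \<in> topspace X. p x \<in> S}. f (p z) = f (p x)"
      by (rule locally_constant_onE[OF L x(1)]) (rule that, assumption+)
    have "openin X {x \<in> topspace X. p x \<in> S}"
      using openin_continuous_map_preimage[OF quotient_imp_continuous_map[OF q] S] .
    then have "openin X (O' \<inter> {x \<in> topspace X. p x \<in> S})" using O'(1) by blast
    moreover have "x \<in> O' \<inter> {x \<in> topspace X. p x \<in> S}" using x O'(2) by blast
    moreover have "O' \<inter> {x \<in> topspace X. p x \<in> S} \<subseteq> {x \<in> topspace X. p x \<in> V}"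
    proof
      fix z assume z: "z \<in> O' \<inter> {x \<in> topspace X. p x \<in> S}"
      then have "f (p z) = f y" using O'(3) x(3) by metis
      then show "z \<in> {x \<in> topspace X. p x \<in> V}" using z by (simp add: V_def)
    qed
    ultimately show "\<exists>T. openin X T \<and> x \<in> T \<and> T \<subseteq> {x \<in> topspace X. p x \<in> V}" by blast
  qed
  then have "openin Y V" using q VY unfolding quotient_map_def by blast
  then show "\<exists>V. openin Y V \<and> y \<in> V \<and> (\<forall>z\<in>V \<inter> S. f z = f y)"
    using y by (intro exI[of _ V]) (auto simp: V_def)
qed


text \<open>
  A Cech 1-cocycle for the cover \<open>U\<close> of the union of the \<open>U k\<close>, presented by local sections \<open>F k\<close>
  of the corresponding principal bundle with discrete structure group; \<open>F k\<close> is only relevant on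
  \<open>U k\<close>. Keeping the cover apart from the functions makes the cocycles over one cover a group.
\<close>

definition cocycle ::
  "'a topology \<Rightarrow> ('k \<Rightarrow> 'a set) \<Rightarrow> ('k \<Rightarrow> 'a \<Rightarrow> 'g::ab_group_add) \<Rightarrow> bool" where
  "cocycle X U F \<longleftrightarrow> (\<forall>k. openin X (U k)) \<and>
     (\<forall>k l. locally_constant_on X (U k \<inter> U l) (\<lambda>x. F k x - F l x))"

text \<open>
  A global section over \<open>A\<close>, that is, a reason for the class to vanish on \<open>A\<close>.
\<close>

definition trivializes ::
  "'a topology \<Rightarrow> ('k \<Rightarrow> 'a set) \<Rightarrow> ('k \<Rightarrow> 'a \<Rightarrow> 'g::ab_group_add) \<Rightarrow> 'a set \<Rightarrow> ('a \<Rightarrow> 'g) \<Rightarrow> bool" where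
  "trivializes X U F A h \<longleftrightarrow> (\<forall>k. locally_constant_on X (U k \<inter> A) (\<lambda>x. h x - F k x))"

lemma trivializes_subset: "trivializes X U F A h \<Longrightarrow> A' \<subseteq> A \<Longrightarrow> trivializes X U F A' h"
  unfolding trivializes_def by (meson Int_mono locally_constant_on_subset order_refl)

lemma trivializes_diff:
  assumes "trivializes X U F A h" "trivializes X U F' A h'"
  shows "trivializes X U (\<lambda>k x. F k x - F' k x) A (\<lambda>x. h x - h' x)"
  unfolding trivializes_def
proof
  fix k
  have "locally_constant_on X (U k \<inter> A) (\<lambda>x. (h x - F k x) - (h' x - F' k x))"
    using assms locally_constant_on_combine[of X _ _ _ "(-)"] unfolding trivializes_def by blast
  then show "locally_constant_on X (U k \<inter> A) (\<lambda>x. h x - h' x - (F k x - F' k x))"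
    by (simp add: algebra_simps)
qed

lemma trivializes_subtopology:
  assumes "A \<subseteq> D"
  shows "trivializes (subtopology X D) U F A h \<longleftrightarrow> trivializes X U F A h"
  unfolding trivializes_def using assms locally_constant_on_subtopology
  by (metis inf.coboundedI2)

lemma cocycle_pullback:
  assumes "cocycle Y U F" "continuous_map X Y p"
  shows "cocycle X (\<lambda>k. {x \<in> topspace X. p x \<in> U k}) (\<lambda>k x. F k (p x))"
  unfolding cocycle_def
proof (intro conjI allI)
  show "openin X {x \<in> topspace X. p x \<in> U k}" for k
    using assms openin_continuous_map_preimage unfolding cocycle_def by blast
  show "locally_constant_on X ({x \<in> topspace X. p x \<in> U k} \<inter> {x \<in> topspace X. p x \<in> U l})
     (\<lambda>x. F k (p x) - F l (p x))" for k l
    by (rule locally_constant_on_pullback[of Y "U k \<inter> U l" "\<lambda>x. F k x - F l x" X p])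
      (use assms in \<open>auto simp: cocycle_def\<close>)
qed

lemma trivializes_pullback:
  assumes "trivializes Y U F A h" "continuous_map X Y p" "p ` A' \<subseteq> A"
    and "\<And>k. U' k \<inter> A' \<subseteq> {x. p x \<in> U k}"
  shows "trivializes X U' (\<lambda>k x. F k (p x)) A' (\<lambda>x. h (p x))"
  unfolding trivializes_def
proof
  fix k
  show "locally_constant_on X (U' k \<inter> A') (\<lambda>x. h (p x) - F k (p x))"
    using assms(1) unfolding trivializes_def
    by (intro locally_constant_on_pullback[OF _ assms(2), of "U k \<inter> A"])
      (use assms(3,4) in blast)+
qed

lemma trivializations_differ_locally_constant:
  assumes U: "\<And>k. openin X (U k)" and cov: "A \<inter> B \<subseteq> (\<Union>k. U k)"
    and f: "trivializes X U F A f" and g: "trivializes X U F B g"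
  shows "locally_constant_on X (A \<inter> B) (\<lambda>x. f x - g x)"
proof (rule locally_constant_onI)
  fix x assume x: "x \<in> topspace X" "x \<in> A \<inter> B"
  then obtain k where k: "x \<in> U k" using cov by blast
  have "locally_constant_on X (U k \<inter> (A \<inter> B)) (\<lambda>x. (f x - F k x) - (g x - F k x))"
    using f g unfolding trivializes_def
    by (intro locally_constant_on_combine[of X _ "\<lambda>x. f x - F k x" "\<lambda>x. g x - F k x" "(-)"])
      (meson locally_constant_on_subset Int_lower1 Int_lower2 Int_mono order_refl)+
  then have "locally_constant_on X (U k \<inter> (A \<inter> B)) (\<lambda>x. f x - g x)" by simp
  moreover have "x \<in> U k \<inter> (A \<inter> B)" using x k by blast
  ultimately obtain V where V: "openin X V" "x \<in> V"
    "\<forall>y\<in>V \<inter> (U k \<inter> (A \<inter> B)). f y - g y = f x - g x"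
    by (rule locally_constant_onE[OF _ x(1)]) (rule that, assumption+)
  then show "\<exists>V. openin X V \<and> x \<in> V \<and> (\<forall>y\<in>V \<inter> (A \<inter> B). f y - g y = f x - g x)"
    using U[of k] k by (intro exI[of _ "V \<inter> U k"]) blast
qed

text \<open>
  A single step of Mayer-Vietoris: on the connected intersection the two trivializations differ by
  a constant, which can be absorbed into one of them.
\<close>

lemma trivializes_glue:
  assumes U: "\<And>k. openin X (U k)" and cov: "A \<union> B \<subseteq> (\<Union>k. U k)"
    and cl: "closedin X A" "closedin X B" and con: "connectedin X (A \<inter> B)"
    and f: "trivializes X U F A f" and g: "trivializes X U F B g"
  shows "\<exists>h. trivializes X U F (A \<union> B) h"
proof -
  have lc: "locally_constant_on X (A \<inter> B) (\<lambda>x. f x - g x)"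
    using trivializations_differ_locally_constant[OF U _ f g] cov by blast
  obtain d where d: "\<And>x. x \<in> A \<inter> B \<Longrightarrow> f x - g x = d"
  proof (cases "A \<inter> B = {}")
    case True then show ?thesis using that by blast
  next
    case False
    then obtain x where "x \<in> A \<inter> B" by blast
    then show ?thesis
      using that[of "f x - g x"] locally_constant_on_connectedin[OF lc con] by blast
  qed
  define h where "h x = (if x \<in> A then f x else g x + d)" for x
  have hB: "h x = g x + d" if "x \<in> B" for x
    using d[of x] that by (auto simp: h_def algebra_simps)
  have "locally_constant_on X (U k \<inter> (A \<union> B)) (\<lambda>x. h x - F k x)" for k
  proof (rule locally_constant_onI)
    fix x assume x: "x \<in> topspace X" "x \<in> U k \<inter> (A \<union> B)"
    have *: "\<exists>V. openin X V \<and> x \<in> V \<and> (\<forall>y\<in>V \<inter> (U k \<inter> C). h y - F k y = h x - F k x)"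
      if C: "closedin X C" and hC: "\<And>y. y \<in> C \<Longrightarrow> h y = c y + e"
        and tr: "trivializes X U F C c" for C c e
    proof (cases "x \<in> C")
      case True
      have "locally_constant_on X (U k \<inter> C) (\<lambda>x. c x - F k x)"
        using tr by (simp add: trivializes_def)
      moreover have "x \<in> U k \<inter> C" using x True by blast
      ultimately obtain V where "openin X V" "x \<in> V"
        "\<forall>y\<in>V \<inter> (U k \<inter> C). c y - F k y = c x - F k x"
        by (rule locally_constant_onE[OF _ x(1)]) (rule that, assumption+)
      moreover have "h y - F k y = (c y - F k y) + e" if "y \<in> C" for y
        using hC[OF that] by (simp add: algebra_simps)
      ultimately show ?thesis using True by (metis IntD2)
    next
      case False
      then show ?thesis using C x
        by (intro exI[of _ "topspace X - C"]) auto
    qed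
    obtain V where V: "openin X V" "x \<in> V"
      "\<forall>y\<in>V \<inter> (U k \<inter> A). h y - F k y = h x - F k x"
      using *[OF cl(1) _ f, of 0] by (auto simp: h_def)
    obtain W where W: "openin X W" "x \<in> W"
      "\<forall>y\<in>W \<inter> (U k \<inter> B). h y - F k y = h x - F k x"
      using *[OF cl(2) hB g] by auto
    show "\<exists>V. openin X V \<and> x \<in> V \<and>
      (\<forall>y\<in>V \<inter> (U k \<inter> (A \<union> B)). h y - F k y = h x - F k x)"
      using V W by (intro exI[of _ "V \<inter> W"]) blast
  qed
  then show ?thesis unfolding trivializes_def by blast
qed

lemma trivializes_local_section:
  assumes "cocycle X U F" "A \<subseteq> U k"
  shows "trivializes X U F A (F k)"
  unfolding trivializes_def
proof
  fix l
  have "locally_constant_on X (U k \<inter> U l) (\<lambda>x. F k x - F l x)"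
    using assms(1) by (simp add: cocycle_def)
  then show "locally_constant_on X (U l \<inter> A) (\<lambda>x. F k x - F l x)"
    by (rule locally_constant_on_subset) (use assms(2) in blast)
qed

section \<open>Cocycles over boxes\<close>

text \<open>
  By compactness a box whose sides are all short lies in one \<open>U k\<close>. Two halves of a box meet
  in a box of smaller dimension, which is connected, so that trivializations of the halves can be
  glued. Thus the bound on the sides can be removed, one coordinate after the other and by doubling.
\<close>

lemma trivial_over_cbox:
  fixes a b :: "'e::euclidean_space"
  assumes co: "cocycle (top_of_set S) U F" and cov: "cbox a b \<subseteq> (\<Union>k. U k)"
    and S: "cbox a b \<subseteq> S"
  shows "\<exists>h. trivializes (top_of_set S) U F (cbox a b) h"
proof -
  let ?P = "\<lambda>A. \<exists>h. trivializes (top_of_set S) U F A h"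
  have Uop: "\<And>k. openin (top_of_set S) (U k)" using co by (simp add: cocycle_def)
  then have "\<forall>k. \<exists>V. open V \<and> U k = S \<inter> V" by (simp add: openin_open)
  from choice[OF this] obtain V where V: "\<And>k. open (V k)" "\<And>k. U k = S \<inter> V k" by blast
  have VC: "cbox a b \<subseteq> \<Union>(range V)" using cov V(2) by blast
  have ex: "\<exists>\<delta>>0. \<forall>T. T \<subseteq> cbox a b \<longrightarrow> diameter T < \<delta> \<longrightarrow> (\<exists>B \<in> range V. T \<subseteq> B)"
    by (rule Lebesgue_number_lemma[OF compact_cbox _ VC]) (use V(1) in \<open>blast+\<close>)
  then obtain \<delta> where \<delta>: "\<delta> > 0"
    "\<And>T. \<lbrakk>T \<subseteq> cbox a b; diameter T < \<delta>\<rbrakk> \<Longrightarrow> \<exists>B \<in> range V. T \<subseteq> B"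
    by blast
  (* a box with sides at most this long has diameter at most \<delta> / 2, by comparison with the l1 norm *)
  define \<epsilon> where "\<epsilon> = \<delta> / (2 * DIM('e))"
  have \<epsilon>: "\<epsilon> > 0" using \<delta>(1) by (simp add: \<epsilon>_def)
  have Q: "finite J \<Longrightarrow> J \<subseteq> Basis \<Longrightarrow> \<forall>c d. cbox c d \<subseteq> cbox a b \<longrightarrow>
      (\<forall>i\<in>Basis - J. d \<bullet> i - c \<bullet> i \<le> \<epsilon>) \<longrightarrow> ?P (cbox c d)" for J
  proof (induction J rule: finite_induct)
    case empty
    show ?case
    proof (intro allI impI)
      fix c d assume cd: "cbox c d \<subseteq> cbox a b" "\<forall>i\<in>Basis - {}. d \<bullet> i - c \<bullet> i \<le> \<epsilon>"
      have "diameter (cbox c d) \<le> \<delta> / 2"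
      proof (rule diameter_le)
        show "cbox c d \<noteq> {} \<or> 0 \<le> \<delta> / 2" using \<delta>(1) by simp
        fix x y assume xy: "x \<in> cbox c d" "y \<in> cbox c d"
        have "norm (x - y) \<le> (\<Sum>i\<in>Basis. \<bar>(x - y) \<bullet> i\<bar>)" by (rule norm_le_l1)
        also have "\<dots> \<le> (\<Sum>i\<in>(Basis::'e set). \<epsilon>)"
        proof (rule sum_mono)
          fix i :: 'e assume i: "i \<in> Basis"
          then have "c \<bullet> i \<le> x \<bullet> i" "x \<bullet> i \<le> d \<bullet> i" "c \<bullet> i \<le> y \<bullet> i" "y \<bullet> i \<le> d \<bullet> i"
            using xy by (auto simp: mem_box)
          moreover have "d \<bullet> i - c \<bullet> i \<le> \<epsilon>" using cd(2) i by blast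
          ultimately show "\<bar>(x - y) \<bullet> i\<bar> \<le> \<epsilon>" by (simp add: inner_diff_left)
        qed
        also have "\<dots> = \<delta> / 2" by (simp add: \<epsilon>_def)
        finally show "norm (x - y) \<le> \<delta> / 2" .
      qed
      then have "diameter (cbox c d) < \<delta>" using \<delta>(1) by linarith
      then obtain k where "cbox c d \<subseteq> V k" using \<delta>(2)[OF cd(1)] by blast
      then have "cbox c d \<subseteq> U k" using V(2) cd(1) S by blast
      then show "?P (cbox c d)" using trivializes_local_section[OF co] by blast
    qed
  next
    case (insert j J)
    have IH: "\<And>c d. cbox c d \<subseteq> cbox a b \<Longrightarrow> (\<forall>i\<in>Basis - J. d \<bullet> i - c \<bullet> i \<le> \<epsilon>) \<Longrightarrow> ?P (cbox c d)"
      using insert by blast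
    have j: "j \<in> Basis" using insert by blast
    have half: "\<forall>c d. cbox c d \<subseteq> cbox a b \<longrightarrow> d \<bullet> j - c \<bullet> j \<le> 2 ^ m * \<epsilon> \<longrightarrow>
        (\<forall>i\<in>Basis - insert j J. d \<bullet> i - c \<bullet> i \<le> \<epsilon>) \<longrightarrow> ?P (cbox c d)" for m
    proof (induction m)
      case 0
      show ?case
      proof (intro allI impI)
        fix c d assume "cbox c d \<subseteq> cbox a b" "d \<bullet> j - c \<bullet> j \<le> 2 ^ 0 * \<epsilon>"
          "\<forall>i\<in>Basis - insert j J. d \<bullet> i - c \<bullet> i \<le> \<epsilon>"
        then show "?P (cbox c d)" by (intro IH) auto
      qed
    next
      case (Suc m)
      show ?case
      proof (intro allI impI)
        fix c d assume cd: "cbox c d \<subseteq> cbox a b" "d \<bullet> j - c \<bullet> j \<le> 2 ^ Suc m * \<epsilon>"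
          "\<forall>i\<in>Basis - insert j J. d \<bullet> i - c \<bullet> i \<le> \<epsilon>"
        define r where "r = (c \<bullet> j + d \<bullet> j) / 2"
        let ?A = "cbox c d \<inter> {x. x \<bullet> j \<le> r}"
        let ?B = "cbox c d \<inter> {x. x \<bullet> j \<ge> r}"
        have inner_eq: "(\<Sum>i\<in>Basis. f i *\<^sub>R i) \<bullet> i = f i" if "i \<in> Basis" for f and i :: 'e
          using that by simp
        have "?P ?A"
        proof -
          define d' where "d' = (\<Sum>i\<in>Basis. (if i = j then min (d \<bullet> j) r else d \<bullet> i) *\<^sub>R i)"
          have A: "?A = cbox c d'" unfolding d'_def using interval_split(1)[OF j] by blast
          have d': "d' \<bullet> i = (if i = j then min (d \<bullet> j) r else d \<bullet> i)" if "i \<in> Basis" for i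
            unfolding d'_def using inner_eq[OF that] by simp
          show ?thesis unfolding A
          proof (rule Suc.IH[rule_format])
            show "cbox c d' \<subseteq> cbox a b" using A cd(1) by blast
            show "d' \<bullet> j - c \<bullet> j \<le> 2 ^ m * \<epsilon>"
              using cd(2) d'[OF j] by (simp add: r_def field_simps min_def) 
            show "d' \<bullet> i - c \<bullet> i \<le> \<epsilon>" if "i \<in> Basis - insert j J" for i
              using cd(3) d'[of i] that by auto
          qed
        qed
        moreover have "?P ?B"
        proof -
          define c' where "c' = (\<Sum>i\<in>Basis. (if i = j then max (c \<bullet> j) r else c \<bullet> i) *\<^sub>R i)"
          have B: "?B = cbox c' d" unfolding c'_def using interval_split(2)[OF j] by blast
          have c': "c' \<bullet> i = (if i = j then max (c \<bullet> j) r else c \<bullet> i)" if "i \<in> Basis" for i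
            unfolding c'_def using inner_eq[OF that] by simp
          show ?thesis unfolding B
          proof (rule Suc.IH[rule_format])
            show "cbox c' d \<subseteq> cbox a b" using B cd(1) by blast
            show "d \<bullet> j - c' \<bullet> j \<le> 2 ^ m * \<epsilon>"
              using cd(2) c'[OF j] by (simp add: r_def field_simps max_def) 
            show "d \<bullet> i - c' \<bullet> i \<le> \<epsilon>" if "i \<in> Basis - insert j J" for i
              using cd(3) c'[of i] that by auto
          qed
        qed
        moreover have AB: "?A \<union> ?B = cbox c d" by auto
        moreover have "\<exists>h. trivializes (top_of_set S) U F (?A \<union> ?B) h"
          if "trivializes (top_of_set S) U F ?A f" "trivializes (top_of_set S) U F ?B g" for f g
        proof (rule trivializes_glue[OF Uop _ _ _ _ that])
          show "?A \<union> ?B \<subseteq> (\<Union>k. U k)" using AB cd(1) cov by blast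
          have "closed {x. x \<bullet> j \<le> r}" "closed {x. x \<bullet> j \<ge> r}"
            by (simp_all add: closed_halfspace_component_le closed_halfspace_component_ge)
          then show "closedin (top_of_set S) ?A" "closedin (top_of_set S) ?B"
            using cd(1) S by (auto intro!: closed_subset)
          have "?A \<inter> ?B = cbox c d \<inter> {x. x \<bullet> j = r}" by auto
          moreover have "convex (cbox c d \<inter> {x. x \<bullet> j = r})"
            using convex_hyperplane[of j r] by (intro convex_Int) (simp_all add: inner_commute)
          ultimately show "connectedin (top_of_set S) (?A \<inter> ?B)"
            using cd(1) S by (auto simp: connectedin_subtopology intro: convex_connected)
        qed
        ultimately show "?P (cbox c d)" by metis
      qed
    qed
    show ?case
    proof (intro allI impI)
      fix c d assume cd: "cbox c d \<subseteq> cbox a b" "\<forall>i\<in>Basis - insert j J. d \<bullet> i - c \<bullet> i \<le> \<epsilon>"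
      obtain m :: nat where "(d \<bullet> j - c \<bullet> j) / \<epsilon> < 2 ^ m"
        using real_arch_pow[of 2] by auto
      then have "d \<bullet> j - c \<bullet> j \<le> 2 ^ m * \<epsilon>" using \<epsilon> by (simp add: field_simps)
      then show "?P (cbox c d)" using half[of m] cd by blast
    qed
  qed
  show ?thesis using Q[of Basis] by auto
qed

text \<open>
  An open box is exhausted by closed boxes around its centre. Trivializations over these are unique
  if they are required to vanish at the centre, and hence they are compatible.
\<close>

lemma trivial_over_box:
  fixes a b :: "'e::euclidean_space"
  assumes co: "cocycle (top_of_set (box a b)) U F" and cov: "box a b \<subseteq> (\<Union>k. U k)"
  shows "\<exists>h. trivializes (top_of_set (box a b)) U F (box a b) h"
proof (cases "box a b = {}")
  case True
  then show ?thesis by (auto simp: trivializes_def locally_constant_on_def)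
next
  case False
  let ?X = "top_of_set (box a b)"
  define z where "z = (1/2) *\<^sub>R (a + b)"
  have ab: "a \<bullet> i < b \<bullet> i" if "i \<in> Basis" for i using False that by (simp add: box_ne_empty)
  have zi: "z \<bullet> i = (a \<bullet> i + b \<bullet> i) / 2" for i by (simp add: z_def inner_add_left)
  define l where "l n = a + (1 / (real n + 2)) *\<^sub>R (b - a)" for n
  define u where "u n = b - (1 / (real n + 2)) *\<^sub>R (b - a)" for n
  define C where "C n = cbox (l n) (u n)" for n
  have li: "l n \<bullet> i = a \<bullet> i + (b \<bullet> i - a \<bullet> i) / (real n + 2)"
    and ui: "u n \<bullet> i = b \<bullet> i - (b \<bullet> i - a \<bullet> i) / (real n + 2)" for n i
    by (simp_all add: l_def u_def inner_add_left inner_diff_left)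
  have sub: "C n \<subseteq> box a b" for n
  proof
    fix x assume x: "x \<in> C n"
    have "a \<bullet> i < x \<bullet> i \<and> x \<bullet> i < b \<bullet> i" if i: "i \<in> Basis" for i
    proof -
      have "0 < (b \<bullet> i - a \<bullet> i) / (real n + 2)" using ab[OF i] by simp
      moreover have "l n \<bullet> i \<le> x \<bullet> i" "x \<bullet> i \<le> u n \<bullet> i"
        using x i by (auto simp: C_def mem_box)
      ultimately show ?thesis using li[of n i] ui[of n i] by linarith
    qed
    then show "x \<in> box a b" by (auto simp: mem_box)
  qed
  have zC: "z \<in> C n" for n
  proof -
    have "l n \<bullet> i \<le> z \<bullet> i \<and> z \<bullet> i \<le> u n \<bullet> i" if i: "i \<in> Basis" for i
    proof -
      have "(b \<bullet> i - a \<bullet> i) / (real n + 2) \<le> (b \<bullet> i - a \<bullet> i) / 2"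
        using ab[OF i] by (intro divide_left_mono) auto
      then have "a \<bullet> i + (b \<bullet> i - a \<bullet> i) / (real n + 2) \<le> a \<bullet> i + (b \<bullet> i - a \<bullet> i) / 2"
        "b \<bullet> i - (b \<bullet> i - a \<bullet> i) / 2 \<le> b \<bullet> i - (b \<bullet> i - a \<bullet> i) / (real n + 2)" by linarith+
      then show ?thesis unfolding li ui zi by (simp add: field_simps)
    qed
    then show ?thesis by (simp add: C_def mem_box)
  qed
  have mono: "C m \<subseteq> C n" if "m \<le> n" for m n
  proof
    fix x assume x: "x \<in> C m"
    have "l n \<bullet> i \<le> x \<bullet> i \<and> x \<bullet> i \<le> u n \<bullet> i" if i: "i \<in> Basis" for i
    proof -
      have "(b \<bullet> i - a \<bullet> i) / (real n + 2) \<le> (b \<bullet> i - a \<bullet> i) / (real m + 2)"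
        using ab[OF i] \<open>m \<le> n\<close> by (intro divide_left_mono) auto
      moreover have "l m \<bullet> i \<le> x \<bullet> i" "x \<bullet> i \<le> u m \<bullet> i"
        using x i by (auto simp: C_def mem_box)
      ultimately show ?thesis using li[of n i] ui[of n i] li[of m i] ui[of m i] by linarith
    qed
    then show "x \<in> C n" by (simp add: C_def mem_box)
  qed
  have int: "\<exists>n. x \<in> box (l n) (u n)" if x: "x \<in> box a b" for x
  proof -
    have "\<forall>i\<in>Basis. eventually (\<lambda>n. l n \<bullet> i < x \<bullet> i \<and> x \<bullet> i < u n \<bullet> i) sequentially"
    proof
      fix i :: 'e assume i: "i \<in> Basis"
      have lim: "(\<lambda>n. (b \<bullet> i - a \<bullet> i) / (real n + 2)) \<longlonglongrightarrow> 0"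
        using LIMSEQ_ignore_initial_segment[OF lim_const_over_n, of "b \<bullet> i - a \<bullet> i" 2]
        by (simp add: add.commute)
      have "0 < min (x \<bullet> i - a \<bullet> i) (b \<bullet> i - x \<bullet> i)" using x i by (auto simp: mem_box)
      then have "eventually (\<lambda>n. (b \<bullet> i - a \<bullet> i) / (real n + 2) < min (x \<bullet> i - a \<bullet> i) (b \<bullet> i - x \<bullet> i)) sequentially"
        using order_tendstoD(2)[OF lim] by blast
      then show "eventually (\<lambda>n. l n \<bullet> i < x \<bullet> i \<and> x \<bullet> i < u n \<bullet> i) sequentially"
        by eventually_elim (auto simp: li ui)
    qed
    then have "eventually (\<lambda>n. \<forall>i\<in>Basis. l n \<bullet> i < x \<bullet> i \<and> x \<bullet> i < u n \<bullet> i) sequentially"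
      by (simp add: eventually_ball_finite)
    then show ?thesis unfolding mem_box by (metis (mono_tags, lifting) eventually_sequentially order_refl)
  qed
  have "\<exists>h. trivializes ?X U F (C n) h" for n
    unfolding C_def using sub[of n] cov
    by (intro trivial_over_cbox[OF co]) (auto simp: C_def)
  then obtain h where h: "\<And>n. trivializes ?X U F (C n) (h n)" by metis
  define g where "g n x = h n x - h n z" for n x
  have g: "trivializes ?X U F (C n) (g n)" for n
    unfolding trivializes_def
  proof
    fix k
    have "locally_constant_on ?X (U k \<inter> C n) (\<lambda>x. (h n x - F k x) - h n z)"
      using h[of n] locally_constant_on_const unfolding trivializes_def
      by (intro locally_constant_on_combine[of _ _ "\<lambda>x. h n x - F k x" "\<lambda>x. h n z" "(-)"]) auto
    then show "locally_constant_on ?X (U k \<inter> C n) (\<lambda>x. g n x - F k x)"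
      by (simp add: g_def algebra_simps)
  qed
  have con: "connectedin ?X (C n)" for n
    using sub[of n] by (auto simp: connectedin_subtopology C_def convex_connected)
  have agree: "g m x = g n x" if mn: "m \<le> n" and x: "x \<in> C m" for m n x
  proof -
    have "locally_constant_on ?X (C m \<inter> C n) (\<lambda>x. g m x - g n x)"
      by (rule trivializations_differ_locally_constant[OF _ _ g g])
        (use co cov sub[of m] in \<open>auto simp: cocycle_def\<close>)
    moreover have "C m \<inter> C n = C m" using mono[OF mn] by blast
    ultimately have "g m x - g n x = g m z - g n z"
      using locally_constant_on_connectedin[OF _ con[of m] _ x zC[of m]] by force
    then show ?thesis by (simp add: g_def)
  qed
  define H where "H x = g (SOME n. x \<in> C n) x" for x
  have H: "H x = g n x" if "x \<in> C n" for x n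
  proof -
    have "x \<in> C (SOME n. x \<in> C n)" using that by (rule someI)
    then show ?thesis unfolding H_def using agree that by (metis nle_le)
  qed
  have "locally_constant_on ?X (U k \<inter> box a b) (\<lambda>x. H x - F k x)" for k
  proof (rule locally_constant_onI)
    fix x assume x: "x \<in> topspace ?X" "x \<in> U k \<inter> box a b"
    obtain n where n: "x \<in> box (l n) (u n)" using int x by auto
    then have xC: "x \<in> C n" using box_subset_cbox by (auto simp: C_def)
    have "locally_constant_on ?X (U k \<inter> C n) (\<lambda>x. g n x - F k x)"
      using g[of n] by (simp add: trivializes_def)
    moreover have "x \<in> U k \<inter> C n" using x xC by blast
    ultimately obtain V where V: "openin ?X V" "x \<in> V"
      "\<forall>y\<in>V \<inter> (U k \<inter> C n). g n y - F k y = g n x - F k x"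
      by (rule locally_constant_onE[OF _ x(1)]) (rule that, assumption+)
    have bs: "box (l n) (u n) \<subseteq> C n" unfolding C_def by (rule box_subset_cbox)
    have "openin ?X (V \<inter> box (l n) (u n))"
      using V(1) bs sub[of n] by (metis inf.absorb_iff2 openin_Int open_box openin_open_Int openin_subset order_trans topspace_euclidean_subtopology open_subset)
    moreover have "H y - F k y = H x - F k x" if "y \<in> V \<inter> box (l n) (u n) \<inter> (U k \<inter> box a b)" for y
    proof -
      have "y \<in> C n" using that bs by blast
      then have "g n y - F k y = g n x - F k x" using V(3) that by blast
      then show ?thesis using H[OF xC] H[OF \<open>y \<in> C n\<close>] by simp
    qed
    ultimately show "\<exists>V. openin ?X V \<and> x \<in> V \<and> (\<forall>y\<in>V \<inter> (U k \<inter> box a b). H y - F k y = H x - F k x)"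
      using V(2) n by (intro exI[of _ "V \<inter> box (l n) (u n)"]) blast
  qed
  then show ?thesis unfolding trivializes_def by blast
qed

section \<open>Cocycles over the torus and the Klein bottle\<close>

text \<open>
  The horizontal sides are identified by a translation and the vertical ones through \<open>\<rho>\<close>, which is
  the identity for the torus and the reflection for the Klein bottle.
\<close>

definition square_glue :: "(real \<Rightarrow> real) \<Rightarrow> real \<times> real \<Rightarrow> real \<times> real \<Rightarrow> bool" where
  "square_glue \<rho> a b \<longleftrightarrow> (\<exists>s\<in>{0..1}. a = (s, 0) \<and> b = (s, 1) \<or> a = (0, s) \<and> b = (1, \<rho> s))"

definition square_quotient :: "'a topology \<Rightarrow> bool" where
  "square_quotient Z \<longleftrightarrow> (\<exists>p \<rho>. quotient_map (top_of_set ({0..1} \<times> {0..1})) Z p \<and>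
     continuous_on {0..1} \<rho> \<and> \<rho> ` {0..1} \<subseteq> {0..1} \<and>
     (\<forall>a b. square_glue \<rho> a b \<longrightarrow> p a = p b) \<and>
     (\<forall>a\<in>{0..1} \<times> {0..1}. \<forall>b\<in>{0..1} \<times> {0..1}. p a = p b \<longrightarrow> equivclp (square_glue \<rho>) a b))"

lemma homeomorphic_square_quotient:
  assumes "square_quotient Z" "Y homeomorphic_space Z"
  shows "square_quotient Y"
proof -
  obtain g where g: "homeomorphic_map Z Y g"
    using assms(2) homeomorphic_space homeomorphic_space_sym by metis
  obtain p \<rho> where p: "quotient_map (top_of_set ({0..1} \<times> {0..1})) Z p"
    "continuous_on {0..1} \<rho>" "\<rho> ` {0..1} \<subseteq> {0..1}"
    "\<forall>a b. square_glue \<rho> a b \<longrightarrow> p a = p b"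
    "\<forall>a\<in>{0..1} \<times> {0..1}. \<forall>b\<in>{0..1} \<times> {0..1}. p a = p b \<longrightarrow> equivclp (square_glue \<rho>) a b"
    using assms(1) unfolding square_quotient_def by blast
  have q: "quotient_map (top_of_set ({0..1} \<times> {0..1})) Y (g \<circ> p)"
    using p(1) g quotient_map_compose unfolding homeomorphic_map_def by blast
  have inj: "inj_on g (topspace Z)" using g unfolding homeomorphic_map_def by blast
  have pZ: "p a \<in> topspace Z" if "a \<in> {0..1} \<times> {0..1}" for a
    using quotient_imp_surjective_map[OF p(1)] that by force
  have "(g \<circ> p) a = (g \<circ> p) b \<longrightarrow> equivclp (square_glue \<rho>) a b"
    if "a \<in> {0..1} \<times> {0..1}" "b \<in> {0..1} \<times> {0..1}" for a b
    using inj_onD[OF inj _ pZ[OF that(1)] pZ[OF that(2)]] p(5) that by auto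
  then show ?thesis unfolding square_quotient_def using q p(2,3,4)
    by (intro exI[of _ "g \<circ> p"] exI[of _ \<rho>]) auto
qed

lemma class_of_eq_iff: "class_of r a = class_of r b \<longleftrightarrow> equivclp r a b"
proof
  assume eq: "class_of r a = class_of r b"
  have "b \<in> class_of r b" by (simp add: class_of_def)
  then have "b \<in> class_of r a" using eq by simp
  then show "equivclp r a b" by (simp add: class_of_def)
next
  assume ab: "equivclp r a b"
  have "equivclp r a c \<longleftrightarrow> equivclp r b c" for c
    using equivclp_trans[OF ab, of c] equivclp_trans[OF equivclp_sym[OF ab], of c] by blast
  then show "class_of r a = class_of r b" by (simp add: class_of_def)
qed

lemma square_quotient_klein_bottle: "square_quotient klein_bottle"
proof -
  have eq: "klein_glue = square_glue (\<lambda>s. 1 - s)"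
    by (intro ext) (simp add: klein_glue_def square_glue_def)
  have cl: "class_of klein_glue a = class_of klein_glue b \<longleftrightarrow> equivclp klein_glue a b" for a b
    by (rule class_of_eq_iff)
  show ?thesis unfolding square_quotient_def
  proof (intro exI[of _ "class_of klein_glue"] exI[of _ "\<lambda>s. 1 - s"] conjI)
    show "quotient_map (top_of_set ({0..1} \<times> {0..1})) klein_bottle (class_of klein_glue)"
      unfolding klein_bottle_def by (rule quotient_map_class_of)
    show "\<forall>a b. square_glue (\<lambda>s. 1 - s) a b \<longrightarrow> class_of klein_glue a = class_of klein_glue b"
      unfolding cl unfolding eq by (simp add: r_into_equivclp)
    show "\<forall>a\<in>{0..1} \<times> {0..1}. \<forall>b\<in>{0..1} \<times> {0..1}.
      class_of klein_glue a = class_of klein_glue b \<longrightarrow> equivclp (square_glue (\<lambda>s. 1 - s)) a b"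
      unfolding cl unfolding eq by simp
  qed (auto intro!: continuous_intros)
qed

lemma square_quotient_torus: "square_quotient torus"
proof -
  define p where "p = (\<lambda>(s, t). (cis (2 * pi * s), cis (2 * pi * t)))"
  let ?Q = "{0..1} \<times> {0..1} :: (real \<times> real) set"
  have T: "torus = top_of_set (sphere 0 1 \<times> sphere 0 1)"
    unfolding torus_def by simp
  have cis: "s = s' \<or> s = 0 \<and> s' = 1 \<or> s = 1 \<and> s' = 0"
    if "cis (2 * pi * s) = cis (2 * pi * s')" "s \<in> {0..1}" "s' \<in> {0..1}" for s s'
  proof -
    have "sin (2 * pi * s) = sin (2 * pi * s') \<and> cos (2 * pi * s) = cos (2 * pi * s')"
      using that(1) by (simp add: complex_eq_iff)
    then obtain n :: int where n: "2 * pi * s = 2 * pi * s' + 2 * pi * n"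
      unfolding sin_cos_eq_iff by blast
    then have "2 * pi * (s - s' - n) = 0" by (simp add: algebra_simps)
    then have sn: "s = s' + n" by simp
    then have "real_of_int n \<le> 1" "-1 \<le> real_of_int n" using that(2,3) by auto
    then have "n = 0 \<or> n = 1 \<or> n = -1" by linarith
    moreover have "s = 1 \<and> s' = 0" if "n = 1" using sn \<open>s \<in> {0..1}\<close> \<open>s' \<in> {0..1}\<close> that by simp
    moreover have "s = 0 \<and> s' = 1" if "n = -1" using sn \<open>s \<in> {0..1}\<close> \<open>s' \<in> {0..1}\<close> that by simp
    moreover have "s = s'" if "n = 0" using sn that by simp
    ultimately show ?thesis by blast
  qed
  have surj1: "\<exists>s\<in>{0..1}. z = cis (2 * pi * s)" if z: "norm z = 1" for z :: complex
  proof -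
    obtain t where t: "0 \<le> t" "t < 2 * pi" "z = Complex (cos t) (sin t)"
      by (rule complex_unimodular_polar[OF z]) (rule that, assumption+)
    have "z = cis (2 * pi * (t / (2 * pi)))" using t(3) by (simp add: complex_eq_iff)
    moreover have "t / (2 * pi) \<in> {0..1}" using t(1,2) by simp
    ultimately show ?thesis by blast
  qed
  have cont: "continuous_on ?Q p" unfolding p_def case_prod_beta by (intro continuous_intros)
  have im: "p ` ?Q = sphere 0 1 \<times> sphere 0 1"
  proof
    show "p ` ?Q \<subseteq> sphere 0 1 \<times> sphere 0 1" by (auto simp: p_def)
    show "sphere 0 1 \<times> sphere 0 1 \<subseteq> p ` ?Q"
    proof
      fix zw :: "complex \<times> complex" assume "zw \<in> sphere 0 1 \<times> sphere 0 1"
      then obtain z w where zw: "zw = (z, w)" "norm z = 1" "norm w = 1" by (cases zw) auto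
      obtain s t where "s \<in> {0..1}" "z = cis (2 * pi * s)" "t \<in> {0..1}" "w = cis (2 * pi * t)"
        using surj1 zw by metis
      then show "zw \<in> p ` ?Q" using zw(1) by (intro image_eqI[of _ _ "(s, t)"]) (auto simp: p_def)
    qed
  qed
  have quo: "quotient_map (top_of_set ?Q) torus p" unfolding T
  proof (rule continuous_closed_imp_quotient_map)
    show cm: "continuous_map (top_of_set ?Q) (top_of_set (sphere 0 1 \<times> sphere 0 1)) p"
      using cont im by (auto simp: continuous_map_in_subtopology)
    show "closed_map (top_of_set ?Q) (top_of_set (sphere 0 1 \<times> sphere 0 1)) p"
    proof (rule continuous_imp_closed_map_gen[OF _ _ cm])
      show "compact_space (top_of_set ?Q)"
        by (simp add: compact_space_subtopology compact_Times)
      show "kc_space (top_of_set (sphere 0 1 \<times> sphere 0 1 :: (complex \<times> complex) set))"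
        by (simp add: Hausdorff_imp_kc_space Hausdorff_space_subtopology)
    qed
    show "p ` topspace (top_of_set ?Q) = topspace (top_of_set (sphere 0 1 \<times> sphere 0 1))"
      using im by simp
  qed
  have step: "equivclp (square_glue (\<lambda>s. s)) (s, t) (s', t')"
    if "s = s' \<or> s = 0 \<and> s' = 1 \<or> s = 1 \<and> s' = 0" "t = t' \<or> t = 0 \<and> t' = 1 \<or> t = 1 \<and> t' = 0"
      "s \<in> {0..1}" "s' \<in> {0..1}" "t \<in> {0..1}" "t' \<in> {0..1}" for s s' t t' :: real
  proof -
    have v: "square_glue (\<lambda>s. s) (r, 0) (r, 1)" "square_glue (\<lambda>s. s) (0, r) (1, r)"
      if "r \<in> {0..1}" for r :: real
      using that unfolding square_glue_def by blast+
    have e: "equivclp (square_glue (\<lambda>s. s)) (r, 0) (r, 1)" "equivclp (square_glue (\<lambda>s. s)) (r, 1) (r, 0)"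
      "equivclp (square_glue (\<lambda>s. s)) (0, r) (1, r)" "equivclp (square_glue (\<lambda>s. s)) (1, r) (0, r)"
      if "r \<in> {0..1}" for r :: real
      using v[OF that] by (simp_all add: r_into_equivclp converse_r_into_equivclp)
    have "equivclp (square_glue (\<lambda>s. s)) (s, t) (s', t)"
      using that(1,3,4,5) e by auto
    also have "equivclp (square_glue (\<lambda>s. s)) (s', t) (s', t')"
      using that(2,4) e by auto
    finally (equivclp_trans) show ?thesis .
  qed
  show ?thesis unfolding square_quotient_def
  proof (intro exI[of _ p] exI[of _ "\<lambda>s. s"] conjI quo)
    show "\<forall>a b. square_glue (\<lambda>s. s) a b \<longrightarrow> p a = p b"
      by (auto simp: square_glue_def p_def)
    show "\<forall>a\<in>?Q. \<forall>b\<in>?Q. p a = p b \<longrightarrow> equivclp (square_glue (\<lambda>s. s)) a b"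
    proof (intro ballI impI)
      fix a b assume ab: "a \<in> ?Q" "b \<in> ?Q" "p a = p b"
      obtain s t s' t' where st: "a = (s, t)" "b = (s', t')" by (cases a; cases b)
      have m: "s \<in> {0..1}" "s' \<in> {0..1}" "t \<in> {0..1}" "t' \<in> {0..1}" using ab(1,2) st by simp_all
      have c: "cis (2 * pi * s) = cis (2 * pi * s')" "cis (2 * pi * t) = cis (2 * pi * t')"
        using ab(3) st by (simp_all add: p_def)
      show "equivclp (square_glue (\<lambda>s. s)) a b"
        unfolding st by (rule step[OF cis[OF c(1) m(1,2)] cis[OF c(2) m(3,4)] m])
    qed
  qed (auto intro!: continuous_intros)
qed

text \<open>
  Along two paths \<open>a\<close> and \<open>b\<close> in the square that become equal in the quotient, \<open>f\<close> restricts to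
  two trivializations of the same cocycle on an interval.
\<close>

lemma loop_holonomy_constant:
  assumes co: "\<And>k. openin Z (U k)" and cov: "topspace Z \<subseteq> (\<Union>k. U k)"
    and p: "continuous_map (top_of_set Q) Z p"
    and f: "trivializes (top_of_set Q) (\<lambda>k. {x \<in> Q. p x \<in> U k}) (\<lambda>k x. F k (p x)) Q f"
    and a: "continuous_on {0..1} a" "a ` {0..1} \<subseteq> Q" and b: "continuous_on {0..1} b" "b ` {0..1} \<subseteq> Q"
    and ab: "\<And>s. s \<in> {0..1::real} \<Longrightarrow> p (a s) = p (b s)" and s: "s \<in> {0..1}"
  shows "f (a s) - f (b s) = f (a 0) - f (b 0)"
proof -
  let ?I = "top_of_set {0..1::real}"
  let ?U = "\<lambda>k. {s \<in> {0..1}. p (a s) \<in> U k}"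
  have ca: "continuous_map ?I (top_of_set Q) a" and cb: "continuous_map ?I (top_of_set Q) b"
    using a b by (auto simp: continuous_map_in_subtopology)
  have fa: "trivializes ?I ?U (\<lambda>k s. F k (p (a s))) {0..1} (\<lambda>s. f (a s))"
    using a(2) by (intro trivializes_pullback[OF f ca]) auto
  have "trivializes ?I ?U (\<lambda>k s. F k (p (b s))) {0..1} (\<lambda>s. f (b s))"
    using b(2) ab by (intro trivializes_pullback[OF f cb]) auto
  then have fb: "trivializes ?I ?U (\<lambda>k s. F k (p (a s))) {0..1} (\<lambda>s. f (b s))"
    unfolding trivializes_def
  proof (intro allI, elim allE)
    fix k assume L: "locally_constant_on ?I (?U k \<inter> {0..1}) (\<lambda>x. f (b x) - F k (p (b x)))"
    show "locally_constant_on ?I (?U k \<inter> {0..1}) (\<lambda>x. f (b x) - F k (p (a x)))"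
      by (rule locally_constant_on_cong[THEN iffD1, OF _ L]) (use ab in auto)
  qed
  have cp: "continuous_map ?I Z (p \<circ> a)" using continuous_map_compose[OF ca p] .
  have op: "openin ?I (?U k)" for k
    using openin_continuous_map_preimage[OF cp co[of k]] by simp
  have sub: "{0..1} \<inter> {0..1} \<subseteq> (\<Union>k. ?U k)"
  proof
    fix s :: real assume s: "s \<in> {0..1} \<inter> {0..1}"
    then have "p (a s) \<in> topspace Z" using cp by (auto simp: continuous_map_def)
    then show "s \<in> (\<Union>k. ?U k)" using cov s by auto
  qed
  have "locally_constant_on ?I ({0..1} \<inter> {0..1}) (\<lambda>s. f (a s) - f (b s))"
    by (rule trivializations_differ_locally_constant[OF op sub fa fb])
  then show ?thesis
    by (rule locally_constant_on_connectedin[where C = "{0..1}"])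
      (use s in \<open>auto simp: connectedin_subtopology\<close>)
qed

text \<open>
  A cocycle becomes trivial on the square. The trivialization jumps by a constant between two
  identified sides; these jumps form \<open>\<beta>\<close>. If two cocycles have the same jumps, then the difference
  of the trivializations descends to the quotient.
\<close>

lemma square_quotient_holonomy:
  fixes U :: "'k \<Rightarrow> 'a set"
  assumes Z: "square_quotient Z" and op: "\<And>k. openin Z (U k)" and cov: "topspace Z \<subseteq> (\<Union>k. U k)"
  shows "\<exists>\<beta> :: ('k \<Rightarrow> 'a \<Rightarrow> 'g::ab_group_add) \<Rightarrow> 'g \<times> 'g. \<forall>F F'. cocycle Z U F \<longrightarrow> cocycle Z U F' \<longrightarrow>
     \<beta> F = \<beta> F' \<longrightarrow> (\<exists>h. trivializes Z U (\<lambda>k x. F k x - F' k x) (topspace Z) h)"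
proof -
  define Q where "Q = ({0..1} \<times> {0..1} :: (real \<times> real) set)"
  obtain p \<rho> where p: "quotient_map (top_of_set Q) Z p"
    "continuous_on {0..1} \<rho>" "\<rho> ` {0..1} \<subseteq> {0..1}"
    "\<And>a b. square_glue \<rho> a b \<Longrightarrow> p a = p b"
    "\<And>a b. a \<in> Q \<Longrightarrow> b \<in> Q \<Longrightarrow> p a = p b \<Longrightarrow> equivclp (square_glue \<rho>) a b"
    using Z unfolding square_quotient_def Q_def[symmetric] by blast
  have cp: "continuous_map (top_of_set Q) Z p" using p(1) by (rule quotient_imp_continuous_map)
  let ?U = "\<lambda>k. {x \<in> Q. p x \<in> U k}"
  let ?tr = "\<lambda>F f. trivializes (top_of_set Q) ?U (\<lambda>k x. F k (p x)) Q f"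
  define f where "f F = (SOME f. ?tr F f)" for F :: "'k \<Rightarrow> 'a \<Rightarrow> 'g"
  define \<beta> where "\<beta> F = (f F (0, 0) - f F (0, 1), f F (0, 0) - f F (1, \<rho> 0))" for F
  have Qb: "Q = cbox (0, 0) (1, 1)" by (auto simp: Q_def cbox_Pair_eq)
  have QU: "Q \<subseteq> (\<Union>k. ?U k)"
  proof
    fix x assume "x \<in> Q"
    then have "p x \<in> topspace Z" using quotient_imp_surjective_map[OF p(1)] by auto
    then show "x \<in> (\<Union>k. ?U k)" using cov \<open>x \<in> Q\<close> by auto
  qed
  have f: "?tr F (f F)" if "cocycle Z U F" for F
  proof -
    have "cocycle (top_of_set Q) ?U (\<lambda>k x. F k (p x))" using cocycle_pullback[OF that cp] by simp
    then have "\<exists>f. ?tr F f"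
      using trivial_over_cbox[of Q ?U "\<lambda>k x. F k (p x)" "(0, 0)" "(1, 1)"] QU unfolding Qb by simp
    then show ?thesis unfolding f_def by (rule someI_ex)
  qed
  have glued_side: "p (s, 0) = p (s, 1)" "p (0, s) = p (1, \<rho> s)" if "s \<in> {0..1}" for s
    using that by (intro p(4); auto simp: square_glue_def)+
  have "\<exists>h. trivializes Z U (\<lambda>k x. F k x - F' k x) (topspace Z) h"
    if F: "cocycle Z U F" "cocycle Z U F'" and eq: "\<beta> F = \<beta> F'" for F F'
  proof -
    define d where "d x = f F x - f F' x" for x
    have d: "?tr (\<lambda>k x. F k x - F' k x) d"
      unfolding d_def by (rule trivializes_diff[OF f[OF F(1)] f[OF F(2)]])
    have d1: "d (s, 0) = d (s, 1)" if "s \<in> {0..1}" for s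
    proof -
      have "d (s, 0) - d (s, 1) = d (0, 0) - d (0, 1)"
        by (rule loop_holonomy_constant[OF op cov cp d, of "\<lambda>s. (s, 0)" "\<lambda>s. (s, 1)"])
          (use that glued_side(1) in \<open>auto simp: Q_def intro!: continuous_intros\<close>)
      also have "\<dots> = 0" using eq by (simp add: \<beta>_def d_def algebra_simps)
      finally show ?thesis by simp
    qed
    have d2: "d (0, s) = d (1, \<rho> s)" if "s \<in> {0..1}" for s
    proof -
      have "d (0, s) - d (1, \<rho> s) = d (0, 0) - d (1, \<rho> 0)"
        by (rule loop_holonomy_constant[OF op cov cp d, of "\<lambda>s. (0, s)" "\<lambda>s. (1, \<rho> s)"])
          (use that p(2,3) glued_side(2) in \<open>auto simp: Q_def intro!: continuous_intros\<close>)
      also have "\<dots> = 0" using eq by (simp add: \<beta>_def d_def algebra_simps)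
      finally show ?thesis by simp
    qed
    have glue: "d a = d b" if "square_glue \<rho> a b" for a b
      using that d1 d2 unfolding square_glue_def by auto
    have fib: "d a = d b" if "equivclp (square_glue \<rho>) a b" for a b
      using that by (induction rule: equivclp_induct) (auto dest: glue)
    define h where "h z = d (SOME a. a \<in> Q \<and> p a = z)" for z
    have h: "h (p a) = d a" if "a \<in> Q" for a
    proof -
      have "\<exists>b. b \<in> Q \<and> p b = p a" using that by blast
      then have "(SOME b. b \<in> Q \<and> p b = p a) \<in> Q \<and> p (SOME b. b \<in> Q \<and> p b = p a) = p a"
        by (rule someI_ex)
      then show ?thesis unfolding h_def using fib p(5) that by metis
    qed
    have "locally_constant_on Z (U k \<inter> topspace Z) (\<lambda>x. h x - (F k x - F' k x))" for k
    proof (rule locally_constant_on_quotient[OF p(1)])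
      show "openin Z (U k \<inter> topspace Z)" using op by blast
      have "locally_constant_on (top_of_set Q) (?U k \<inter> Q) (\<lambda>x. d x - (F k (p x) - F' k (p x)))"
        using d by (simp add: trivializes_def)
      then have "locally_constant_on (top_of_set Q) {x \<in> topspace (top_of_set Q). p x \<in> U k \<inter> topspace Z}
          (\<lambda>x. d x - (F k (p x) - F' k (p x)))"
        by (rule locally_constant_on_subset) auto
      then show "locally_constant_on (top_of_set Q) {x \<in> topspace (top_of_set Q). p x \<in> U k \<inter> topspace Z}
          (\<lambda>x. h (p x) - (F k (p x) - F' k (p x)))"
        by (subst locally_constant_on_cong[of _ _ _ "\<lambda>x. d x - (F k (p x) - F' k (p x))"])
          (auto simp: h)
    qed
    then show ?thesis unfolding trivializes_def by blast
  qed
  then show ?thesis by (intro exI[of _ \<beta>]) blast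
qed

text \<open>
  As the components are open, trivializations over them can be combined.
\<close>

lemma components_holonomy:
  fixes U :: "'k \<Rightarrow> 'a set"
  assumes Z: "\<And>C. C \<in> connected_components_of Y \<Longrightarrow> square_quotient (subtopology Y C)"
    and C: "\<And>C. C \<in> connected_components_of Y \<Longrightarrow> openin Y C"
    and op: "\<And>k. openin Y (U k)" and cov: "topspace Y \<subseteq> (\<Union>k. U k)"
  shows "\<exists>\<beta> :: ('k \<Rightarrow> 'a \<Rightarrow> 'g::ab_group_add) \<Rightarrow> 'a set \<Rightarrow> 'g \<times> 'g. \<forall>F F'.
     cocycle Y U F \<longrightarrow> cocycle Y U F' \<longrightarrow> (\<forall>C\<in>connected_components_of Y. \<beta> F C = \<beta> F' C) \<longrightarrow>
     (\<exists>h. trivializes Y U (\<lambda>k x. F k x - F' k x) (topspace Y) h)"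
proof -
  let ?U = "\<lambda>C k. {x \<in> topspace (subtopology Y C). x \<in> U k}"
  have ci: "continuous_map (subtopology Y C) Y (\<lambda>x. x)" for C
    using continuous_map_from_subtopology[OF continuous_map_id, of Y C] by (simp add: id_def)
  let ?P = "\<lambda>C (\<beta> :: ('k \<Rightarrow> 'a \<Rightarrow> 'g) \<Rightarrow> 'g \<times> 'g). \<forall>F F'.
     cocycle (subtopology Y C) (?U C) F \<longrightarrow> cocycle (subtopology Y C) (?U C) F' \<longrightarrow> \<beta> F = \<beta> F' \<longrightarrow>
     (\<exists>h. trivializes (subtopology Y C) (?U C) (\<lambda>k x. F k x - F' k x) (topspace (subtopology Y C)) h)"
  have "\<exists>\<beta>. C \<in> connected_components_of Y \<longrightarrow> ?P C \<beta>" for C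
  proof (cases "C \<in> connected_components_of Y")
    case True
    have "openin (subtopology Y C) (?U C k)" for k
      using openin_continuous_map_preimage[OF ci op] .
    moreover have "topspace (subtopology Y C) \<subseteq> (\<Union>k. ?U C k)" using cov by auto
    ultimately have "\<exists>\<beta>. ?P C \<beta>" by (rule square_quotient_holonomy[OF Z[OF True], of "?U C"])
    then show ?thesis by (rule ex_forward) (rule impI)
  qed simp
  then have "\<forall>C. \<exists>\<beta>. C \<in> connected_components_of Y \<longrightarrow> ?P C \<beta>" by (rule allI)
  from choice[OF this] obtain \<beta> :: "'a set \<Rightarrow> ('k \<Rightarrow> 'a \<Rightarrow> 'g) \<Rightarrow> 'g \<times> 'g" where
    \<beta>: "\<And>C F F'. C \<in> connected_components_of Y \<Longrightarrow>
     cocycle (subtopology Y C) (?U C) F \<Longrightarrow> cocycle (subtopology Y C) (?U C) F' \<Longrightarrow> \<beta> C F = \<beta> C F' \<Longrightarrow>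
     (\<exists>h. trivializes (subtopology Y C) (?U C) (\<lambda>k x. F k x - F' k x) (topspace (subtopology Y C)) h)"
    by blast
  show ?thesis
  proof (intro exI[of _ "\<lambda>F C. \<beta> C F"] allI impI)
    fix F F' :: "'k \<Rightarrow> 'a \<Rightarrow> 'g"
    assume F: "cocycle Y U F" "cocycle Y U F'"
      and eq: "\<forall>C\<in>connected_components_of Y. \<beta> C F = \<beta> C F'"
    have "\<exists>h. trivializes Y U (\<lambda>k x. F k x - F' k x) C h" if C: "C \<in> connected_components_of Y" for C
    proof -
      obtain h where h: "trivializes (subtopology Y C) (?U C) (\<lambda>k x. F k x - F' k x) (topspace (subtopology Y C)) h"
        using \<beta>[OF C cocycle_pullback[OF F(1) ci] cocycle_pullback[OF F(2) ci] bspec[OF eq C]] by (rule exE)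
      have CY: "topspace (subtopology Y C) = C"
        using connected_components_of_subset[OF C] by auto
      have "locally_constant_on Y (U k \<inter> C) (\<lambda>x. h x - (F k x - F' k x))" for k
      proof -
        have "locally_constant_on (subtopology Y C) (?U C k \<inter> C) (\<lambda>x. h x - (F k x - F' k x))"
          using h unfolding trivializes_def CY by blast
        moreover have "?U C k \<inter> C = U k \<inter> C" using CY by blast
        ultimately show ?thesis
          using locally_constant_on_subtopology[of "U k \<inter> C" C Y] by auto
      qed
      then show ?thesis unfolding trivializes_def by blast
    qed
    then have "\<forall>C. \<exists>h. C \<in> connected_components_of Y \<longrightarrow>
        trivializes Y U (\<lambda>k x. F k x - F' k x) C h" by blast
    from choice[OF this] obtain H where H: "\<And>C. C \<in> connected_components_of Y \<Longrightarrow>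
        trivializes Y U (\<lambda>k x. F k x - F' k x) C (H C)" by blast
    define h where "h x = H (connected_component_of_set Y x) x" for x
    have "locally_constant_on Y (U k \<inter> topspace Y) (\<lambda>x. h x - (F k x - F' k x))" for k
    proof (rule locally_constant_onI)
      fix x assume x: "x \<in> topspace Y" "x \<in> U k \<inter> topspace Y"
      define D where "D = connected_component_of_set Y x"
      have D: "D \<in> connected_components_of Y"
        using x(1) connected_component_in_connected_components_of unfolding D_def by metis
      have xD: "x \<in> D" using x(1) by (simp add: D_def connected_component_of_refl)
      have hD: "h y = H D y" if "y \<in> D" for y
        using that connected_component_of_equiv[of Y x y] unfolding h_def D_def by auto
      have "locally_constant_on Y (U k \<inter> D) (\<lambda>x. H D x - (F k x - F' k x))"
        using H[OF D] by (simp add: trivializes_def)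
      moreover have "x \<in> U k \<inter> D" using x xD by blast
      ultimately obtain V where V: "openin Y V" "x \<in> V"
        "\<forall>y\<in>V \<inter> (U k \<inter> D). H D y - (F k y - F' k y) = H D x - (F k x - F' k x)"
        by (rule locally_constant_onE[OF _ x(1)]) (rule that, assumption+)
      have "openin Y (V \<inter> D)" using V(1) C[OF D] by blast
      moreover have "h y - (F k y - F' k y) = h x - (F k x - F' k x)"
        if "y \<in> V \<inter> D \<inter> (U k \<inter> topspace Y)" for y
      proof -
        have "H D y - (F k y - F' k y) = H D x - (F k x - F' k x)" using V(3) that by blast
        then show ?thesis using hD[OF xD] hD[of y] that by simp
      qed
      ultimately show "\<exists>V. openin Y V \<and> x \<in> V \<and>
          (\<forall>y\<in>V \<inter> (U k \<inter> topspace Y). h y - (F k y - F' k y) = h x - (F k x - F' k x))"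
        using V(2) xD by (intro exI[of _ "V \<inter> D"]) blast
    qed
    then show "\<exists>h. trivializes Y U (\<lambda>k x. F k x - F' k x) (topspace Y) h"
      unfolding trivializes_def by blast
  qed
qed

section \<open>The boundary of a compact 3-manifold\<close>

text \<open>
  A neighbourhood \<open>B\<close> of a point of the boundary \<open>D\<close> that looks like a box in half-space: its
  boundary part is connected, and the rest is an open box.
\<close>

definition half_box :: "'a topology \<Rightarrow> 'a set \<Rightarrow> 'a set \<Rightarrow> bool" where
  "half_box N D B \<longleftrightarrow> openin N B \<and> connectedin N (B \<inter> D) \<and>
     (\<exists>a b :: real^3. box a b \<noteq> {} \<and>
        top_of_set (box a b) homeomorphic_space subtopology N (B - D))"

text \<open>
  Arbitrarily small half boxes at every point of \<open>D\<close>: in this form the manifold structure near the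
  boundary enters the argument.
\<close>

definition half_boxed :: "'a topology \<Rightarrow> 'a set \<Rightarrow> bool" where
  "half_boxed N D \<longleftrightarrow> closedin N D \<and>
     (\<forall>p\<in>D. \<forall>V. openin N V \<and> p \<in> V \<longrightarrow> (\<exists>B. p \<in> B \<and> B \<subseteq> V \<and> half_box N D B))"

lemma half_boxedE:
  assumes "half_boxed N D" "p \<in> D" "openin N V" "p \<in> V"
  obtains B where "p \<in> B" "B \<subseteq> V" "half_box N D B"
  using assms unfolding half_boxed_def by metis

lemma openin_euclidean3_points: "openin X (euclidean3_points X)"
proof (subst openin_subopen, intro ballI)
  fix p assume "p \<in> euclidean3_points X"
  then obtain U where U: "openin X U" "p \<in> U"
    "\<exists>W :: (real^3) set. open W \<and> subtopology X U homeomorphic_space top_of_set W"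
    by (auto simp: euclidean3_points_def)
  have "U \<subseteq> euclidean3_points X"
    using U openin_subset[OF U(1)] unfolding euclidean3_points_def by blast
  then show "\<exists>T. openin X T \<and> p \<in> T \<and> T \<subseteq> euclidean3_points X" using U by blast
qed

text \<open>
  A point of the bounding plane has no Euclidean neighbourhood: by invariance of domain, a chart
  around it would be open in space and would contain points beyond the plane.
\<close>

lemma half_space_chart_euclidean_iff:
  fixes W :: "(real^3) set"
  assumes U: "openin N U" and W: "openin (top_of_set {x :: real^3. 0 \<le> x $ 1}) W"
    and fg: "homeomorphic_maps (subtopology N U) (top_of_set W) f g" and u: "u \<in> U"
  shows "u \<in> euclidean3_points N \<longleftrightarrow> 0 < f u $ 1"
proof
  have UN: "U \<subseteq> topspace N" using U by (rule openin_subset)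
  have tU: "topspace (subtopology N U) = U" using UN by auto
  have cf: "continuous_map (subtopology N U) (top_of_set W) f"
    and cg: "continuous_map (top_of_set W) (subtopology N U) g"
    and gf: "\<And>x. x \<in> U \<Longrightarrow> g (f x) = x" and fg': "\<And>y. y \<in> W \<Longrightarrow> f (g y) = y"
    using fg tU unfolding homeomorphic_maps_def by auto
  have fW: "f x \<in> W" if "x \<in> U" for x
    using cf that tU by (auto simp: continuous_map_def)
  have gU: "g y \<in> U" if "y \<in> W" for y
    using cg that tU by (auto simp: continuous_map_def)
  have WH: "0 \<le> y $ 1" if "y \<in> W" for y using openin_subset[OF W] that by auto
  show "u \<in> euclidean3_points N" if pos: "0 < f u $ 1"
  proof -
    obtain O' where O': "open O'" "W = {x. 0 \<le> x $ 1} \<inter> O'"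
      using W by (auto simp: openin_open)
    define W' where "W' = O' \<inter> {x. 0 < x $ 1}"
    have "open {x :: real^3. 0 < x $ 1}" by (rule open_halfspace_component_gt_cart)
    then have W'o: "open W'" using O'(1) by (simp add: W'_def open_Int)
    have W'W: "W' \<subseteq> W" using O'(2) by (auto simp: W'_def)
    define U' where "U' = {x \<in> U. f x \<in> W'}"
    have "openin (top_of_set W) W'" using W'o W'W by (simp add: open_openin_trans open_subset)
    then have "openin (subtopology N U) U'"
      using openin_continuous_map_preimage[OF cf, of W'] unfolding tU U'_def by blast
    then have U'o: "openin N U'" using U openin_trans_full by blast
    have "homeomorphic_maps (subtopology (subtopology N U) U') (subtopology (top_of_set W) W') f g"
    proof (rule homeomorphic_maps_subtopologies[OF fg])
      show "f ` (topspace (subtopology N U) \<inter> U') = topspace (top_of_set W) \<inter> W'"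
      proof
        show "f ` (topspace (subtopology N U) \<inter> U') \<subseteq> topspace (top_of_set W) \<inter> W'"
          using W'W by (auto simp: U'_def)
        show "topspace (top_of_set W) \<inter> W' \<subseteq> f ` (topspace (subtopology N U) \<inter> U')"
        proof
          fix y assume y: "y \<in> topspace (top_of_set W) \<inter> W'"
          then have "y \<in> W" "y \<in> W'" by auto
          then have "g y \<in> U" "f (g y) = y" "y \<in> W'" using gU fg' by auto
          then show "y \<in> f ` (topspace (subtopology N U) \<inter> U')"
            using UN by (intro image_eqI[of _ _ "g y"]) (auto simp: U'_def)
        qed
      qed
    qed
    moreover have "U \<inter> U' = U'" "W \<inter> W' = W'" using W'W by (auto simp: U'_def)
    ultimately have "homeomorphic_maps (subtopology N U') (top_of_set W') f g"
      by (simp add: subtopology_subtopology)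
    then have "subtopology N U' homeomorphic_space top_of_set W'"
      unfolding homeomorphic_space_def by blast
    moreover have "u \<in> U'" using u pos fW[OF u] O'(2) by (auto simp: U'_def W'_def)
    ultimately have "\<exists>U. openin N U \<and> u \<in> U \<and>
        (\<exists>W :: (real^3) set. open W \<and> subtopology N U homeomorphic_space top_of_set W)"
      using U'o W'o by (intro exI[of _ U'] conjI exI[of _ W'])
    moreover have "u \<in> topspace N" using u UN by (rule subsetD[rotated])
    ultimately show ?thesis unfolding euclidean3_points_def by (intro CollectI conjI)
  qed
  show "0 < f u $ 1" if eu: "u \<in> euclidean3_points N"
  proof (rule ccontr)
    assume "\<not> 0 < f u $ 1"
    then have f0: "f u $ 1 = 0" using WH[OF fW[OF u]] by simp
    obtain U2 and W2 :: "(real^3) set" and f2 g2 where U2: "openin N U2" "u \<in> U2" "open W2"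
      "homeomorphic_maps (subtopology N U2) (top_of_set W2) f2 g2"
      using eu unfolding euclidean3_points_def homeomorphic_space_def by blast
    have U2N: "U2 \<subseteq> topspace N" using U2(1) by (rule openin_subset)
    have tU2: "topspace (subtopology N U2) = U2" using U2N by auto
    have cf2: "continuous_map (subtopology N U2) (top_of_set W2) f2"
      and cg2: "continuous_map (top_of_set W2) (subtopology N U2) g2"
      and gf2: "\<And>x. x \<in> U2 \<Longrightarrow> g2 (f2 x) = x" and fg2: "\<And>y. y \<in> W2 \<Longrightarrow> f2 (g2 y) = y"
      using U2(4) tU2 unfolding homeomorphic_maps_def by auto
    define S where "S = {y \<in> W2. g2 y \<in> U}"
    have cg2N: "continuous_map (top_of_set W2) N g2" using cg2 by (simp add: continuous_map_in_subtopology)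
    have "openin (top_of_set W2) S"
      using openin_continuous_map_preimage[OF cg2N U] by (simp add: S_def)
    then have So: "open S" using U2(3) by (metis openin_open_eq)
    have SW: "S \<subseteq> W2" by (auto simp: S_def)
    have "continuous_map (top_of_set S) (subtopology N U) g2"
    proof -
      have "continuous_map (top_of_set S) N g2"
        using cg2N SW by (rule continuous_map_from_subtopology_mono)
      then show ?thesis by (auto simp: continuous_map_in_subtopology S_def)
    qed
    then have "continuous_map (top_of_set S) (top_of_set W) (f \<circ> g2)"
      using cf by (rule continuous_map_compose)
    then have "continuous_on S (f \<circ> g2)" by (simp add: continuous_map_in_subtopology)
    moreover have "inj_on (f \<circ> g2) S"
    proof (rule inj_onI)
      fix x y assume xy: "x \<in> S" "y \<in> S" "(f \<circ> g2) x = (f \<circ> g2) y"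
      have "g2 x \<in> U" "g2 y \<in> U" "x \<in> W2" "y \<in> W2" using xy(1,2) by (simp_all add: S_def)
      then show "x = y" using xy(3) gf fg2 by (metis comp_apply)
    qed
    ultimately have op: "open ((f \<circ> g2) ` S)" using So by (intro invariance_of_domain)
    have "f2 u \<in> W2" using cf2 U2(2) tU2 by (auto simp: continuous_map_def)
    then have "f2 u \<in> S" using u gf2[OF U2(2)] by (simp add: S_def)
    then have fu: "f u \<in> (f \<circ> g2) ` S" using gf2[OF U2(2)] by (intro image_eqI[of _ _ "f2 u"]) auto
    obtain e where e: "e > 0" "ball (f u) e \<subseteq> (f \<circ> g2) ` S"
      using openE[OF op fu] by blast
    (* a point beyond the bounding plane *)
    define z where "z = f u - (e/2) *\<^sub>R axis 1 1"
    have "dist (f u) z = e / 2" using e(1) by (simp add: z_def dist_norm)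
    then have "z \<in> ball (f u) e" using e(1) by simp
    then have "z \<in> (f \<circ> g2) ` S" using e(2) by (rule subsetD[rotated])
    then obtain s where "s \<in> S" "z = f (g2 s)" by auto
    then have "z \<in> W" using fW[of "g2 s"] by (simp add: S_def)
    moreover have "z $ 1 = - (e / 2)" using f0 by (simp add: z_def axis_def)
    ultimately show False using WH[of z] e(1) by simp
  qed
qed

lemma half_boxed_manifold_boundary:
  assumes "compact_3manifold_with_boundary N"
  shows "half_boxed N (topspace N - euclidean3_points N)"
proof -
  define D where "D = topspace N - euclidean3_points N"
  have "\<exists>B. p \<in> B \<and> B \<subseteq> V \<and> half_box N D B" if p: "p \<in> D" and V: "openin N V" "p \<in> V" for p V
  proof -
    have "p \<in> topspace N" using p by (simp add: D_def)
    then obtain U and W :: "(real^3) set" and f g where U: "openin N U" "p \<in> U"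
      "openin (top_of_set {x :: real^3. 0 \<le> x $ 1}) W"
      "homeomorphic_maps (subtopology N U) (top_of_set W) f g"
      using assms unfolding compact_3manifold_with_boundary_def homeomorphic_space_def by blast
    note chart = half_space_chart_euclidean_iff[OF U(1,3,4)]
    have UN: "U \<subseteq> topspace N" using U(1) by (rule openin_subset)
    have tU: "topspace (subtopology N U) = U" using UN by auto
    have cf: "continuous_map (subtopology N U) (top_of_set W) f"
      and cg: "continuous_map (top_of_set W) (subtopology N U) g"
      and gf: "\<And>x. x \<in> U \<Longrightarrow> g (f x) = x" and fg: "\<And>y. y \<in> W \<Longrightarrow> f (g y) = y"
      using U(4) tU unfolding homeomorphic_maps_def by auto
    have fW: "f x \<in> W" if "x \<in> U" for x
      using cf that tU by (auto simp: continuous_map_def)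
    have gU: "g y \<in> U" if "y \<in> W" for y
      using cg that tU by (auto simp: continuous_map_def)
    have WH: "0 \<le> y $ 1" if "y \<in> W" for y using openin_subset[OF U(3)] that by auto
    have DU: "x \<in> D \<longleftrightarrow> f x $ 1 = 0" if "x \<in> U" for x
      using chart[OF that] WH[OF fW[OF that]] that UN by (auto simp: D_def)
    define y where "y = f p"
    have y0: "y $ 1 = 0" using DU[OF U(2)] p by (simp add: y_def)
    define S where "S = {z \<in> W. g z \<in> V}"
    have cgN: "continuous_map (top_of_set W) N g" using cg by (simp add: continuous_map_in_subtopology)
    have "openin (top_of_set W) S"
      using openin_continuous_map_preimage[OF cgN V(1)] by (simp add: S_def)
    then have "openin (top_of_set {x :: real^3. 0 \<le> x $ 1}) S" using U(3) openin_trans by blast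
    then obtain O' where O': "open O'" "S = {x. 0 \<le> x $ 1} \<inter> O'" by (auto simp: openin_open)
    have "y \<in> S" using fW[OF U(2)] gf[OF U(2)] V(2) by (simp add: y_def S_def)
    then obtain e where e: "e > 0" "ball y e \<subseteq> O'" using O' open_contains_ball by blast
    define \<delta> where "\<delta> = e / 3"
    have \<delta>: "\<delta> > 0" using e(1) by (simp add: \<delta>_def)
    define b where "b = (\<chi> i. y $ i + \<delta>)"
    define a' where "a' = (\<chi> i. y $ i - \<delta>)"
    define a where "a = (\<chi> i. if i = 1 then 0 else y $ i - \<delta>)"
    (* the box from a' to b around y is cut by the bounding plane; its open half goes from a to b *)
    define K where "K = {x. 0 \<le> x $ 1} \<inter> box a' b"
    have KS: "K \<subseteq> S"
    proof
      fix x assume x: "x \<in> K"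
      have "norm (x - y) \<le> (\<Sum>i\<in>UNIV. \<bar>(x - y) $ i\<bar>)" by (rule norm_le_l1_cart)
      also have "\<dots> < (\<Sum>i\<in>(UNIV :: 3 set). \<delta>)"
      proof (rule sum_strict_mono)
        fix i :: 3
        have "y $ i - \<delta> < x $ i" "x $ i < y $ i + \<delta>"
          using x by (auto simp: K_def mem_box_cart a'_def b_def)
        then show "\<bar>(x - y) $ i\<bar> < \<delta>" by auto
      qed auto
      also have "\<dots> = e" by (simp add: \<delta>_def)
      finally have "x \<in> ball y e" by (simp add: dist_norm norm_minus_commute)
      then show "x \<in> S" using e(2) O'(2) x by (auto simp: K_def)
    qed
    then have KW: "K \<subseteq> W" by (auto simp: S_def)
    have "openin (top_of_set {x :: real^3. 0 \<le> x $ 1}) K" unfolding K_def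
      by (simp add: openin_open_Int open_box)
    then have KoW: "openin (top_of_set W) K"
      using KW openin_subset[OF U(3)] by (auto intro: openin_subset_trans)
    define B where "B = {x \<in> U. f x \<in> K}"
    have "openin (subtopology N U) B"
      using openin_continuous_map_preimage[OF cf KoW] unfolding tU B_def .
    then have Bo: "openin N B" using U(1) openin_trans_full by blast
    have pB: "p \<in> B" using U(2) \<delta> y0 by (auto simp: B_def K_def mem_box_cart a'_def b_def simp flip: y_def)
    have BV: "B \<subseteq> V"
    proof
      fix x assume "x \<in> B"
      then have "x \<in> U" "f x \<in> S" using KS by (auto simp: B_def)
      then show "x \<in> V" using gf by (auto simp: S_def)
    qed
    have BD: "B \<inter> D = g ` {x \<in> K. x $ 1 = 0}"
    proof
      show "B \<inter> D \<subseteq> g ` {x \<in> K. x $ 1 = 0}"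
      proof
        fix x assume x: "x \<in> B \<inter> D"
        then have "x \<in> U" "f x \<in> K" "f x $ 1 = 0" using DU by (auto simp: B_def)
        then show "x \<in> g ` {x \<in> K. x $ 1 = 0}" using gf by (intro image_eqI[of _ _ "f x"]) auto
      qed
      show "g ` {x \<in> K. x $ 1 = 0} \<subseteq> B \<inter> D"
      proof
        fix z assume "z \<in> g ` {x \<in> K. x $ 1 = 0}"
        then obtain x where x: "z = g x" "x \<in> K" "x $ 1 = 0" by auto
        then have "g x \<in> U" "f (g x) = x" using KW gU fg by auto
        then show "z \<in> B \<inter> D" using x DU by (auto simp: B_def)
      qed
    qed
    have "convex {x \<in> K. x $ 1 = 0}"
    proof -
      have "{x \<in> K. x $ 1 = 0} = box a' b \<inter> {x. x \<bullet> axis 1 1 = 0}"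
        by (auto simp: K_def inner_axis)
      moreover have "convex \<dots>"
        using convex_hyperplane[of "axis 1 1 :: real^3" 0]
        by (intro convex_Int convex_box) (simp add: inner_commute)
      ultimately show ?thesis by simp
    qed
    then have "connectedin (top_of_set W) {x \<in> K. x $ 1 = 0}"
      using KW by (auto simp: connectedin_subtopology convex_connected)
    then have con: "connectedin N (B \<inter> D)"
      unfolding BD by (rule connectedin_continuous_map_image[OF cgN])
    have abK: "box a b = {x \<in> K. 0 < x $ 1}"
    proof (intro set_eqI iffI)
      fix x assume x: "x \<in> box a b"
      have x1: "0 < x $ 1" using x by (auto simp: mem_box_cart a_def dest: spec[of _ 1])
      moreover have "a' $ i < x $ i" for i
      proof (cases "i = 1")
        case True then show ?thesis using x1 y0 \<delta> by (simp add: a'_def)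
      next
        case False
        have "a $ i < x $ i" using x by (simp add: mem_box_cart)
        then show ?thesis using False by (simp add: a_def a'_def)
      qed
      ultimately show "x \<in> {x \<in> K. 0 < x $ 1}" using x by (auto simp: K_def mem_box_cart)
    next
      fix x assume x: "x \<in> {x \<in> K. 0 < x $ 1}"
      have "a $ i < x $ i" for i
        using x by (cases "i = 1") (auto simp: K_def mem_box_cart a_def a'_def)
      then show "x \<in> box a b" using x by (auto simp: K_def mem_box_cart)
    qed
    have "(\<chi> i. if i = 1 then \<delta> / 2 else y $ i) \<in> box a b"
      using \<delta> y0 by (auto simp: mem_box_cart a_def b_def)
    then have ne: "box a b \<noteq> {}" by blast
    have abW: "box a b \<subseteq> W" using abK KW by auto
    have "homeomorphic_maps (subtopology (subtopology N U) (B - D)) (subtopology (top_of_set W) (box a b)) f g"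
    proof (rule homeomorphic_maps_subtopologies[OF U(4)])
      show "f ` (topspace (subtopology N U) \<inter> (B - D)) = topspace (top_of_set W) \<inter> box a b"
      proof
        show "f ` (topspace (subtopology N U) \<inter> (B - D)) \<subseteq> topspace (top_of_set W) \<inter> box a b"
        proof
          fix z assume "z \<in> f ` (topspace (subtopology N U) \<inter> (B - D))"
          then obtain x where x: "z = f x" "x \<in> U" "x \<in> B" "x \<notin> D" using tU by auto
          then have "f x \<in> K" "f x $ 1 \<noteq> 0" "0 \<le> f x $ 1"
            using DU[OF x(2)] WH[OF fW[OF x(2)]] by (auto simp: B_def)
          then have "f x \<in> box a b" unfolding abK by auto
          then show "z \<in> topspace (top_of_set W) \<inter> box a b" using x fW by auto
        qed
        show "topspace (top_of_set W) \<inter> box a b \<subseteq> f ` (topspace (subtopology N U) \<inter> (B - D))"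
        proof
          fix z assume z: "z \<in> topspace (top_of_set W) \<inter> box a b"
          then have zW: "z \<in> W" and zK: "z \<in> K" "z $ 1 \<noteq> 0" unfolding abK by auto
          have "g z \<in> U" "f (g z) = z" using gU[OF zW] fg[OF zW] by auto
          then have "g z \<in> B - D" using zK DU[of "g z"] by (auto simp: B_def)
          then show "z \<in> f ` (topspace (subtopology N U) \<inter> (B - D))"
            using \<open>g z \<in> U\<close> \<open>f (g z) = z\<close> tU by (intro image_eqI[of _ _ "g z"]) auto
        qed
      qed
    qed
    moreover have "U \<inter> (B - D) = B - D" "W \<inter> box a b = box a b" using abW by (auto simp: B_def)
    ultimately have "homeomorphic_maps (subtopology N (B - D)) (top_of_set (box a b)) f g"
      by (simp add: subtopology_subtopology)
    then have "top_of_set (box a b) homeomorphic_space subtopology N (B - D)"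
      unfolding homeomorphic_space_def using homeomorphic_maps_sym by blast
    then have "half_box N D B" unfolding half_box_def using Bo con ne by blast
    then show ?thesis using pB BV by blast
  qed
  moreover have "closedin N D" unfolding D_def using openin_euclidean3_points by blast
  ultimately show ?thesis unfolding half_boxed_def D_def[symmetric] by blast
qed

lemma half_box_nonempty: "half_box N D B \<Longrightarrow> B - D \<noteq> {}"
  and connectedin_half_box: "half_box N D B \<Longrightarrow> connectedin N (B - D)"
proof -
  assume "half_box N D B"
  then obtain a b :: "real^3" where ab: "openin N B" "box a b \<noteq> {}"
    "top_of_set (box a b) homeomorphic_space subtopology N (B - D)"
    by (auto simp: half_box_def)
  obtain f where "continuous_map (top_of_set (box a b)) (subtopology N (B - D)) f"
    using ab(3) unfolding homeomorphic_space_def homeomorphic_maps_def by blast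
  then show "B - D \<noteq> {}" using ab(2) by (fastforce simp: continuous_map_def)
  have "connectedin euclidean (box a b)" by (simp add: convex_connected)
  then have "connected_space (top_of_set (box a b))" by (simp add: connectedin_def)
  then have "connected_space (subtopology N (B - D))"
    using homeomorphic_connected_space[OF ab(3)] by simp
  moreover have "B - D \<subseteq> topspace N" using openin_subset[OF ab(1)] by auto
  ultimately show "connectedin N (B - D)" by (simp add: connectedin_def)
qed

lemma trivial_over_half_box:
  assumes B: "half_box N D B" and F: "cocycle N U F" and cov: "B - D \<subseteq> (\<Union>k. U k)"
  shows "\<exists>h. trivializes N U F (B - D) h"
proof -
  obtain a b :: "real^3" and f g where ab: "openin N B"
    "homeomorphic_maps (top_of_set (box a b)) (subtopology N (B - D)) f g"
    using B by (auto simp: half_box_def homeomorphic_space_def)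
  have t: "topspace (subtopology N (B - D)) = B - D" using openin_subset[OF ab(1)] by auto
  have cf: "continuous_map (top_of_set (box a b)) (subtopology N (B - D)) f"
    and cg: "continuous_map (subtopology N (B - D)) (top_of_set (box a b)) g"
    and fg: "\<And>y. y \<in> B - D \<Longrightarrow> f (g y) = y"
    using ab(2) t unfolding homeomorphic_maps_def by auto
  have cfN: "continuous_map (top_of_set (box a b)) N f"
    using cf by (simp add: continuous_map_in_subtopology)
  let ?U = "\<lambda>k. {x \<in> box a b. f x \<in> U k}"
  have co: "cocycle (top_of_set (box a b)) ?U (\<lambda>k x. F k (f x))"
    using cocycle_pullback[OF F cfN] by simp
  have "box a b \<subseteq> (\<Union>k. ?U k)"
  proof
    fix x assume x: "x \<in> box a b"
    then have "f x \<in> B - D" using cf t by (auto simp: continuous_map_def)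
    then show "x \<in> (\<Union>k. ?U k)" using x cov by auto
  qed
  then obtain h where h: "trivializes (top_of_set (box a b)) ?U (\<lambda>k x. F k (f x)) (box a b) h"
    using trivial_over_box[OF co] by blast
  have gb: "g x \<in> box a b" if "x \<in> B - D" for x
    using cg that t by (auto simp: continuous_map_def)
  have tr: "trivializes (subtopology N (B - D)) U (\<lambda>k x. F k (f (g x))) (B - D) (\<lambda>x. h (g x))"
    by (rule trivializes_pullback[OF h cg]) (use gb fg in auto)
  have "trivializes (subtopology N (B - D)) U F (B - D) (\<lambda>x. h (g x))"
    unfolding trivializes_def
  proof
    fix k
    have L: "locally_constant_on (subtopology N (B - D)) (U k \<inter> (B - D)) (\<lambda>x. h (g x) - F k (f (g x)))"
      using tr by (simp add: trivializes_def)
    show "locally_constant_on (subtopology N (B - D)) (U k \<inter> (B - D)) (\<lambda>x. h (g x) - F k x)"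
      by (rule locally_constant_on_cong[THEN iffD1, OF _ L]) (use fg in auto)
  qed
  then show ?thesis using trivializes_subtopology[of "B - D" "B - D" N] by blast
qed

text \<open>
  For \<open>q\<close> in the boundary \<open>D\<close>, the value that \<open>f\<close> takes at all interior points close to \<open>q\<close>.
\<close>

definition germ_value :: "'a topology \<Rightarrow> 'a set \<Rightarrow> ('a \<Rightarrow> 'b) \<Rightarrow> 'a \<Rightarrow> 'b \<Rightarrow> bool" where
  "germ_value N D f q v \<longleftrightarrow> (\<exists>V. openin N V \<and> q \<in> V \<and> (\<forall>x\<in>V - D. f x = v))"

lemma germ_value_unique:
  assumes hb: "half_boxed N D" and q: "q \<in> D" and v: "germ_value N D f q v" "germ_value N D f q v'"
  shows "v = v'"
proof -
  obtain V where V: "openin N V" "q \<in> V" "\<forall>x\<in>V - D. f x = v"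
    using v(1) by (auto simp: germ_value_def)
  obtain V' where V': "openin N V'" "q \<in> V'" "\<forall>x\<in>V' - D. f x = v'"
    using v(2) by (auto simp: germ_value_def)
  have o: "openin N (V \<inter> V')" and qV: "q \<in> V \<inter> V'" using V V' by auto
  obtain B where B: "B \<subseteq> V \<inter> V'" "half_box N D B"
    by (rule half_boxedE[OF hb q o qV]) (rule that, assumption+)
  obtain x where "x \<in> B - D" using half_box_nonempty[OF B(2)] by blast
  then show ?thesis using V(3) V'(3) B(1) by (metis DiffD1 DiffD2 DiffI IntE subsetD)
qed

lemma germ_value_combine:
  assumes "germ_value N D f q v" "germ_value N D g q w"
  shows "germ_value N D (\<lambda>x. G (f x) (g x)) q (G v w)"
proof -
  obtain V where V: "openin N V" "q \<in> V" "\<forall>x\<in>V - D. f x = v"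
    using assms(1) by (auto simp: germ_value_def)
  obtain W where W: "openin N W" "q \<in> W" "\<forall>x\<in>W - D. g x = w"
    using assms(2) by (auto simp: germ_value_def)
  have "openin N (V \<inter> W)" "q \<in> V \<inter> W" "\<forall>x\<in>V \<inter> W - D. G (f x) (g x) = G v w"
    using V W by auto
  then show ?thesis unfolding germ_value_def by blast
qed

text \<open>
  Arbitrarily small half boxes have connected interior parts.
\<close>

lemma germ_value_exists:
  assumes hb: "half_boxed N D" and q: "q \<in> D" and B: "openin N B" "q \<in> B"
    and lc: "locally_constant_on N (B - D) f"
  shows "\<exists>v. germ_value N D f q v"
proof -
  obtain B' where B': "q \<in> B'" "B' \<subseteq> B" "half_box N D B'"
    by (rule half_boxedE[OF hb q B]) (rule that, assumption+)
  obtain x where x: "x \<in> B' - D" using half_box_nonempty[OF B'(3)] by blast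
  have "f y = f x" if "y \<in> B' - D" for y
    by (rule locally_constant_on_connectedin[OF lc connectedin_half_box[OF B'(3)] _ that x])
      (use B'(2) in blast)
  moreover have "openin N B'" using B'(3) by (simp add: half_box_def)
  ultimately show ?thesis unfolding germ_value_def using B'(1) by blast
qed


text \<open>
  Let \<open>G q\<close> be a function near each boundary point \<open>q\<close> such that any two of them agree close to
  the boundary points where both are defined. Choose finitely many closed sets \<open>K q\<close> inside the
  \<open>C q\<close> whose interiors cover \<open>D\<close>. The set where \<open>G q\<close> and \<open>G r\<close> differ on \<open>K q \<inter> K r\<close> has a
  closure that does not meet \<open>D\<close>. After removing these finitely many closed sets, all \<open>G q\<close> agree
  wherever they are compared.
\<close>

lemma germs_glue:
  assumes N: "compact_space N" "Hausdorff_space N" and hb: "half_boxed N D"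
    and C: "\<And>q. q \<in> D \<Longrightarrow> openin N (C q)" "\<And>q. q \<in> D \<Longrightarrow> q \<in> C q"
    and agree: "\<And>q r p. \<lbrakk>q \<in> D; r \<in> D; p \<in> D; p \<in> C q; p \<in> C r\<rbrakk> \<Longrightarrow>
       \<exists>V. openin N V \<and> p \<in> V \<and> (\<forall>x\<in>V - D. G q x = G r x)"
  shows "\<exists>W G'. openin N W \<and> D \<subseteq> W \<and>
    (\<forall>x\<in>W - D. \<exists>q\<in>D. \<exists>V. openin N V \<and> x \<in> V \<and> V \<subseteq> C q \<and> (\<forall>y\<in>V \<inter> W - D. G' y = G q y)) \<and>
    (\<forall>p\<in>D. \<exists>V. openin N V \<and> p \<in> V \<and> V \<subseteq> W \<and> (\<forall>y\<in>V - D. G' y = G p y))"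
proof -
  have Dcl: "closedin N D" using hb by (simp add: half_boxed_def)
  then have DN: "D \<subseteq> topspace N" by (rule closedin_subset)
  have "regular_space N" using N compact_Hausdorff_imp_regular_space by blast
  have "\<forall>q. \<exists>V K. q \<in> D \<longrightarrow> openin N V \<and> closedin N K \<and> q \<in> V \<and> V \<subseteq> K \<and> K \<subseteq> C q"
  proof
    fix q
    show "\<exists>V K. q \<in> D \<longrightarrow> openin N V \<and> closedin N K \<and> q \<in> V \<and> V \<subseteq> K \<and> K \<subseteq> C q"
    proof (cases "q \<in> D")
      case True
      then have "\<exists>U V. openin N U \<and> closedin N V \<and> q \<in> U \<and> U \<subseteq> V \<and> V \<subseteq> C q"
        using \<open>regular_space N\<close> C[OF True]
        unfolding neighbourhood_base_of_closedin[symmetric] neighbourhood_base_of by blast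
      then show ?thesis by blast
    qed blast
  qed
  from choice[OF this] obtain V where
    "\<forall>q. \<exists>K. q \<in> D \<longrightarrow> openin N (V q) \<and> closedin N K \<and> q \<in> V q \<and> V q \<subseteq> K \<and> K \<subseteq> C q" by blast
  from choice[OF this] obtain K where
    VK: "\<And>q. q \<in> D \<Longrightarrow> openin N (V q) \<and> closedin N (K q) \<and> q \<in> V q \<and> V q \<subseteq> K q \<and> K q \<subseteq> C q"
    by blast
  have "compactin N D" using N(1) Dcl closedin_compact_space by blast
  moreover have "\<And>U. U \<in> V ` D \<Longrightarrow> openin N U" using VK by blast
  moreover have "D \<subseteq> \<Union>(V ` D)" using VK by blast
  ultimately obtain \<F> where "finite \<F>" "\<F> \<subseteq> V ` D" "D \<subseteq> \<Union>\<F>" by (rule compactinD[THEN exE]) blast+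
  then obtain Q where Q: "finite Q" "Q \<subseteq> D" "D \<subseteq> (\<Union>q\<in>Q. V q)"
    using finite_subset_image[of \<F> V D] by blast
  (* where G q and G r disagree, closed up; this set misses D, since they agree near points of D *)
  define Z where "Z q r = N closure_of {x \<in> K q \<inter> K r - D. G q x \<noteq> G r x}" for q r
  have ZD: "Z q r \<inter> D = {}" if qr: "q \<in> Q" "r \<in> Q" for q r
  proof (rule ccontr)
    assume "Z q r \<inter> D \<noteq> {}"
    then obtain p where p: "p \<in> Z q r" "p \<in> D" by blast
    have qrD: "q \<in> D" "r \<in> D" using qr Q(2) by auto
    have "Z q r \<subseteq> K q \<inter> K r" unfolding Z_def
      by (rule closure_of_minimal) (use VK qrD in auto)
    then have "p \<in> C q" "p \<in> C r" using p(1) VK[OF qrD(1)] VK[OF qrD(2)] by blast+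
    then have "\<exists>V. openin N V \<and> p \<in> V \<and> (\<forall>x\<in>V - D. G q x = G r x)"
      by (rule agree[OF qrD p(2)])
    then obtain V' where V': "openin N V'" "p \<in> V'" "\<forall>x\<in>V' - D. G q x = G r x"
      by (elim exE conjE) (rule that, assumption+)
    have "\<forall>T. p \<in> T \<and> openin N T \<longrightarrow> (\<exists>y. y \<in> {x \<in> K q \<inter> K r - D. G q x \<noteq> G r x} \<and> y \<in> T)"
      using p(1) unfolding Z_def in_closure_of by (rule conjunct2)
    then have "\<exists>y. y \<in> {x \<in> K q \<inter> K r - D. G q x \<noteq> G r x} \<and> y \<in> V'" using V'(1,2) by simp
    then show False using V'(3) by auto
  qed
  define W where "W = (\<Union>q\<in>Q. V q) - (\<Union>(q, r)\<in>Q \<times> Q. Z q r)"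
  have Wo: "openin N W" unfolding W_def
  proof (rule openin_diff)
    show "openin N (\<Union>q\<in>Q. V q)" using VK Q(2) by blast
    show "closedin N (\<Union>(q, r)\<in>Q \<times> Q. Z q r)"
      using Q(1) by (intro closedin_Union) (auto simp: Z_def)
  qed
  have DW: "D \<subseteq> W" unfolding W_def using Q(3) ZD by blast
  define G' where "G' x = G (SOME q. q \<in> Q \<and> x \<in> K q) x" for x
  have G': "G' x = G q x" if x: "x \<in> W - D" and q: "q \<in> Q" "x \<in> K q" for x q
  proof -
    define r where "r = (SOME q. q \<in> Q \<and> x \<in> K q)"
    have r: "r \<in> Q \<and> x \<in> K r" unfolding r_def by (rule someI[of _ q]) (use q in blast)
    have xN: "x \<in> topspace N" using openin_subset[OF Wo] x by blast
    have "x \<notin> Z r q" using x r q by (auto simp: W_def)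
    moreover have "x \<in> Z r q" if "G r x \<noteq> G q x"
      unfolding Z_def
    proof (rule subsetD[OF closure_of_subset_Int])
      show "x \<in> topspace N \<inter> {x \<in> K r \<inter> K q - D. G r x \<noteq> G q x}" using xN x r q that by simp
    qed
    ultimately have "G r x = G q x" by (rule contrapos_np)
    then show ?thesis by (simp add: G'_def r_def)
  qed
  have VW: "G' y = G q y" if "q \<in> Q" "y \<in> V q \<inter> W - D" for q y
    using G'[of y q] that VK[of q] Q(2) by blast
  show ?thesis
  proof (rule exI[of _ W], rule exI[of _ G'], intro conjI ballI Wo DW)
    fix x assume x: "x \<in> W - D"
    then obtain q where q: "q \<in> Q" "x \<in> V q" by (auto simp: W_def)
    then have "openin N (V q) \<and> x \<in> V q \<and> V q \<subseteq> C q \<and> (\<forall>y\<in>V q \<inter> W - D. G' y = G q y)"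
      using VK[of q] Q(2) VW by blast
    then show "\<exists>q\<in>D. \<exists>V. openin N V \<and> x \<in> V \<and> V \<subseteq> C q \<and> (\<forall>y\<in>V \<inter> W - D. G' y = G q y)"
      using q(1) Q(2) by blast
  next
    fix p assume p: "p \<in> D"
    then obtain q where q: "q \<in> Q" "p \<in> V q" using Q(3) by blast
    have qD: "q \<in> D" using q(1) Q(2) by blast
    obtain V' where V': "openin N V'" "p \<in> V'" "\<forall>x\<in>V' - D. G q x = G p x"
      using agree[OF qD p p _ C(2)[OF p]] q(2) VK[OF qD] by (metis subsetD)
    have "openin N (V' \<inter> V q \<inter> W)" "p \<in> V' \<inter> V q \<inter> W"
      using V' Wo VK[OF qD] q(2) DW p by auto
    moreover have "G' y = G p y" if "y \<in> V' \<inter> V q \<inter> W - D" for y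
    proof -
      have "G' y = G q y" using VW[OF q(1)] that by blast
      also have "G q y = G p y" using V'(3) that by blast
      finally show ?thesis .
    qed
    ultimately show "\<exists>V. openin N V \<and> p \<in> V \<and> V \<subseteq> W \<and> (\<forall>y\<in>V - D. G' y = G p y)"
      by (intro exI[of _ "V' \<inter> V q \<inter> W"]) blast
  qed
qed

lemma locally_constant_extends_inward:
  assumes N: "compact_space N" "Hausdorff_space N" and hb: "half_boxed N D"
    and f: "locally_constant_on N D f"
  shows "\<exists>W G. openin N W \<and> D \<subseteq> W \<and> locally_constant_on N (W - D) G \<and>
    (\<forall>p\<in>D. \<exists>V. openin N V \<and> p \<in> V \<and> V \<subseteq> W \<and> (\<forall>y\<in>V - D. G y = f p))"
proof -
  have DN: "D \<subseteq> topspace N" using hb closedin_subset by (auto simp: half_boxed_def)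
  have "\<forall>q. \<exists>C. q \<in> D \<longrightarrow> openin N C \<and> q \<in> C \<and> (\<forall>y\<in>C \<inter> D. f y = f q)"
    using f DN unfolding locally_constant_on_def by blast
  from choice[OF this] obtain C where
    C: "\<And>q. q \<in> D \<Longrightarrow> openin N (C q)" "\<And>q. q \<in> D \<Longrightarrow> q \<in> C q"
      "\<And>q y. q \<in> D \<Longrightarrow> y \<in> C q \<Longrightarrow> y \<in> D \<Longrightarrow> f y = f q" by blast
  have "\<exists>W G. openin N W \<and> D \<subseteq> W \<and>
    (\<forall>x\<in>W - D. \<exists>q\<in>D. \<exists>V. openin N V \<and> x \<in> V \<and> V \<subseteq> C q \<and> (\<forall>y\<in>V \<inter> W - D. G y = f q)) \<and>
    (\<forall>p\<in>D. \<exists>V. openin N V \<and> p \<in> V \<and> V \<subseteq> W \<and> (\<forall>y\<in>V - D. G y = f p))"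
  proof (rule germs_glue[OF N hb C(1,2), of "\<lambda>q x. f q"])
    fix q r p assume qrp: "q \<in> D" "r \<in> D" "p \<in> D" "p \<in> C q" "p \<in> C r"
    then have "f q = f r" using C(3)[of q p] C(3)[of r p] by simp
    then show "\<exists>V. openin N V \<and> p \<in> V \<and> (\<forall>x\<in>V - D. f q = f r)"
      using qrp(3) DN by (intro exI[of _ "topspace N"]) auto
  qed
  then obtain W G where W: "openin N W" "D \<subseteq> W"
    "\<forall>x\<in>W - D. \<exists>q\<in>D. \<exists>V. openin N V \<and> x \<in> V \<and> V \<subseteq> C q \<and> (\<forall>y\<in>V \<inter> W - D. G y = f q)"
    "\<forall>p\<in>D. \<exists>V. openin N V \<and> p \<in> V \<and> V \<subseteq> W \<and> (\<forall>y\<in>V - D. G y = f p)"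
    by (elim exE conjE) (rule that, assumption+)
  have "locally_constant_on N (W - D) G"
  proof (rule locally_constant_onI)
    fix x assume x: "x \<in> topspace N" "x \<in> W - D"
    obtain q V where qV: "openin N V" "x \<in> V" "\<forall>y\<in>V \<inter> W - D. G y = f q"
      using bspec[OF W(3) x(2)] by (elim bexE exE conjE) (rule that, assumption+)
    have "G y = G x" if "y \<in> V \<inter> (W - D)" for y
    proof -
      have "G y = f q" "G x = f q" using qV(2,3) x that by blast+
      then show ?thesis by simp
    qed
    then show "\<exists>V. openin N V \<and> x \<in> V \<and> (\<forall>y\<in>V \<inter> (W - D). G y = G x)" using qV(1,2) by blast
  qed
  then show ?thesis using W(1,2,4) by (rule_tac exI[of _ W], rule_tac exI[of _ G]) (intro conjI)
qed

section \<open>Extending cocycles over the boundary\<close>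

lemma connected_component_boundary_open:
  assumes hb: "half_boxed N D" and C: "C \<in> connected_components_of (subtopology N D)"
  shows "openin (subtopology N D) C"
proof (subst openin_subopen, intro ballI)
  fix p assume p: "p \<in> C"
  have CD: "C \<subseteq> topspace (subtopology N D)" by (rule connected_components_of_subset[OF C])
  then have pD: "p \<in> D" "p \<in> topspace N" using p by auto
  obtain B where B: "p \<in> B" "half_box N D B"
    by (rule half_boxedE[OF hb pD(1) openin_topspace pD(2)]) (rule that, assumption+)
  have "connectedin (subtopology N D) (B \<inter> D)"
    using B(2) by (simp add: half_box_def connectedin_subtopology)
  moreover have "\<not> disjnt C (B \<inter> D)" using p B(1) pD(1) by (auto simp: disjnt_def)
  ultimately have "B \<inter> D \<subseteq> C" by (rule connected_components_of_maximal[OF C])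
  moreover have "openin (subtopology N D) (B \<inter> D)"
    using B(2) by (auto simp: half_box_def openin_subtopology)
  ultimately show "\<exists>T. openin (subtopology N D) T \<and> p \<in> T \<and> T \<subseteq> C"
    using B(1) pD(1) by blast
qed

lemma finite_components_boundary:
  assumes N: "compact_space N" and hb: "half_boxed N D"
  shows "finite (connected_components_of (subtopology N D))"
proof -
  let ?Y = "subtopology N D"
  let ?\<C> = "connected_components_of ?Y"
  have Dcl: "closedin N D" using hb by (simp add: half_boxed_def)
  have "compact_space ?Y" by (rule compact_space_subtopology[OF closedin_compact_space[OF N Dcl]])
  then have cpt: "(\<forall>C\<in>?\<C>. openin ?Y C) \<and> topspace ?Y \<subseteq> \<Union>?\<C> \<longrightarrow>
      (\<exists>\<F>. finite \<F> \<and> \<F> \<subseteq> ?\<C> \<and> topspace ?Y \<subseteq> \<Union>\<F>)"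
    unfolding compact_space_alt by (rule spec)
  have "topspace ?Y \<subseteq> \<Union>?\<C>" using Union_connected_components_of[of ?Y] by simp
  then obtain \<F> where F: "finite \<F>" "\<F> \<subseteq> ?\<C>" "topspace ?Y \<subseteq> \<Union>\<F>"
    using cpt connected_component_boundary_open[OF hb] by blast
  have "?\<C> \<subseteq> \<F>"
  proof
    fix C assume C: "C \<in> ?\<C>"
    obtain p where p: "p \<in> C" using nonempty_connected_components_of[OF C] by blast
    then have "p \<in> topspace ?Y" using connected_components_of_subset[OF C] by blast
    then obtain C' where C': "C' \<in> \<F>" "p \<in> C'" using F(3) by blast
    then have "C = C'"
      using pairwiseD[OF pairwise_disjoint_connected_components_of C, of C'] F(2) p
      by (auto simp: disjnt_def)
    then show "C \<in> \<F>" using C'(1) by simp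
  qed
  then show ?thesis using F(1) finite_subset by blast
qed

text \<open>
  At a boundary point \<open>q\<close> the trivialization \<open>H q\<close> on the interior side serves as the reference.
  Relative to it, the section extending \<open>H p\<close> has at \<open>q\<close> the value that \<open>H p - H q\<close> takes close to
  \<open>q\<close>.
\<close>

definition boundary_cocycle ::
  "'a topology \<Rightarrow> 'a set \<Rightarrow> ('a \<Rightarrow> 'a \<Rightarrow> 'g::ab_group_add) \<Rightarrow> 'a \<Rightarrow> 'a \<Rightarrow> 'g" where
  "boundary_cocycle N D H p q = (SOME v. germ_value N D (\<lambda>x. H p x - H q x) q v)"

lemma boundary_cocycle:
  fixes F :: "'k \<Rightarrow> 'a \<Rightarrow> 'g::ab_group_add"
  assumes hb: "half_boxed N D" and F: "cocycle N U F"
    and B: "\<And>p. p \<in> D \<Longrightarrow> openin N (B p)" "\<And>p. p \<in> D \<Longrightarrow> p \<in> B p"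
    and cov: "\<And>p. p \<in> D \<Longrightarrow> B p - D \<subseteq> (\<Union>k. U k)"
    and H: "\<And>p. p \<in> D \<Longrightarrow> trivializes N U F (B p - D) (H p)"
  shows "\<And>p q. p \<in> D \<Longrightarrow> q \<in> D \<Longrightarrow> q \<in> B p \<Longrightarrow>
      germ_value N D (\<lambda>x. H p x - H q x) q (boundary_cocycle N D H p q)"
    and "cocycle (subtopology N D) (\<lambda>p. if p \<in> D then B p \<inter> D else {}) (boundary_cocycle N D H)"
proof -
  have Uo: "\<And>k. openin N (U k)" using F by (simp add: cocycle_def)
  have lc: "locally_constant_on N (B p \<inter> B r - D) (\<lambda>x. H p x - H r x)" if pr: "p \<in> D" "r \<in> D" for p r
  proof -
    have "locally_constant_on N ((B p - D) \<inter> (B r - D)) (\<lambda>x. H p x - H r x)"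
      by (rule trivializations_differ_locally_constant[OF Uo _ H[OF pr(1)] H[OF pr(2)]])
        (use cov[OF pr(1)] in blast)
    moreover have "(B p - D) \<inter> (B r - D) = B p \<inter> B r - D" by blast
    ultimately show ?thesis by simp
  qed
  have ex: "\<exists>v. germ_value N D (\<lambda>x. H p x - H r x) q v"
    if pr: "p \<in> D" "r \<in> D" and q: "q \<in> D" "q \<in> B p" "q \<in> B r" for p q r
    by (rule germ_value_exists[OF hb q(1) _ _ lc[OF pr]]) (use q B(1)[OF pr(1)] B(1)[OF pr(2)] in auto)
  show g: "germ_value N D (\<lambda>x. H p x - H q x) q (boundary_cocycle N D H p q)"
    if "p \<in> D" "q \<in> D" "q \<in> B p" for p q
    unfolding boundary_cocycle_def
    by (rule someI_ex, rule ex) (use that B(2) in auto)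
  show "cocycle (subtopology N D) (\<lambda>p. if p \<in> D then B p \<inter> D else {}) (boundary_cocycle N D H)"
    unfolding cocycle_def
  proof (intro conjI allI)
    fix p
    show "openin (subtopology N D) (if p \<in> D then B p \<inter> D else {})"
      using B(1)[of p] by (auto simp: openin_subtopology)
  next
    fix p r
    let ?E = "boundary_cocycle N D H"
    show "locally_constant_on (subtopology N D)
       ((if p \<in> D then B p \<inter> D else {}) \<inter> (if r \<in> D then B r \<inter> D else {})) (\<lambda>q. ?E p q - ?E r q)"
    proof (cases "p \<in> D \<and> r \<in> D")
      case True
      then have pr: "p \<in> D" "r \<in> D" by auto
      have "locally_constant_on (subtopology N D) (B p \<inter> D \<inter> (B r \<inter> D)) (\<lambda>q. ?E p q - ?E r q)"
      proof (rule locally_constant_onI)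
        fix q assume q: "q \<in> topspace (subtopology N D)" "q \<in> B p \<inter> D \<inter> (B r \<inter> D)"
        have qD: "q \<in> D" "q \<in> B p" "q \<in> B r" using q by auto
        obtain v where "germ_value N D (\<lambda>x. H p x - H r x) q v" using ex[OF pr qD] by blast
        then obtain V where V: "openin N V" "q \<in> V" "\<forall>x\<in>V - D. H p x - H r x = v"
          unfolding germ_value_def by blast
        have E: "?E p y - ?E r y = v" if y: "y \<in> V" "y \<in> D" "y \<in> B p" "y \<in> B r" for y
        proof -
          have "germ_value N D (\<lambda>x. (H p x - H y x) - (H r x - H y x)) y (?E p y - ?E r y)"
            by (rule germ_value_combine[of _ _ _ _ _ "\<lambda>x. H r x - H y x" _ "(-)"])
              (use g[OF pr(1)] g[OF pr(2)] y in auto)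
          then have "germ_value N D (\<lambda>x. H p x - H r x) y (?E p y - ?E r y)" by simp
          moreover have "germ_value N D (\<lambda>x. H p x - H r x) y v"
            unfolding germ_value_def using V y(1) by blast
          ultimately show ?thesis by (rule germ_value_unique[OF hb y(2)])
        qed
        have "openin (subtopology N D) (V \<inter> D)" using V(1) by (auto simp: openin_subtopology)
        moreover have "?E p y - ?E r y = ?E p q - ?E r q"
          if "y \<in> V \<inter> D \<inter> (B p \<inter> D \<inter> (B r \<inter> D))" for y
          using E[of y] E[OF V(2) qD] that by simp
        ultimately show "\<exists>V. openin (subtopology N D) V \<and> q \<in> V \<and>
            (\<forall>y\<in>V \<inter> (B p \<inter> D \<inter> (B r \<inter> D)). ?E p y - ?E r y = ?E p q - ?E r q)"
          using V(2) qD(1) by (intro exI[of _ "V \<inter> D"]) blast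
      qed
      then show ?thesis using pr by simp
    next
      case False
      then have "(if p \<in> D then B p \<inter> D else {}) \<inter> (if r \<in> D then B r \<inter> D else {}) = {}" by auto
      then show ?thesis by (simp add: locally_constant_on_def)
    qed
  qed
qed

text \<open>
  Over the interior part of each half box a cocycle \<open>F\<close> is trivialized by some \<open>H F p\<close>, and its
  extension \<open>E F\<close> to the boundary has holonomies. If they agree for \<open>F\<close> and \<open>F'\<close>, then the extension
  of the difference has a trivialization \<open>e\<close>. It is the right correction of the local
  trivializations \<open>d q\<close> of the difference: the functions \<open>d q + e q\<close> agree near the boundary and can
  be glued.
\<close>

lemma end_holonomy:
  fixes U :: "'k \<Rightarrow> 'a set"
  assumes N: "compact_space N" "Hausdorff_space N" and hb: "half_boxed N D"
    and Z: "\<And>C. C \<in> connected_components_of (subtopology N D) \<Longrightarrow>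
              square_quotient (subtopology (subtopology N D) C)"
    and W0: "openin N W0" "D \<subseteq> W0" "W0 - D \<subseteq> (\<Union>k. U k)"
  shows "\<exists>\<beta> :: ('k \<Rightarrow> 'a \<Rightarrow> 'g::ab_group_add) \<Rightarrow> 'a set \<Rightarrow> 'g \<times> 'g. \<forall>F F'.
     cocycle N U F \<longrightarrow> cocycle N U F' \<longrightarrow>
     (\<forall>C\<in>connected_components_of (subtopology N D). \<beta> F C = \<beta> F' C) \<longrightarrow>
     (\<exists>W h. openin N W \<and> D \<subseteq> W \<and> W \<subseteq> W0 \<and> trivializes N U (\<lambda>k x. F k x - F' k x) (W - D) h)"
proof -
  let ?Y = "subtopology N D"
  have DN: "D \<subseteq> topspace N" using hb closedin_subset by (auto simp: half_boxed_def)
  have "\<forall>p. \<exists>B. p \<in> D \<longrightarrow> p \<in> B \<and> B \<subseteq> W0 \<and> half_box N D B"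
    using hb W0(1,2) unfolding half_boxed_def by (meson subsetD)
  from choice[OF this] obtain B where
    B: "\<And>p. p \<in> D \<Longrightarrow> p \<in> B p" "\<And>p. p \<in> D \<Longrightarrow> B p \<subseteq> W0" "\<And>p. p \<in> D \<Longrightarrow> half_box N D (B p)" by blast
  have Bo: "openin N (B p)" if "p \<in> D" for p using B(3)[OF that] by (simp add: half_box_def)
  have Bcov: "B p - D \<subseteq> (\<Union>k. U k)" if "p \<in> D" for p using B(2)[OF that] W0(3) by blast
  define H where "H F p = (SOME h. trivializes N U F (B p - D) h)" for F :: "'k \<Rightarrow> 'a \<Rightarrow> 'g" and p
  have H: "trivializes N U F (B p - D) (H F p)" if F: "cocycle N U F" and p: "p \<in> D" for F p
    unfolding H_def by (rule someI_ex[OF trivial_over_half_box[OF B(3)[OF p] F Bcov[OF p]]])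
  define E where "E F = boundary_cocycle N D (H F)" for F
  let ?B = "\<lambda>p. if p \<in> D then B p \<inter> D else {}"
  have Eg: "germ_value N D (\<lambda>x. H F p x - H F q x) q (E F p q)"
    if "cocycle N U F" "p \<in> D" "q \<in> D" "q \<in> B p" for F p q
    unfolding E_def
    by (rule boundary_cocycle(1)[OF hb that(1) Bo B(1) Bcov H[OF that(1)] that(2-4)])
  have Eco: "cocycle ?Y ?B (E F)" if "cocycle N U F" for F
    unfolding E_def by (rule boundary_cocycle(2)[OF hb that Bo B(1) Bcov H[OF that]])
  have Bop: "openin ?Y (?B p)" for p using Bo[of p] by (auto simp: openin_subtopology)
  have "topspace ?Y \<subseteq> (\<Union>p. ?B p)"
  proof
    fix p assume "p \<in> topspace ?Y"
    then have "p \<in> D" by simp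
    then have "p \<in> ?B p" using B(1) by simp
    then show "p \<in> (\<Union>p. ?B p)" by blast
  qed
  from components_holonomy[OF Z connected_component_boundary_open[OF hb] Bop this]
  obtain \<beta> :: "('a \<Rightarrow> 'a \<Rightarrow> 'g) \<Rightarrow> 'a set \<Rightarrow> 'g \<times> 'g" where
    \<beta>: "\<forall>F F'. cocycle ?Y ?B F \<longrightarrow> cocycle ?Y ?B F' \<longrightarrow>
      (\<forall>C\<in>connected_components_of ?Y. \<beta> F C = \<beta> F' C) \<longrightarrow>
      (\<exists>h. trivializes ?Y ?B (\<lambda>k x. F k x - F' k x) (topspace ?Y) h)" by (rule exE)
  show ?thesis
  proof (rule exI[of _ "\<lambda>F. \<beta> (E F)"], intro allI impI)
    fix F F' :: "'k \<Rightarrow> 'a \<Rightarrow> 'g"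
    assume F: "cocycle N U F" and F': "cocycle N U F'"
      and eq: "\<forall>C\<in>connected_components_of ?Y. \<beta> (E F) C = \<beta> (E F') C"
    let ?F = "\<lambda>k x. F k x - F' k x"
    obtain e where e: "trivializes ?Y ?B (\<lambda>p q. E F p q - E F' p q) (topspace ?Y) e"
      using \<beta> Eco[OF F] Eco[OF F'] eq by blast
    define d where "d p x = H F p x - H F' p x" for p x
    have d: "trivializes N U ?F (B p - D) (d p)" if "p \<in> D" for p
      unfolding d_def by (rule trivializes_diff[OF H[OF F that] H[OF F' that]])
    define Ed where "Ed p q = E F p q - E F' p q" for p q
    have Edg: "germ_value N D (\<lambda>x. d p x - d q x) q (Ed p q)" if "p \<in> D" "q \<in> D" "q \<in> B p" for p q
    proof -
      have "germ_value N D (\<lambda>x. (H F p x - H F q x) - (H F' p x - H F' q x)) q (E F p q - E F' p q)"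
        by (rule germ_value_combine[of _ _ _ _ _ "\<lambda>x. H F' p x - H F' q x" _ "(-)"])
          (use Eg[OF F that] Eg[OF F' that] in auto)
      then show ?thesis by (simp add: d_def Ed_def algebra_simps)
    qed
    have Ed0: "Ed q q = 0" if q: "q \<in> D" for q
    proof (rule germ_value_unique[OF hb q Edg[OF q q B(1)[OF q]]])
      show "germ_value N D (\<lambda>x. d q x - d q x) q 0"
        unfolding germ_value_def using q DN by (intro exI[of _ "topspace N"]) auto
    qed
    have "\<forall>q. \<exists>C. q \<in> D \<longrightarrow> openin N C \<and> q \<in> C \<and> C \<subseteq> B q \<and> (\<forall>r\<in>C \<inter> D. e r - Ed q r = e q)"
    proof
      fix q
      show "\<exists>C. q \<in> D \<longrightarrow> openin N C \<and> q \<in> C \<and> C \<subseteq> B q \<and> (\<forall>r\<in>C \<inter> D. e r - Ed q r = e q)"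
      proof (cases "q \<in> D")
        case True
        have "locally_constant_on ?Y (?B q \<inter> topspace ?Y) (\<lambda>r. e r - Ed q r)"
          using e unfolding trivializes_def Ed_def by blast
        moreover have "?B q \<inter> topspace ?Y = B q \<inter> D" using True DN by auto
        ultimately have "locally_constant_on ?Y (B q \<inter> D) (\<lambda>r. e r - Ed q r)" by simp
        then have L: "locally_constant_on N (B q \<inter> D) (\<lambda>r. e r - Ed q r)"
          by (subst (asm) locally_constant_on_subtopology) auto
        have q: "q \<in> topspace N" "q \<in> B q \<inter> D" using True DN B(1) by auto
        obtain V where V: "openin N V" "q \<in> V" "\<forall>r\<in>V \<inter> (B q \<inter> D). e r - Ed q r = e q - Ed q q"
          by (rule locally_constant_onE[OF L q]) (rule that, assumption+)
        have "openin N (V \<inter> B q)" using V(1) Bo[OF True] by blast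
        moreover have "\<forall>r\<in>V \<inter> B q \<inter> D. e r - Ed q r = e q"
          using V(3) Ed0[OF True] by auto
        ultimately show ?thesis using V(2) B(1)[OF True] by (intro exI[of _ "V \<inter> B q"]) blast
      qed simp
    qed
    from choice[OF this] obtain C where
      C: "\<And>q. q \<in> D \<Longrightarrow> openin N (C q)" "\<And>q. q \<in> D \<Longrightarrow> q \<in> C q" "\<And>q. q \<in> D \<Longrightarrow> C q \<subseteq> B q"
        "\<And>q. q \<in> D \<Longrightarrow> \<forall>r\<in>C q \<inter> D. e r - Ed q r = e q" by blast
    define G where "G q x = d q x + e q" for q x
    (* close to p, the function G q coincides with the one that belongs to p itself *)
    have near: "\<exists>V. openin N V \<and> p \<in> V \<and> (\<forall>x\<in>V - D. G q x = d p x + e p)"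
      if q: "q \<in> D" and p: "p \<in> D" "p \<in> C q" for p q
    proof -
      have "p \<in> B q" using C(3)[OF q] p(2) by blast
      then obtain V where V: "openin N V" "p \<in> V" "\<forall>x\<in>V - D. d q x - d p x = Ed q p"
        using Edg[OF q p(1)] unfolding germ_value_def by blast
      have "e p - Ed q p = e q" using C(4)[OF q] p by blast
      then have "\<forall>x\<in>V - D. G q x = d p x + e p"
        using V(3) by (auto simp: G_def algebra_simps)
      then show ?thesis using V(1,2) by blast
    qed
    have agree: "\<exists>V. openin N V \<and> p \<in> V \<and> (\<forall>x\<in>V - D. G q x = G r x)"
      if a: "q \<in> D" "r \<in> D" "p \<in> D" "p \<in> C q" "p \<in> C r" for q r p
    proof -
      obtain V where V: "openin N V" "p \<in> V" "\<forall>x\<in>V - D. G q x = d p x + e p"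
        using near[OF a(1,3,4)] by (elim exE conjE) (rule that, assumption+)
      obtain V' where V': "openin N V'" "p \<in> V'" "\<forall>x\<in>V' - D. G r x = d p x + e p"
        using near[OF a(2,3,5)] by (elim exE conjE) (rule that, assumption+)
      have "openin N (V \<inter> V')" "p \<in> V \<inter> V'" "\<forall>x\<in>V \<inter> V' - D. G q x = G r x"
        using V V' by auto
      then show ?thesis by blast
    qed
    have "\<exists>W G'. openin N W \<and> D \<subseteq> W \<and>
      (\<forall>x\<in>W - D. \<exists>q\<in>D. \<exists>V. openin N V \<and> x \<in> V \<and> V \<subseteq> C q \<and> (\<forall>y\<in>V \<inter> W - D. G' y = G q y)) \<and>
      (\<forall>p\<in>D. \<exists>V. openin N V \<and> p \<in> V \<and> V \<subseteq> W \<and> (\<forall>y\<in>V - D. G' y = G p y))"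
    proof (rule germs_glue[OF N hb C(1,2)])
      fix q r p assume "q \<in> D" "r \<in> D" "p \<in> D" "p \<in> C q" "p \<in> C r"
      then show "\<exists>V. openin N V \<and> p \<in> V \<and> (\<forall>x\<in>V - D. G q x = G r x)" by (rule agree)
    qed
    then obtain W G' where W: "openin N W" "D \<subseteq> W"
      "\<forall>x\<in>W - D. \<exists>q\<in>D. \<exists>V. openin N V \<and> x \<in> V \<and> V \<subseteq> C q \<and> (\<forall>y\<in>V \<inter> W - D. G' y = G q y)"
      by (elim exE conjE) (rule that, assumption+)
    have "locally_constant_on N (U k \<inter> (W - D)) (\<lambda>x. G' x - ?F k x)" for k
    proof (rule locally_constant_onI)
      fix x assume x: "x \<in> topspace N" "x \<in> U k \<inter> (W - D)"
      then have "x \<in> W - D" by blast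
      then obtain q V where q: "q \<in> D" and V: "openin N V" "x \<in> V" "V \<subseteq> C q"
        "\<forall>y\<in>V \<inter> W - D. G' y = G q y"
        using W(3) by blast
      have L: "locally_constant_on N (U k \<inter> (B q - D)) (\<lambda>x. d q x - ?F k x)"
        using d[OF q] by (simp add: trivializes_def)
      have xB: "x \<in> U k \<inter> (B q - D)" using x V(2,3) C(3)[OF q] by blast
      obtain V' where V': "openin N V'" "x \<in> V'"
        "\<forall>y\<in>V' \<inter> (U k \<inter> (B q - D)). d q y - ?F k y = d q x - ?F k x"
        by (rule locally_constant_onE[OF L x(1) xB]) (rule that, assumption+)
      have "G' y - ?F k y = G' x - ?F k x" if y: "y \<in> V \<inter> V' \<inter> (U k \<inter> (W - D))" for y
      proof -
        have "G' y = d q y + e q" "G' x = d q x + e q"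
          using V(2,4) y x by (auto simp: G_def)
        moreover have "d q y - ?F k y = d q x - ?F k x"
          using V'(3) y V(3) C(3)[OF q] by blast
        ultimately show ?thesis by (simp add: algebra_simps)
      qed
      then show "\<exists>V. openin N V \<and> x \<in> V \<and> (\<forall>y\<in>V \<inter> (U k \<inter> (W - D)). G' y - ?F k y = G' x - ?F k x)"
        using V(1,2) V'(1,2) by (intro exI[of _ "V \<inter> V'"]) blast
    qed
    then have "trivializes N U ?F (W - D) G'" by (simp add: trivializes_def)
    then have "trivializes N U ?F (W \<inter> W0 - D) G'" by (rule trivializes_subset) blast
    then show "\<exists>W h. openin N W \<and> D \<subseteq> W \<and> W \<subseteq> W0 \<and> trivializes N U ?F (W - D) h"
      using W(1,2) W0(1,2) by (intro exI[of _ "W \<inter> W0"] exI[of _ G']) blast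
  qed
qed

section \<open>The tetrahedra without their vertices\<close>

definition punctured_simplices :: "('n \<times> (real^4)) topology" where
  "punctured_simplices = subtopology disjoint_simplices {(i, x). \<forall>v. x $ v < 1}"

lemma topspace_punctured_simplices:
  "topspace punctured_simplices = {(i, x). x \<in> simplex3 \<and> (\<forall>v. x $ v < 1)}"
  by (auto simp: punctured_simplices_def disjoint_simplices_def)

lemma mem_punctured [simp]:
  "(i, x) \<in> topspace punctured_simplices \<longleftrightarrow> x \<in> simplex3 \<and> (\<forall>v. x $ v < 1)"
  by (simp add: topspace_punctured_simplices)

lemma openin_disjoint_simplices_slice:
  assumes "open S"
  shows "openin disjoint_simplices {(j, x). j \<in> I \<and> x \<in> simplex3 \<and> x \<in> S}"
proof -
  have "{(j, x). j \<in> I \<and> x \<in> simplex3 \<and> x \<in> S} = I \<times> (simplex3 \<inter> S)" by auto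
  moreover have "openin disjoint_simplices (I \<times> (simplex3 \<inter> S))"
    unfolding disjoint_simplices_def openin_prod_Times_iff using assms by (simp add: openin_open_Int)
  ultimately show ?thesis by simp
qed

lemma openin_punctured_slice:
  assumes "open S"
  shows "openin punctured_simplices {(j, x). (j, x) \<in> topspace punctured_simplices \<and> j \<in> I \<and> x \<in> S}"
proof -
  have "{(j, x). (j, x) \<in> topspace punctured_simplices \<and> j \<in> I \<and> x \<in> S}
      = {(j, x). j \<in> I \<and> x \<in> simplex3 \<and> x \<in> S} \<inter> {(i, x). \<forall>v. x $ v < 1}" by auto
  then show ?thesis unfolding punctured_simplices_def
    using openin_disjoint_simplices_slice[OF assms, of I] by (auto simp: openin_subtopology)
qed

lemma connectedin_punctured_slice:
  assumes "convex S" "S \<subseteq> {x. x \<in> simplex3 \<and> (\<forall>v. x $ v < 1)}"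
  shows "connectedin punctured_simplices ({i} \<times> S)"
proof -
  have "connectedin (top_of_set simplex3) S"
    using assms by (auto simp: connectedin_subtopology convex_connected)
  then have "connectedin disjoint_simplices ({i} \<times> S)"
    unfolding disjoint_simplices_def connectedin_Times by simp
  then show ?thesis unfolding punctured_simplices_def connectedin_subtopology using assms(2) by auto
qed

lemma convex_simplex3: "convex simplex3"
proof -
  have "simplex3 = {x :: real^4. \<forall>v. 0 \<le> x $ v} \<inter> {x. (\<chi> i. 1) \<bullet> x = 1}"
    by (auto simp: simplex3_def inner_vec_def)
  moreover have "convex {x :: real^4. \<forall>v. 0 \<le> x $ v}"
    unfolding convex_def by auto
  ultimately show ?thesis using convex_hyperplane by (metis convex_Int)
qed

lemma simplex3_sum: "x \<in> simplex3 \<Longrightarrow> (\<Sum>v\<in>UNIV. x $ v) = 1" and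
  simplex3_nonneg: "x \<in> simplex3 \<Longrightarrow> 0 \<le> x $ v"
  by (auto simp: simplex3_def)

lemma simplex3_pair: "x \<in> simplex3 \<Longrightarrow> v \<noteq> w \<Longrightarrow> x $ v + x $ w \<le> 1"
proof -
  assume x: "x \<in> simplex3" and vw: "v \<noteq> w"
  have "(\<Sum>u\<in>{v, w}. x $ u) \<le> (\<Sum>u\<in>UNIV. x $ u)"
    by (rule sum_mono2) (use simplex3_nonneg[OF x] in auto)
  then show ?thesis using vw simplex3_sum[OF x] by simp
qed

lemma simplex3_triple:
  "x \<in> simplex3 \<Longrightarrow> v \<noteq> w \<Longrightarrow> v \<noteq> u \<Longrightarrow> w \<noteq> u \<Longrightarrow> x $ v + x $ w + x $ u \<le> 1"
proof -
  assume x: "x \<in> simplex3" and d: "v \<noteq> w" "v \<noteq> u" "w \<noteq> u"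
  have "(\<Sum>u\<in>{v, w, u}. x $ u) \<le> (\<Sum>u\<in>UNIV. x $ u)"
    by (rule sum_mono2) (use simplex3_nonneg[OF x] in auto)
  then show ?thesis using d simplex3_sum[OF x] by simp
qed

lemma simplex3_vertex: "x \<in> simplex3 \<Longrightarrow> x $ v = 1 \<Longrightarrow> x = axis v 1"
proof -
  assume x: "x \<in> simplex3" "x $ v = 1"
  have "x $ u = 0" if "u \<noteq> v" for u
    using simplex3_pair[OF x(1), of v u] simplex3_nonneg[OF x(1), of u] x(2) that by auto
  then show ?thesis using x(2) by (auto simp: vec_eq_iff axis_def)
qed

lemma gluedE:
  assumes "glued T (i, x) (j, y)"
  obtains f where "x \<in> simplex3" "y \<in> simplex3" "x $ f = 0" "j = adj T i f"
    "\<forall>v. y $ glue T i f v = x $ v"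
  using assms by (auto simp: glued_def)

lemma glued_sym:
  assumes fp: "face_pairing T" and g: "glued T y z"
  shows "glued T z y"
proof -
  obtain i x j x' where yz: "y = (i, x)" "z = (j, x')" by (cases y; cases z)
  obtain f where f: "x \<in> simplex3" "x' \<in> simplex3" "x $ f = 0" "j = adj T i f"
    "\<forall>v. x' $ glue T i f v = x $ v"
    by (rule gluedE[OF g[unfolded yz]]) (rule that, assumption+)
  have bij: "bij (glue T i f)" and adj: "adj T j (glue T i f f) = i"
    and inv: "glue T j (glue T i f f) = inv (glue T i f)"
    using fp f(4) unfolding face_pairing_def by blast+
  have "x $ inv (glue T i f) u = x' $ u" for u
    using f(5) bij by (metis bij_inv_eq_iff)
  moreover have "x' $ glue T i f f = 0" using f(3,5) by simp
  ultimately show ?thesis unfolding yz glued_def using f(1,2) adj inv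
    by (auto intro!: exI[of _ "glue T i f f"])
qed

lemma glued_coordinate:
  assumes fp: "face_pairing T" and g: "glued T (i, x) (j, y)"
  obtains f where "x $ f = 0" "j = adj T i f" "bij (glue T i f)"
    "\<forall>v. y $ glue T i f v = x $ v" "\<forall>u. \<exists>v. u = glue T i f v"
proof -
  obtain f where f: "x $ f = 0" "j = adj T i f" "\<forall>v. y $ glue T i f v = x $ v"
    by (rule gluedE[OF g]) (rule that, assumption+)
  have bij: "bij (glue T i f)" using fp unfolding face_pairing_def by blast
  then have "\<forall>u. \<exists>v. u = glue T i f v" by (metis bij_pointE)
  then show thesis using that f bij by blast
qed

text \<open>
  As gluing is symmetric, a property need only be carried forward along it.
\<close>

lemma equivclp_glued_invariant:
  assumes fp: "face_pairing T" and e: "equivclp (glued T) y z"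
    and P: "P y" and step: "\<And>y z. glued T y z \<Longrightarrow> P y \<Longrightarrow> P z"
  shows "P z"
  using e
proof (induction rule: equivclp_induct)
  case base then show ?case using P .
next
  case (step a b)
  then show ?case using assms(4)[of a b] glued_sym[OF fp, of b a] by blast
qed

text \<open>
  The complement of the vertices is open in the pseudo-manifold, and its preimage consists of the
  points without a barycentric coordinate equal to 1. So \<open>M\<close> is a quotient of the punctured
  simplices.
\<close>

lemma punctured_quotient:
  fixes T :: "'n gluing"
  assumes fp: "face_pairing T"
    and h: "homeomorphic_map M
         (subtopology (pseudo_manifold T) (topspace (pseudo_manifold T) - vertex_points T)) h"
  obtains \<kappa> where "quotient_map punctured_simplices M \<kappa>"
    "\<And>y z. y \<in> topspace punctured_simplices \<Longrightarrow> z \<in> topspace punctured_simplices \<Longrightarrow>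
       \<kappa> y = \<kappa> z \<longleftrightarrow> equivclp (glued T) y z"
proof -
  let ?K = "pseudo_manifold T"
  let ?\<pi> = "class_of (glued T)"
  define V where "V = topspace ?K - vertex_points T"
  have q: "quotient_map disjoint_simplices ?K ?\<pi>"
    unfolding pseudo_manifold_def by (rule quotient_map_class_of)
  have tD: "topspace disjoint_simplices = UNIV \<times> simplex3" by (simp add: disjoint_simplices_def)
  have vert: "?\<pi> (i, x) \<in> vertex_points T \<longleftrightarrow> (\<exists>v. x $ v = 1)" if x: "x \<in> simplex3" for i x
  proof
    assume "?\<pi> (i, x) \<in> vertex_points T"
    then obtain j v where "?\<pi> (i, x) = ?\<pi> (j, axis v 1)" by (auto simp: vertex_points_def)
    then have "equivclp (glued T) (j, axis v 1) (i, x)"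
      using class_of_eq_iff[of "glued T" "(j, axis v 1)" "(i, x)"] by simp
    then have "\<exists>v. snd (i, x) $ v = 1"
    proof (rule equivclp_glued_invariant[OF fp])
      show "\<exists>u. snd (j, axis v 1) $ u = (1 :: real)" by (auto simp: axis_def)
      fix a b :: "'n \<times> (real^4)" assume ab: "glued T a b" "\<exists>u. snd a $ u = 1"
      obtain i x j y where "a = (i, x)" "b = (j, y)" by (cases a; cases b)
      then show "\<exists>u. snd b $ u = 1"
        using ab gluedE[of T i x j y] by (metis snd_conv)
    qed
    then show "\<exists>v. x $ v = 1" by simp
  next
    assume "\<exists>v. x $ v = 1"
    then obtain v where "x = axis v 1" using simplex3_vertex[OF x] by blast
    then show "?\<pi> (i, x) \<in> vertex_points T" by (auto simp: vertex_points_def)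
  qed
  have lt: "(\<forall>v. x $ v < 1) \<longleftrightarrow> \<not> (\<exists>v. x $ v = 1)" if "x \<in> simplex3" for x :: "real^4"
  proof -
    have "x $ v \<le> 1" for v
      using simplex3_pair[OF that, of v "v + 1"] simplex3_nonneg[OF that, of "v + 1"] by auto
    then show ?thesis by (metis less_le)
  qed
  have pre: "{y \<in> topspace disjoint_simplices. ?\<pi> y \<in> V}
      = topspace disjoint_simplices \<inter> {(i, x). \<forall>v. x $ v < 1}"
  proof (intro set_eqI)
    fix y :: "'n \<times> (real^4)"
    obtain i x where y: "y = (i, x)" by (cases y)
    have "?\<pi> (i, x) \<in> topspace ?K" if "x \<in> simplex3"
      using quotient_imp_surjective_map[OF q] tD that by auto
    then show "y \<in> {y \<in> topspace disjoint_simplices. ?\<pi> y \<in> V} \<longleftrightarrow>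
        y \<in> topspace disjoint_simplices \<inter> {(i, x). \<forall>v. x $ v < 1}"
      unfolding y V_def tD using vert[of x i] lt[of x] by auto
  qed
  have "openin disjoint_simplices {(j, x). j \<in> (UNIV :: 'n set) \<and> x \<in> simplex3 \<and> x \<in> (\<Inter>v. {x. x $ v < 1})}"
    by (rule openin_disjoint_simplices_slice)
      (intro open_INT ballI finite open_halfspace_component_lt_cart)
  moreover have "{(j, x). j \<in> (UNIV :: 'n set) \<and> x \<in> simplex3 \<and> x \<in> (\<Inter>v. {x. x $ v < 1})}
      = {y \<in> topspace disjoint_simplices. ?\<pi> y \<in> V}"
    unfolding pre by (auto simp: tD)
  ultimately have "openin disjoint_simplices {y \<in> topspace disjoint_simplices. ?\<pi> y \<in> V}" by simp
  then have Vo: "openin ?K V" using q unfolding quotient_map_def V_def by blast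
  have "quotient_map (subtopology disjoint_simplices (topspace disjoint_simplices \<inter> {(i, x). \<forall>v. x $ v < 1}))
      (subtopology ?K V) ?\<pi>"
    by (rule quotient_map_restriction[OF q pre]) (use Vo in blast)
  then have q': "quotient_map punctured_simplices (subtopology ?K V) ?\<pi>"
    unfolding punctured_simplices_def by (metis subtopology_restrict)
  obtain g where g: "homeomorphic_maps M (subtopology ?K V) h g"
    using h unfolding V_def[symmetric] homeomorphic_map_maps by blast
  then have gm: "homeomorphic_map (subtopology ?K V) M g"
    using homeomorphic_maps_sym homeomorphic_maps_map by blast
  have quo: "quotient_map punctured_simplices M (g \<circ> ?\<pi>)"
    using q' gm quotient_map_compose unfolding homeomorphic_map_def by blast
  have inj: "inj_on g (topspace (subtopology ?K V))" using gm by (simp add: homeomorphic_map_def)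
  have "(g \<circ> ?\<pi>) y = (g \<circ> ?\<pi>) z \<longleftrightarrow> equivclp (glued T) y z"
    if "y \<in> topspace punctured_simplices" "z \<in> topspace punctured_simplices" for y z
  proof -
    have "?\<pi> y \<in> topspace (subtopology ?K V)" "?\<pi> z \<in> topspace (subtopology ?K V)"
      using quotient_imp_surjective_map[OF q'] that by auto
    then have "g (?\<pi> y) = g (?\<pi> z) \<longleftrightarrow> ?\<pi> y = ?\<pi> z" using inj by (simp add: inj_on_eq_iff)
    then show ?thesis by (simp add: class_of_eq_iff)
  qed
  then show thesis using that quo by blast
qed

section \<open>Pieces of the corners of tetrahedra\<close>

text \<open>
  Close to an ideal vertex a point of a tetrahedron has a barycentric coordinate above 1/2. The other
  three coordinates locate it in the triangle that cuts off this corner. These triangles form the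
  vertex links.
\<close>

definition near_corner :: "real^4 \<Rightarrow> 4" where
  "near_corner x = (THE v. 1 / 2 < x $ v)"

text \<open>
  The vertex of the link triangle to which the point is close, if there is one; it is indexed by the
  other end \<open>w\<close> of the edge of the tetrahedron that it lies on.
\<close>

definition dominant :: "real^4 \<Rightarrow> 4" where
  "dominant x = (THE w. w \<noteq> near_corner x \<and> (1 - x $ near_corner x) / 2 < x $ w)"

text \<open>
  The side of the link triangle to which the point is closest; it lies in the face opposite to \<open>f\<close>.
\<close>

definition lowest :: "real^4 \<Rightarrow> 4" where
  "lowest x = (THE f. \<forall>u. u \<noteq> f \<longrightarrow> x $ f < x $ u)"

lemma near_corner_eq:
  assumes "x \<in> simplex3" "1 / 2 < x $ v"
  shows "near_corner x = v"
  unfolding near_corner_def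
proof (rule the_equality)
  show "u = v" if "1 / 2 < x $ u" for u
    using simplex3_pair[OF assms(1), of u v] assms(2) that by force
qed (rule assms(2))

lemma dominant_eq:
  assumes x: "x \<in> simplex3" and v: "1 / 2 < x $ v" and w: "w \<noteq> v" "(1 - x $ v) / 2 < x $ w"
  shows "dominant x = w"
  unfolding dominant_def near_corner_eq[OF x v]
proof (rule the_equality)
  show "u = w" if "u \<noteq> v \<and> (1 - x $ v) / 2 < x $ u" for u
    using simplex3_triple[OF x, of v w u] w that by force
qed (use w in blast)

lemma lowest_eq:
  assumes "\<forall>u. u \<noteq> f \<longrightarrow> x $ f < x $ u"
  shows "lowest x = f"
  unfolding lowest_def
proof (rule the_equality)
  show "\<forall>u. u \<noteq> f \<longrightarrow> x $ f < x $ u" by (rule assms)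
  show "g = f" if "\<forall>u. u \<noteq> g \<longrightarrow> x $ g < x $ u" for g
    using assms that by force
qed

datatype piece = Vertex_piece | Edge_piece | Cell_piece

text \<open>
  An open cover of the corners by three sets: around the vertices, along the sides and in the
  interiors of the link triangles. On each of them the incident vertex, side or triangle is unique,
  which makes it possible to define functions on the quotient by cases.
\<close>

fun piece_region :: "piece \<Rightarrow> (real^4) set" where
  "piece_region Vertex_piece = {x. \<exists>v w. w \<noteq> v \<and> 1 / 2 < x $ v \<and> (1 - x $ v) / 2 < x $ w}"
| "piece_region Edge_piece = {x. \<exists>v f. 1 / 2 < x $ v \<and> (\<forall>u. u \<noteq> f \<longrightarrow> x $ f < x $ u)}"
| "piece_region Cell_piece = {x. \<exists>v. 1 / 2 < x $ v \<and> (\<forall>u. 0 < x $ u)}"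

text \<open>
  The local sections that represent a cellular cocycle \<open>c\<close>. Crossing the side \<open>f\<close> of a link
  triangle changes the section on vertex pieces from \<open>c (i, v, w)\<close> to the value of \<open>c\<close> in the
  adjacent triangle; \<open>\<epsilon>\<close> distributes this change over the two triangles, so that the differences of
  sections are well defined on the quotient.
\<close>

fun piece_section ::
  "('n \<times> 4 \<times> 4 \<Rightarrow> bit) \<Rightarrow> ('n \<times> 4 \<times> 4 \<Rightarrow> bit) \<Rightarrow> piece \<Rightarrow> 'n \<times> (real^4) \<Rightarrow> bit" where
  "piece_section c \<epsilon> Vertex_piece (i, x) = c (i, near_corner x, dominant x)"
| "piece_section c \<epsilon> Edge_piece (i, x) = \<epsilon> (i, near_corner x, lowest x)"
| "piece_section c \<epsilon> Cell_piece (i, x) = 0"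

definition piece :: "piece \<Rightarrow> ('n \<times> (real^4)) set" where
  "piece k = {(i, x). (i, x) \<in> topspace punctured_simplices \<and> x \<in> piece_region k}"

lemma mem_piece: "(i, x) \<in> piece k \<longleftrightarrow> (i, x) \<in> topspace punctured_simplices \<and> x \<in> piece_region k"
  by (simp add: piece_def)

lemma piece_section_diff:
  "piece_section (\<lambda>y. c y - c' y) (\<lambda>y. \<epsilon> y - \<epsilon>' y) k y = piece_section c \<epsilon> k y - piece_section c' \<epsilon>' k y"
  by (cases y; cases k) simp_all

lemma piece_nbhd:
  assumes y: "y \<in> piece k"
  shows "\<exists>V. openin punctured_simplices V \<and> y \<in> V \<and> V \<subseteq> piece k \<and>
    (\<forall>z\<in>V. piece_section c \<epsilon> k z = piece_section c \<epsilon> k y)"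
proof -
  obtain i x where ix: "y = (i, x)" by (cases y)
  have x: "x \<in> simplex3" "\<forall>v. x $ v < 1" "x \<in> piece_region k" using y ix by (auto simp: piece_def)
  let ?V = "\<lambda>S. {(j, x). (j, x) \<in> topspace punctured_simplices \<and> j \<in> {i} \<and> x \<in> S}"
  have *: ?thesis if S: "open S" "x \<in> S" "S \<subseteq> piece_region k"
    "\<And>x'. x' \<in> S \<Longrightarrow> x' \<in> simplex3 \<Longrightarrow> piece_section c \<epsilon> k (i, x') = piece_section c \<epsilon> k (i, x)" for S
  proof (rule exI[of _ "?V S"], intro conjI ballI)
    show "openin punctured_simplices (?V S)" by (rule openin_punctured_slice[OF S(1)])
    show "y \<in> ?V S" using ix x S(2) by simp
    show "?V S \<subseteq> piece k" using S(3) by (auto simp: piece_def)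
    show "piece_section c \<epsilon> k z = piece_section c \<epsilon> k y" if "z \<in> ?V S" for z
      using that S(4) ix by auto
  qed
  have half: "open {x :: real^4. 1 / 2 < x $ v}" for v by (rule open_halfspace_component_gt_cart)
  show ?thesis
  proof (cases k)
    case Vertex_piece
    then obtain v w where vw: "w \<noteq> v" "1 / 2 < x $ v" "(1 - x $ v) / 2 < x $ w" using x(3) by auto
    have "open {x :: real^4. (1 - x $ v) / 2 < x $ w}"
      by (intro open_Collect_less continuous_intros) simp
    then have "open ({x :: real^4. 1 / 2 < x $ v} \<inter> {x. (1 - x $ v) / 2 < x $ w})"
      using half by (rule open_Int[rotated])
    then show ?thesis
    proof (rule *)
      fix x' assume "x' \<in> {x. 1 / 2 < x $ v} \<inter> {x. (1 - x $ v) / 2 < x $ w}" "x' \<in> simplex3"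
      then show "piece_section c \<epsilon> k (i, x') = piece_section c \<epsilon> k (i, x)"
        using Vertex_piece vw x(1) near_corner_eq[of _ v] dominant_eq[of _ v w] by simp
    qed (use vw Vertex_piece in auto)
  next
    case Edge_piece
    then obtain v f where vf: "1 / 2 < x $ v" "\<forall>u. u \<noteq> f \<longrightarrow> x $ f < x $ u" using x(3) by auto
    let ?S = "{x :: real^4. 1 / 2 < x $ v} \<inter> (\<Inter>u\<in>-{f}. {x. x $ f < x $ u})"
    have "open {x :: real^4. x $ f < x $ u}" for u
      by (intro open_Collect_less continuous_intros)
    then have "open ?S" using half by (intro open_Int open_INT) auto
    then show ?thesis
    proof (rule *)
      fix x' assume x': "x' \<in> ?S" "x' \<in> simplex3"
      then have "\<forall>u. u \<noteq> f \<longrightarrow> x' $ f < x' $ u" "1 / 2 < x' $ v" by auto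
      then show "piece_section c \<epsilon> k (i, x') = piece_section c \<epsilon> k (i, x)"
        using Edge_piece vf x(1) x'(2) near_corner_eq[of _ v] lowest_eq[of f] by simp
    next
      show "?S \<subseteq> piece_region k"
      proof
        fix x' assume "x' \<in> ?S"
        then have "1 / 2 < x' $ v \<and> (\<forall>u. u \<noteq> f \<longrightarrow> x' $ f < x' $ u)" by auto
        then show "x' \<in> piece_region k" using Edge_piece by auto
      qed
    qed (use vf in auto)
  next
    case Cell_piece
    then obtain v where v: "1 / 2 < x $ v" "\<forall>u. 0 < x $ u" using x(3) by auto
    let ?S = "{x :: real^4. 1 / 2 < x $ v} \<inter> (\<Inter>u. {x. 0 < x $ u})"
    have "open ?S" using half by (intro open_Int open_INT ballI finite open_halfspace_component_gt_cart)
    then show ?thesis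
    proof (rule *)
      show "?S \<subseteq> piece_region k"
      proof
        fix x' assume "x' \<in> ?S"
        then have "1 / 2 < x' $ v \<and> (\<forall>u. 0 < x' $ u)" by auto
        then show "x' \<in> piece_region k" using Cell_piece by auto
      qed
    qed (use v Cell_piece in auto)
  qed
qed

lemma openin_piece: "openin punctured_simplices (piece k)"
  by (subst openin_subopen) (meson piece_nbhd)

lemma locally_constant_piece_section:
  "locally_constant_on punctured_simplices (piece k) (piece_section c \<epsilon> k)"
proof (rule locally_constant_onI)
  fix y :: "'a \<times> (real^4)" assume "y \<in> piece k"
  from piece_nbhd[OF this, of c \<epsilon>]
  show "\<exists>V. openin punctured_simplices V \<and> y \<in> V \<and>
      (\<forall>z\<in>V \<inter> piece k. piece_section c \<epsilon> k z = piece_section c \<epsilon> k y)" by blast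
qed

text \<open>
  If a coordinate vanishes, either it is the only one, or the point lies on an edge of the
  tetrahedron and the coordinate at its far end is all of \<open>1 - x $ v\<close>.
\<close>

lemma pieces_cover:
  assumes "(i, x) \<in> topspace punctured_simplices" "1 / 2 < x $ v"
  shows "\<exists>k. (i, x) \<in> piece k"
proof -
  have x: "x \<in> simplex3" "x $ v < 1" using assms(1) by auto
  note nn = simplex3_nonneg[OF x(1)]
  have *: ?thesis if "x \<in> piece_region k" for k
    by (rule exI[of _ k]) (simp only: mem_piece assms(1) that simp_thms)
  show ?thesis
  proof (cases "\<forall>u. 0 < x $ u")
    case True
    then have "x \<in> piece_region Cell_piece" using assms(2) by auto
    then show ?thesis by (rule *)
  next
    case False
    then obtain f where "\<not> 0 < x $ f" by blast
    then have f: "x $ f = 0" using nn[of f] by simp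
    show ?thesis
    proof (cases "\<exists>g. g \<noteq> f \<and> x $ g = 0")
      case False
      then have "\<forall>u. u \<noteq> f \<longrightarrow> x $ f < x $ u" using f nn by (metis less_le)
      then have "x \<in> piece_region Edge_piece" using assms(2) by auto
      then show ?thesis by (rule *)
    next
      case True
      then obtain g where g: "g \<noteq> f" "x $ g = 0" by blast
      have vfg: "v \<noteq> f" "v \<noteq> g" using assms(2) f g by auto
      have "card {v, f, g} = 3" using g(1) vfg by simp
      moreover have "card (UNIV :: 4 set) = 4" by simp
      ultimately have "{v, f, g} \<noteq> UNIV" by force
      then obtain w where w: "w \<noteq> v" "w \<noteq> f" "w \<noteq> g" by blast
      have U: "UNIV = {v, f, g, w}"
        using g(1) vfg w by (intro card_subset_eq[symmetric]) auto
      have "(\<Sum>u\<in>UNIV. x $ u) = x $ v + x $ w"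
        unfolding U using g vfg w f by simp
      then have "x $ w = 1 - x $ v" using simplex3_sum[OF x(1)] by simp
      then have "w \<noteq> v \<and> 1 / 2 < x $ v \<and> (1 - x $ v) / 2 < x $ w" using w(1) assms(2) x(2) by simp
      then have "x \<in> piece_region Vertex_piece" unfolding piece_region.simps by blast
      then show ?thesis by (rule *)
    qed
  qed
qed

lemma glued_piece:
  assumes fp: "face_pairing T" and g: "glued T y z" and y: "y \<in> piece k"
  shows "z \<in> piece k"
proof -
  obtain i x j x' where yz: "y = (i, x)" "z = (j, x')" by (cases y; cases z)
  have x: "x \<in> simplex3" "x' \<in> simplex3" using g yz by (auto simp: glued_def)
  obtain f where f: "bij (glue T i f)" "\<forall>v. x' $ glue T i f v = x $ v" "\<forall>u. \<exists>v. u = glue T i f v"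
    by (rule glued_coordinate[OF fp g[unfolded yz]]) (rule that, assumption+)
  let ?g = "glue T i f"
  have lt: "\<forall>v. x' $ v < 1"
  proof
    fix u obtain v where "u = ?g v" using f(3) by blast
    then show "x' $ u < 1" using f(2) y yz by (simp add: piece_def)
  qed
  have inj: "?g a = ?g b \<longleftrightarrow> a = b" for a b using f(1) by (simp add: bij_def inj_eq)
  have "x' \<in> piece_region k"
  proof (cases k)
    case Vertex_piece
    then obtain v w where "w \<noteq> v" "1 / 2 < x $ v" "(1 - x $ v) / 2 < x $ w"
      using y yz by (auto simp: piece_def)
    then have "?g w \<noteq> ?g v \<and> 1 / 2 < x' $ ?g v \<and> (1 - x' $ ?g v) / 2 < x' $ ?g w"
      using f(2) inj by simp
    then show ?thesis unfolding Vertex_piece by auto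
  next
    case Edge_piece
    then obtain v h where vh: "1 / 2 < x $ v" "\<forall>u. u \<noteq> h \<longrightarrow> x $ h < x $ u"
      using y yz by (auto simp: piece_def)
    have "\<forall>u. u \<noteq> ?g h \<longrightarrow> x' $ ?g h < x' $ u"
    proof (intro allI impI)
      fix u assume "u \<noteq> ?g h"
      moreover obtain u' where "u = ?g u'" using f(3) by blast
      ultimately show "x' $ ?g h < x' $ u" using vh(2) f(2) by auto
    qed
    moreover have "1 / 2 < x' $ ?g v" using vh(1) f(2) by simp
    ultimately show ?thesis unfolding Edge_piece by auto
  next
    case Cell_piece
    then obtain v where v: "1 / 2 < x $ v" "\<forall>u. 0 < x $ u"
      using y yz by (auto simp: piece_def)
    have "0 < x' $ u" for u
    proof -
      obtain u' where "u = ?g u'" using f(3) by blast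
      then show ?thesis using v(2) f(2) by simp
    qed
    moreover have "1 / 2 < x' $ ?g v" using v(1) f(2) by simp
    ultimately show ?thesis unfolding Cell_piece by auto
  qed
  then show ?thesis using x(2) lt yz by (simp add: piece_def)
qed

lemma not_glued_cell: "glued T y z \<Longrightarrow> y \<notin> piece Cell_piece"
proof
  assume g: "glued T y z" and y: "y \<in> piece Cell_piece"
  obtain i x j x' where yz: "y = (i, x)" "z = (j, x')" by (cases y; cases z)
  obtain f where "x $ f = 0" using g yz by (auto simp: glued_def)
  moreover have "0 < x $ f" using y yz by (auto simp: piece_def)
  ultimately show False by simp
qed

text \<open>
  What makes the difference between the sections on vertex pieces and on edge pieces invariant under
  gluing.
\<close>

definition edge_splitting :: "'n gluing \<Rightarrow> ('n \<times> 4 \<times> 4 \<Rightarrow> bit) \<Rightarrow> ('n \<times> 4 \<times> 4 \<Rightarrow> bit) \<Rightarrow> bool" where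
  "edge_splitting T c \<epsilon> \<longleftrightarrow> (\<forall>i v w f. f \<noteq> v \<longrightarrow> w \<noteq> v \<longrightarrow> w \<noteq> f \<longrightarrow>
     \<epsilon> (i, v, f) + \<epsilon> (adj T i f, glue T i f v, glue T i f f)
       = c (i, v, w) + c (adj T i f, glue T i f v, glue T i f w))"

text \<open>
  Near a side of a link triangle only the face through this side is glued, and there \<open>\<epsilon>\<close> compensates
  the change of \<open>c\<close>.
\<close>

lemma glued_section_vertex_edge:
  assumes fp: "face_pairing T" and es: "edge_splitting T c \<epsilon>" and g: "glued T y z"
    and y: "y \<in> piece Vertex_piece" "y \<in> piece Edge_piece"
  shows "piece_section c \<epsilon> Vertex_piece y - piece_section c \<epsilon> Edge_piece y
       = piece_section c \<epsilon> Vertex_piece z - piece_section c \<epsilon> Edge_piece z"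
proof -
  obtain i x j x' where yz: "y = (i, x)" "z = (j, x')" by (cases y; cases z)
  have x: "x \<in> simplex3" "x' \<in> simplex3" using g yz by (auto simp: glued_def)
  obtain f where f: "x $ f = 0" "j = adj T i f" "bij (glue T i f)"
    "\<forall>v. x' $ glue T i f v = x $ v" "\<forall>u. \<exists>v. u = glue T i f v"
    by (rule glued_coordinate[OF fp g[unfolded yz]]) (rule that, assumption+)
  let ?g = "glue T i f"
  have inj: "?g a = ?g b \<longleftrightarrow> a = b" for a b using f(3) by (simp add: bij_def inj_eq)
  obtain v w where vw: "w \<noteq> v" "1 / 2 < x $ v" "(1 - x $ v) / 2 < x $ w"
    using y(1) yz by (auto simp: piece_def)
  obtain h where h: "\<forall>u. u \<noteq> h \<longrightarrow> x $ h < x $ u" using y(2) yz by (auto simp: piece_def)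
  have hf: "h = f"
  proof (rule ccontr)
    assume "h \<noteq> f"
    then have "x $ h < 0" using h f(1) by auto
    then show False using simplex3_nonneg[OF x(1), of h] by simp
  qed
  have "x $ v < 1" using y(1) yz by (simp add: piece_def)
  then have fvw: "f \<noteq> v" "w \<noteq> f" using vw f(1) by auto
  have low': "\<forall>u. u \<noteq> ?g f \<longrightarrow> x' $ ?g f < x' $ u"
  proof (intro allI impI)
    fix u assume "u \<noteq> ?g f"
    moreover obtain u' where "u = ?g u'" using f(5) by blast
    ultimately show "x' $ ?g f < x' $ u" using h f(4) hf by auto
  qed
  have "near_corner x = v" "dominant x = w" "lowest x = f"
    using near_corner_eq[OF x(1) vw(2)] dominant_eq[OF x(1) vw(2,1,3)] lowest_eq[OF h] hf by auto
  moreover have "near_corner x' = ?g v" using near_corner_eq[OF x(2), of "?g v"] vw(2) f(4) by simp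
  moreover have "dominant x' = ?g w"
    using dominant_eq[OF x(2), of "?g v" "?g w"] vw f(4) inj by simp
  moreover have "lowest x' = ?g f" by (rule lowest_eq[OF low'])
  moreover have "\<epsilon> (i, v, f) + \<epsilon> (j, ?g v, ?g f) = c (i, v, w) + c (j, ?g v, ?g w)"
    using es fvw vw(1) f(2) unfolding edge_splitting_def by simp
  then have "c (i, v, w) - \<epsilon> (i, v, f) = c (j, ?g v, ?g w) - \<epsilon> (j, ?g v, ?g f)"
    by (cases "c (i, v, w)"; cases "\<epsilon> (i, v, f)"; cases "c (j, ?g v, ?g w)"; cases "\<epsilon> (j, ?g v, ?g f)") simp_all
  ultimately show ?thesis unfolding yz by simp
qed

lemma glued_section_diff:
  assumes fp: "face_pairing T" and es: "edge_splitting T c \<epsilon>" and g: "glued T y z"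
    and y: "y \<in> piece k" "y \<in> piece l"
  shows "piece_section c \<epsilon> k y - piece_section c \<epsilon> l y = piece_section c \<epsilon> k z - piece_section c \<epsilon> l z"
proof -
  have "k \<noteq> Cell_piece" "l \<noteq> Cell_piece" using not_glued_cell[OF g] y by auto
  moreover note ve = glued_section_vertex_edge[OF fp es g]
  have ev: "piece_section c \<epsilon> Edge_piece y - piece_section c \<epsilon> Vertex_piece y
       = piece_section c \<epsilon> Edge_piece z - piece_section c \<epsilon> Vertex_piece z"
    if "y \<in> piece Vertex_piece" "y \<in> piece Edge_piece"
    using arg_cong[OF ve[OF that], of uminus] by (simp only: minus_diff_eq)
  ultimately show ?thesis using y ve ev by (cases k; cases l) (simp_all del: piece_section.simps minus_bit_def)
qed

section \<open>The ends of an ideally triangulated manifold\<close>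

definition corner_region :: "real \<Rightarrow> 4 \<Rightarrow> (real^4) set" where
  "corner_region s v = simplex3 \<inter> {x. 1 - s < x $ v} \<inter> {x. x $ v < 1}"

lemma corner_region_punctured:
  assumes "x \<in> corner_region s v" "s \<le> 1 / 2"
  shows "(i, x) \<in> topspace punctured_simplices" "1 / 2 < x $ v"
proof -
  have x: "x \<in> simplex3" "1 - s < x $ v" "x $ v < 1" using assms(1) by (auto simp: corner_region_def)
  show h: "1 / 2 < x $ v" using x(2) assms(2) by simp
  have "x $ u < 1" for u
    using simplex3_pair[OF x(1), of u v] h x(3) by (cases "u = v") auto
  then show "(i, x) \<in> topspace punctured_simplices" using x(1) by simp
qed

lemma convex_component_gt: "convex {x :: real^4. a < x $ v}"
  using convex_halfspace_gt[of a "axis v 1 :: real^4"] by (simp add: inner_axis' )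

lemma convex_component_lt: "convex {x :: real^4. x $ v < a}"
  using convex_halfspace_lt[of "axis v 1 :: real^4" a] by (simp add: inner_axis')

lemma convex_corner_region: "convex (corner_region s v)"
  unfolding corner_region_def
  by (intro convex_Int convex_simplex3 convex_component_gt convex_component_lt)

lemma convex_dominant_region: "convex {x :: real^4. (1 - x $ v) / 2 < x $ w}"
proof -
  have "{x :: real^4. (1 - x $ v) / 2 < x $ w} = {x. 1 < (axis v 1 + 2 *\<^sub>R axis w 1) \<bullet> x}"
    by (auto simp: inner_add_left inner_axis')
  then show ?thesis using convex_halfspace_gt by metis
qed

lemma convex_positive: "convex {x :: real^4. \<forall>u. 0 < x $ u}"
proof -
  have "{x :: real^4. \<forall>u. 0 < x $ u} = (\<Inter>u. {x. 0 < x $ u})" by auto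
  then show ?thesis using convex_component_gt by (simp add: convex_INT)
qed

text \<open>
  A point near the corner \<open>v\<close> on the edge towards \<open>w\<close>. It lies in both faces at this edge, so that
  it can be used to compare values across faces.
\<close>

definition edge_point :: "real \<Rightarrow> 4 \<Rightarrow> 4 \<Rightarrow> real^4" where
  "edge_point s v w = (1 - s / 2) *\<^sub>R axis v 1 + (s / 2) *\<^sub>R axis w 1"

text \<open>
  A point in the interior of the tetrahedron near the corner \<open>v\<close> that has \<open>w\<close> as dominant coordinate:
  the coordinates are \<open>1 - s / 2\<close> at \<open>v\<close>, \<open>3 s / 10\<close> at \<open>w\<close> and \<open>s / 10\<close> at the other two vertices.
\<close>

definition inner_point :: "real \<Rightarrow> 4 \<Rightarrow> 4 \<Rightarrow> real^4" where
  "inner_point s v w = (1 - 6 * s / 10) *\<^sub>R axis v 1 + (2 * s / 10) *\<^sub>R axis w 1 + (\<chi> u. s / 10)"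

lemma sum_axis4: "(\<Sum>u\<in>UNIV. axis v (1::real) $ (u::4)) = 1"
  by (simp add: axis_def)

lemma edge_point:
  assumes "0 < s" "s \<le> 1 / 2" "v \<noteq> w"
  shows "edge_point s v w \<in> corner_region s v"
    "(1 - edge_point s v w $ v) / 2 < edge_point s v w $ w"
    "u \<noteq> v \<Longrightarrow> u \<noteq> w \<Longrightarrow> edge_point s v w $ u = 0"
proof -
  let ?x = "edge_point s v w"
  have c: "?x $ u = (1 - s / 2) * axis v 1 $ u + (s / 2) * axis w 1 $ u" for u
    by (simp add: edge_point_def)
  have v: "?x $ v = 1 - s / 2" and w: "?x $ w = s / 2"
    unfolding c using assms(3) by (simp_all add: axis_def)
  show 0: "?x $ u = 0" if "u \<noteq> v" "u \<noteq> w" for u unfolding c using that by (simp add: axis_def)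
  have "(\<Sum>u\<in>UNIV. ?x $ u) = (1 - s / 2) * (\<Sum>u\<in>UNIV. axis v 1 $ u) + (s / 2) * (\<Sum>u\<in>UNIV. axis w 1 $ u)"
    unfolding c by (simp only: sum.distrib sum_distrib_left)
  then have "(\<Sum>u\<in>UNIV. ?x $ u) = 1" by (simp add: sum_axis4)
  moreover have "0 \<le> ?x $ u" for u
    using 0[of u] v w assms by (cases "u = v"; cases "u = w") auto
  ultimately have "?x \<in> simplex3" by (simp add: simplex3_def)
  then show "?x \<in> corner_region s v" using v assms by (simp add: corner_region_def)
  show "(1 - ?x $ v) / 2 < ?x $ w" using v w assms by simp
qed

lemma inner_point:
  assumes "0 < s" "s \<le> 1 / 2" "v \<noteq> w"
  shows "inner_point s v w \<in> corner_region s v"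
    "(1 - inner_point s v w $ v) / 2 < inner_point s v w $ w"
    "\<forall>u. 0 < inner_point s v w $ u"
proof -
  let ?x = "inner_point s v w"
  have c: "?x $ u = (1 - 6 * s / 10) * axis v 1 $ u + (2 * s / 10) * axis w 1 $ u + s / 10" for u
    by (simp add: inner_point_def)
  have v: "?x $ v = 1 - s / 2" and w: "?x $ w = 3 * s / 10"
    unfolding c using assms(3) by (simp_all add: axis_def)
  have 0: "?x $ u = s / 10" if "u \<noteq> v" "u \<noteq> w" for u unfolding c using that by (simp add: axis_def)
  have "(\<Sum>u\<in>UNIV. ?x $ u) = (1 - 6 * s / 10) * (\<Sum>u\<in>UNIV. axis v 1 $ u)
      + (2 * s / 10) * (\<Sum>u\<in>UNIV. axis w 1 $ u) + (\<Sum>u\<in>(UNIV :: 4 set). s / 10)"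
    unfolding c by (simp only: sum.distrib sum_distrib_left)
  then have "(\<Sum>u\<in>UNIV. ?x $ u) = 1" by (simp add: sum_axis4)
  moreover show pos: "\<forall>u. 0 < ?x $ u"
  proof
    fix u show "0 < ?x $ u"
      using 0[of u] v w assms by (cases "u = v"; cases "u = w") auto
  qed
  ultimately have "?x \<in> simplex3" by (simp add: simplex3_def less_imp_le)
  then show "?x \<in> corner_region s v" using v assms by (simp add: corner_region_def)
  show "(1 - ?x $ v) / 2 < ?x $ w" using v w assms by simp
qed

lemma obtain_other:
  obtains w :: 4 where "w \<noteq> v" "w \<noteq> f"
proof -
  have "card {v, f} < card (UNIV :: 4 set)" using card_insert_le_m1[of 2 "{f}" v] by simp
  then have "{v, f} \<noteq> UNIV" by force
  then show thesis using that by blast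
qed

text \<open>
  An ideal triangulation of the complement \<open>M\<close> of the boundary of a compact space \<open>N\<close>, given by
  the quotient map \<open>\<kappa>\<close> from the punctured simplices.
\<close>

locale ideal_end =
  fixes T :: "'n::finite gluing" and N :: "'a topology" and M :: "'a set"
    and \<kappa> :: "'n \<times> (real^4) \<Rightarrow> 'a"
  assumes fp: "face_pairing T"
    and compact: "compact_space N" and Hausdorff: "Hausdorff_space N"
    and boxed: "half_boxed N (topspace N - M)"
    and M_open: "openin N M"
    and quo: "quotient_map punctured_simplices (subtopology N M) \<kappa>"
    and fibre: "\<And>y z. y \<in> topspace punctured_simplices \<Longrightarrow> z \<in> topspace punctured_simplices \<Longrightarrow>
       \<kappa> y = \<kappa> z \<longleftrightarrow> equivclp (glued T) y z"
begin

lemma M_sub: "M \<subseteq> topspace N" by (rule openin_subset[OF M_open])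

lemma topspace_M: "topspace (subtopology N M) = M" using M_sub by auto

lemma continuous: "continuous_map punctured_simplices N \<kappa>"
  using quotient_imp_continuous_map[OF quo] by (simp add: continuous_map_in_subtopology)

lemma kappa_image: "\<kappa> ` topspace punctured_simplices = M"
  using quotient_imp_surjective_map[OF quo] topspace_M by simp

lemma point_of_M:
  assumes "m \<in> M"
  obtains i x where "(i, x) \<in> topspace punctured_simplices" "m = \<kappa> (i, x)"
proof -
  obtain y where "y \<in> topspace punctured_simplices" "m = \<kappa> y"
    using assms unfolding kappa_image[symmetric] by (rule imageE) (rule that, assumption+)
  then show thesis using that by (cases y) simp
qed

lemma kappa_in_M: "y \<in> topspace punctured_simplices \<Longrightarrow> \<kappa> y \<in> M"
  using kappa_image by blast

lemma open_image:
  assumes S: "openin punctured_simplices S"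
    and sat: "\<And>y z. y \<in> S \<Longrightarrow> z \<in> topspace punctured_simplices \<Longrightarrow> \<kappa> y = \<kappa> z \<Longrightarrow> z \<in> S"
  shows "openin N (\<kappa> ` S)"
proof -
  have sub: "S \<subseteq> topspace punctured_simplices" by (rule openin_subset[OF S])
  have eq: "{y \<in> topspace punctured_simplices. \<kappa> y \<in> \<kappa> ` S} = S"
  proof
    show "{y \<in> topspace punctured_simplices. \<kappa> y \<in> \<kappa> ` S} \<subseteq> S" using sat by auto
  qed (use sub in auto)
  have "\<kappa> ` S \<subseteq> topspace (subtopology N M)" using sub kappa_image topspace_M by blast
  then have "openin punctured_simplices {y \<in> topspace punctured_simplices. \<kappa> y \<in> \<kappa> ` S}
      = openin (subtopology N M) (\<kappa> ` S)"
    using quo by (simp only: quotient_map_def)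
  then have "openin (subtopology N M) (\<kappa> ` S)" using S unfolding eq by blast
  then show ?thesis using M_open by (rule openin_trans_full)
qed

lemma saturated:
  assumes "y \<in> topspace punctured_simplices" "z \<in> topspace punctured_simplices" "\<kappa> y = \<kappa> z"
    and "P y" and "\<And>y z. glued T y z \<Longrightarrow> P y \<Longrightarrow> P z"
  shows "P z"
  by (rule equivclp_glued_invariant[OF fp, of y z P]) (use assms fibre in auto)

lemma piece_punctured: "y \<in> piece k \<Longrightarrow> y \<in> topspace punctured_simplices"
  using openin_subset[OF openin_piece] by blast

definition U :: "piece \<Rightarrow> 'a set" where "U k = \<kappa> ` piece k"

lemma kappa_in_U: "y \<in> topspace punctured_simplices \<Longrightarrow> \<kappa> y \<in> U k \<longleftrightarrow> y \<in> piece k"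
proof
  assume y: "y \<in> topspace punctured_simplices" and "\<kappa> y \<in> U k"
  then obtain z where z: "z \<in> piece k" "\<kappa> z = \<kappa> y" by (auto simp: U_def)
  show "y \<in> piece k"
    by (rule saturated[OF piece_punctured[OF z(1)] y z(2), of "\<lambda>y. y \<in> piece k"])
      (use z(1) glued_piece[OF fp] in auto)
qed (simp add: U_def)

lemma U_open: "openin N (U k)"
  unfolding U_def
proof (rule open_image[OF openin_piece])
  fix y z :: "'n \<times> (real^4)"
  assume "y \<in> piece k" "z \<in> topspace punctured_simplices" "\<kappa> y = \<kappa> z"
  then show "z \<in> piece k" using kappa_in_U[of z k] by (metis U_def imageI)
qed

definition rep :: "'a \<Rightarrow> 'n \<times> (real^4)" where
  "rep m = (SOME y. y \<in> topspace punctured_simplices \<and> \<kappa> y = m)"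

lemma rep: "y \<in> topspace punctured_simplices \<Longrightarrow>
    rep (\<kappa> y) \<in> topspace punctured_simplices \<and> \<kappa> (rep (\<kappa> y)) = \<kappa> y"
  unfolding rep_def by (rule someI[of _ y]) simp

text \<open>
  Sections are evaluated at an arbitrary preimage. Only their differences are independent of the
  choice.
\<close>

definition F :: "('n \<times> 4 \<times> 4 \<Rightarrow> bit) \<Rightarrow> ('n \<times> 4 \<times> 4 \<Rightarrow> bit) \<Rightarrow> piece \<Rightarrow> 'a \<Rightarrow> bit" where
  "F c \<epsilon> k m = piece_section c \<epsilon> k (rep m)"

lemma F_diff: "F (\<lambda>y. c y - c' y) (\<lambda>y. \<epsilon> y - \<epsilon>' y) k m = F c \<epsilon> k m - F c' \<epsilon>' k m"
  unfolding F_def by (rule piece_section_diff)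

lemma F_difference_kappa:
  assumes es: "edge_splitting T c \<epsilon>" and y: "y \<in> piece k" "y \<in> piece l"
  shows "F c \<epsilon> k (\<kappa> y) - F c \<epsilon> l (\<kappa> y) = piece_section c \<epsilon> k y - piece_section c \<epsilon> l y"
proof -
  have yP: "y \<in> topspace punctured_simplices" by (rule piece_punctured[OF y(1)])
  let ?P = "\<lambda>z. z \<in> piece k \<and> z \<in> piece l \<and>
    piece_section c \<epsilon> k z - piece_section c \<epsilon> l z = piece_section c \<epsilon> k y - piece_section c \<epsilon> l y"
  have "?P (rep (\<kappa> y))"
  proof (rule saturated[of y "rep (\<kappa> y)" ?P])
    fix a b assume g: "glued T a b" and P: "?P a"
    show "?P b" using glued_piece[OF fp g] glued_section_diff[OF fp es g] P by metis
  qed (use rep[OF yP] yP y in auto)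
  then show ?thesis by (simp only: F_def)
qed

text \<open>
  The differences of the sections are compatible with the gluing and locally constant upstairs.
\<close>

lemma end_cocycle:
  assumes es: "edge_splitting T c \<epsilon>"
  shows "cocycle N U (F c \<epsilon>)"
  unfolding cocycle_def
proof (intro conjI allI U_open)
  fix k l
  have UM: "U k \<inter> U l \<subseteq> M" using piece_punctured kappa_in_M unfolding U_def by blast
  have "locally_constant_on (subtopology N M) (U k \<inter> U l) (\<lambda>m. F c \<epsilon> k m - F c \<epsilon> l m)"
  proof (rule locally_constant_on_quotient[OF quo])
    have "U k \<inter> U l = (U k \<inter> U l) \<inter> M" using UM by blast
    then show "openin (subtopology N M) (U k \<inter> U l)"
      using U_open by (metis openin_Int openin_subtopology)
    have eq: "{y \<in> topspace punctured_simplices. \<kappa> y \<in> U k \<inter> U l} = piece k \<inter> piece l"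
      using kappa_in_U piece_punctured by blast
    have L: "locally_constant_on punctured_simplices (piece k \<inter> piece l)
        (\<lambda>y. piece_section c \<epsilon> k y - piece_section c \<epsilon> l y)"
      by (rule locally_constant_on_combine[of _ _ _ _ "(-)"];
          rule locally_constant_on_subset[OF locally_constant_piece_section]) auto
    show "locally_constant_on punctured_simplices {y \<in> topspace punctured_simplices. \<kappa> y \<in> U k \<inter> U l}
        (\<lambda>y. F c \<epsilon> k (\<kappa> y) - F c \<epsilon> l (\<kappa> y))"
      unfolding eq
      by (rule locally_constant_on_cong[THEN iffD1, OF _ L])
        (rule F_difference_kappa[OF es, symmetric]; blast)
  qed
  then show "locally_constant_on N (U k \<inter> U l) (\<lambda>m. F c \<epsilon> k m - F c \<epsilon> l m)"
    using locally_constant_on_subtopology[OF UM] by blast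
qed

text \<open>
  The tetrahedra with their corners cut off. As \<open>s\<close> tends to 0, these compact sets exhaust \<open>M\<close>.
\<close>

definition core :: "real \<Rightarrow> ('n \<times> (real^4)) set" where
  "core s = {(i, x). x \<in> simplex3 \<and> (\<forall>v. x $ v \<le> 1 - s)}"

lemma core_punctured: "0 < s \<Longrightarrow> core s \<subseteq> topspace punctured_simplices"
proof
  fix y assume s: "0 < s" and y: "y \<in> core s"
  obtain i x where ix: "y = (i, x)" by (cases y)
  have "x $ v < 1" for v
  proof -
    have "x $ v \<le> 1 - s" using y ix by (simp add: core_def)
    then show ?thesis using s by linarith
  qed
  then show "y \<in> topspace punctured_simplices" using y ix by (simp add: core_def)
qed

lemma compactin_core:
  assumes "0 < s"
  shows "compactin N (\<kappa> ` core s)"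
proof -
  let ?S = "simplex3 \<inter> {x :: real^4. \<forall>v. x $ v \<le> 1 - s}"
  have eq: "simplex3 = (\<Inter>v. {x :: real^4. 0 \<le> x $ v}) \<inter> {x. (\<Sum>v\<in>UNIV. x $ v) = 1}"
    by (auto simp: simplex3_def)
  have cl: "closed (simplex3 :: (real^4) set)" unfolding eq
    by (intro closed_Int closed_INT ballI closed_Collect_le closed_Collect_eq continuous_intros)
  have "bounded (simplex3 :: (real^4) set)"
  proof (rule boundedI)
    fix x :: "real^4" assume x: "x \<in> simplex3"
    have "norm x \<le> (\<Sum>i\<in>UNIV. \<bar>x $ i\<bar>)" by (rule norm_le_l1_cart)
    also have "\<dots> = (\<Sum>i\<in>UNIV. x $ i)" using simplex3_nonneg[OF x] by simp
    finally show "norm x \<le> 1" using simplex3_sum[OF x] by simp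
  qed
  then have "compact (simplex3 :: (real^4) set)" using cl by (simp add: compact_eq_bounded_closed)
  moreover have "closed {x :: real^4. \<forall>v. x $ v \<le> 1 - s}"
    by (intro closed_Collect_all closed_Collect_le continuous_intros)
  ultimately have "compact ?S" by (rule compact_Int_closed)
  then have "compactin (top_of_set simplex3) ?S" by (simp add: compactin_subtopology)
  moreover have "compactin (discrete_topology UNIV) (UNIV :: 'n set)" by (simp add: compactin_discrete_topology)
  ultimately have "compactin disjoint_simplices ((UNIV :: 'n set) \<times> ?S)"
    unfolding disjoint_simplices_def by (simp add: compactin_Times)
  moreover have "(UNIV :: 'n set) \<times> ?S = core s" by (auto simp: core_def)
  ultimately have "compactin disjoint_simplices (core s)" by simp
  moreover have "core s \<subseteq> {(i, x). \<forall>v. x $ v < 1}" using core_punctured[OF assms] by (auto simp: topspace_punctured_simplices)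
  ultimately have "compactin punctured_simplices (core s)"
    unfolding punctured_simplices_def by (simp add: compactin_subtopology)
  then show ?thesis using continuous by (rule image_compactin)
qed

definition end_region :: "'a set" where
  "end_region = topspace N - \<kappa> ` core (1 / 2)"

lemma end_region:
  shows "openin N end_region" "topspace N - M \<subseteq> end_region"
    "end_region - (topspace N - M) \<subseteq> (\<Union>k. U k)"
proof -
  have "closedin N (\<kappa> ` core (1 / 2))"
    using compactin_imp_closedin[OF Hausdorff compactin_core[of "1 / 2"]] by simp
  then show "openin N end_region" unfolding end_region_def by blast
  show "topspace N - M \<subseteq> end_region"
    using core_punctured[of "1 / 2"] kappa_in_M unfolding end_region_def by force
  show "end_region - (topspace N - M) \<subseteq> (\<Union>k. U k)"
  proof
    fix m assume "m \<in> end_region - (topspace N - M)"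
    then have m: "m \<in> M" "m \<notin> \<kappa> ` core (1 / 2)" by (auto simp: end_region_def)
    obtain i x where ix: "(i, x) \<in> topspace punctured_simplices" "m = \<kappa> (i, x)"
      by (rule point_of_M[OF m(1)]) (rule that, assumption+)
    then have "(i, x) \<notin> core (1 / 2)" using m(2) by blast
    then obtain v where "1 / 2 < x $ v" using ix(1) by (auto simp: core_def not_le)
    then obtain k where "(i, x) \<in> piece k" using pieces_cover[OF ix(1)] by blast
    then show "m \<in> (\<Union>k. U k)" using ix(2) by (auto simp: U_def)
  qed
qed

text \<open>
  The part of \<open>N\<close> outside \<open>W\<close> is compact and contained in \<open>M\<close>, hence contained in a set
  \<open>G n\<close> of points whose coordinates stay away from 1.
\<close>

lemma corners_reach_end:
  assumes W: "openin N W" "topspace N - M \<subseteq> W"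
  obtains s where "0 < s" "s \<le> 1 / 2"
    "\<forall>i v x. x \<in> corner_region s v \<longrightarrow> \<kappa> (i, x) \<in> W - (topspace N - M)"
proof -
  define G where "G n = \<kappa> ` {(j, x). (j, x) \<in> topspace punctured_simplices \<and> j \<in> (UNIV :: 'n set) \<and>
      x \<in> (\<Inter>v. {x. x $ v < 1 - 1 / (real n + 2)})}" for n :: nat
  have Gmem: "\<forall>v. x $ v < 1 - 1 / (real n + 2)" if y: "(i, x) \<in> topspace punctured_simplices" "\<kappa> (i, x) \<in> G n" for i x n
  proof -
    obtain j x' where jx: "(j, x') \<in> topspace punctured_simplices" "\<kappa> (j, x') = \<kappa> (i, x)"
      "\<forall>v. x' $ v < 1 - 1 / (real n + 2)"
      using y(2) by (auto simp: G_def)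
    have "\<forall>v. snd (i, x) $ v < 1 - 1 / (real n + 2)"
    proof (rule saturated[OF jx(1) y(1) jx(2)])
      show "\<forall>v. snd (j, x') $ v < 1 - 1 / (real n + 2)" using jx(3) by simp
      fix a b :: "'n \<times> (real^4)" assume g: "glued T a b" and a: "\<forall>v. snd a $ v < 1 - 1 / (real n + 2)"
      obtain i x j y where ab: "a = (i, x)" "b = (j, y)" by (cases a; cases b)
      obtain f where f: "\<forall>v. y $ glue T i f v = x $ v" "\<forall>u. \<exists>v. u = glue T i f v"
        by (rule glued_coordinate[OF fp g[unfolded ab]]) (rule that, assumption+)
      show "\<forall>v. snd b $ v < 1 - 1 / (real n + 2)"
      proof
        fix u obtain v where "u = glue T i f v" using f(2) by blast
        then show "snd b $ u < 1 - 1 / (real n + 2)" using f(1) a ab by simp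
      qed
    qed
    then show ?thesis by simp
  qed
  have Go: "openin N (G n)" for n
    unfolding G_def
  proof (rule open_image)
    show "openin punctured_simplices {(j, x). (j, x) \<in> topspace punctured_simplices \<and> j \<in> (UNIV :: 'n set) \<and>
      x \<in> (\<Inter>v. {x. x $ v < 1 - 1 / (real n + 2)})}"
      by (rule openin_punctured_slice) (intro open_INT ballI finite open_halfspace_component_lt_cart)
    fix y z assume y: "y \<in> {(j, x). (j, x) \<in> topspace punctured_simplices \<and> j \<in> (UNIV :: 'n set) \<and>
      x \<in> (\<Inter>v. {x. x $ v < 1 - 1 / (real n + 2)})}" and z: "z \<in> topspace punctured_simplices"
      and eq: "\<kappa> y = \<kappa> z"
    obtain i x where ix: "z = (i, x)" by (cases z)
    have "\<kappa> y \<in> G n" unfolding G_def by (rule imageI[OF y])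
    then have zG: "\<kappa> (i, x) \<in> G n" using eq ix by simp
    then show "z \<in> {(j, x). (j, x) \<in> topspace punctured_simplices \<and> j \<in> (UNIV :: 'n set) \<and>
      x \<in> (\<Inter>v. {x. x $ v < 1 - 1 / (real n + 2)})}"
      using Gmem[OF z[unfolded ix] zG] z ix by simp
  qed
  have Gcov: "M \<subseteq> \<Union>(range G)"
  proof
    fix m assume "m \<in> M"
    then obtain i x where ix: "(i, x) \<in> topspace punctured_simplices" "m = \<kappa> (i, x)"
      by (rule point_of_M) (rule that, assumption+)
    have "\<forall>v. \<exists>n :: nat. x $ v < 1 - 1 / (real n + 2)"
    proof
      fix v
      have "0 < 1 - x $ v" using ix(1) by simp
      then obtain n :: nat where "n \<noteq> 0" "inverse (real n) < 1 - x $ v" using real_arch_inverse by blast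
      moreover have "1 / (real n + 2) \<le> inverse (real n)"
        using \<open>n \<noteq> 0\<close> by (simp add: field_simps)
      ultimately have "x $ v < 1 - 1 / (real n + 2)" by linarith
      then show "\<exists>n :: nat. x $ v < 1 - 1 / (real n + 2)" by blast
    qed
    from choice[OF this] obtain n :: "4 \<Rightarrow> nat" where n: "\<And>v. x $ v < 1 - 1 / (real (n v) + 2)" by blast
    define m' where "m' = Max (range n)"
    have "x $ v < 1 - 1 / (real m' + 2)" for v
    proof -
      have "n v \<le> m'" unfolding m'_def by simp
      then have "1 / (real m' + 2) \<le> 1 / (real (n v) + 2)" by (simp add: field_simps)
      then show ?thesis using n[of v] by linarith
    qed
    then have "m \<in> G m'" unfolding G_def using ix by blast
    then show "m \<in> \<Union>(range G)" by blast
  qed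
  have "closedin N (topspace N - W)" using W(1) by blast
  then have "compactin N (topspace N - W)" by (rule closedin_compact_space[OF compact])
  moreover have "topspace N - W \<subseteq> \<Union>(range G)" using W(2) Gcov by blast
  moreover have "\<forall>V\<in>range G. openin N V" using Go by blast
  ultimately have "\<exists>\<F>. finite \<F> \<and> \<F> \<subseteq> range G \<and> topspace N - W \<subseteq> \<Union>\<F>"
    by (simp add: compactin_def)
  then obtain \<F> where \<F>: "finite \<F>" "\<F> \<subseteq> range G" "topspace N - W \<subseteq> \<Union>\<F>" by blast
  obtain J where J: "finite J" "\<F> = G ` J" using finite_subset_image[OF \<F>(1,2)] by blast
  define n where "n = Max (insert 0 J)"
  define s where "s = 1 / (real n + 2)"
  show thesis
  proof (rule that[of s])
    show "0 < s" "s \<le> 1 / 2" by (simp_all add: s_def)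
    show "\<forall>i v x. x \<in> corner_region s v \<longrightarrow> \<kappa> (i, x) \<in> W - (topspace N - M)"
    proof (intro allI impI)
      fix i :: 'n and v x assume x: "x \<in> corner_region s v"
      have xP: "(i, x) \<in> topspace punctured_simplices"
        using corner_region_punctured(1)[OF x \<open>s \<le> 1 / 2\<close>] .
      have xv: "1 - s < x $ v" using x by (simp add: corner_region_def)
      have "\<kappa> (i, x) \<in> W"
      proof (rule ccontr)
        assume "\<kappa> (i, x) \<notin> W"
        then have "\<kappa> (i, x) \<in> topspace N - W" using kappa_in_M[OF xP] M_sub by blast
        then obtain k where k: "k \<in> J" "\<kappa> (i, x) \<in> G k" using \<F>(3) J(2) by blast
        then have "x $ v < 1 - 1 / (real k + 2)" using Gmem[OF xP] by blast
        moreover have "k \<le> n" using k(1) J(1) unfolding n_def by simp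
        then have "s \<le> 1 / (real k + 2)" by (simp add: s_def field_simps)
        ultimately show False using xv by linarith
      qed
      then show "\<kappa> (i, x) \<in> W - (topspace N - M)" using kappa_in_M[OF xP] by blast
    qed
  qed
qed

lemma glue_edge_point:
  assumes s: "0 < s" "s \<le> 1 / 2" and vw: "v \<noteq> w" "f \<noteq> v" "f \<noteq> w"
  shows "\<kappa> (i, edge_point s v w) = \<kappa> (adj T i f, edge_point s (glue T i f v) (glue T i f w))"
proof -
  let ?g = "glue T i f"
  have bij: "bij ?g" using fp unfolding face_pairing_def by blast
  then have inj: "?g a = ?g b \<longleftrightarrow> a = b" for a b by (simp add: bij_def inj_eq)
  have gvw: "?g v \<noteq> ?g w" using inj vw(1) by simp
  note p = edge_point[OF s vw(1)] and q = edge_point[OF s gvw]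
  have c: "edge_point s (?g v) (?g w) $ ?g u = edge_point s v w $ u" for u
    by (simp add: edge_point_def axis_def inj)
  have "glued T (i, edge_point s v w) (adj T i f, edge_point s (?g v) (?g w))"
    using p(1) q(1) p(3)[OF vw(2,3)] c unfolding glued_def corner_region_def by auto
  then have "equivclp (glued T) (i, edge_point s v w) (adj T i f, edge_point s (?g v) (?g w))"
    by (rule r_into_equivclp)
  then show ?thesis
    using fibre[OF corner_region_punctured(1)[OF p(1) s(2)] corner_region_punctured(1)[OF q(1) s(2)]] by blast
qed

lemma connectedin_slice:
  assumes "convex S" "S \<subseteq> corner_region s v" "s \<le> 1 / 2"
  shows "connectedin N (\<kappa> ` ({i} \<times> S))"
proof (rule connectedin_continuous_map_image[OF continuous connectedin_punctured_slice[OF assms(1)]])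
  show "S \<subseteq> {x. x \<in> simplex3 \<and> (\<forall>v. x $ v < 1)}"
    using corner_region_punctured(1)[OF _ assms(3)] assms(2) by fastforce
qed

text \<open>
  The corners are connected, and corners glued along a face share points.
\<close>

lemma locally_constant_near_corners:
  assumes W: "openin N W" "topspace N - M \<subseteq> W"
    and G: "locally_constant_on N (W - (topspace N - M)) G"
  obtains s a where "0 < s" "s \<le> 1 / 2"
    "\<forall>i v x. x \<in> corner_region s v \<longrightarrow> G (\<kappa> (i, x)) = a (i, v)"
    "\<forall>i v f. f \<noteq> v \<longrightarrow> a (adj T i f, glue T i f v) = a (i, v)"
proof -
  obtain s where s: "0 < s" "s \<le> 1 / 2"
    "\<forall>i v x. x \<in> corner_region s v \<longrightarrow> \<kappa> (i, x) \<in> W - (topspace N - M)"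
    by (rule corners_reach_end[OF W]) (rule that, assumption+)
  define a where "a = (\<lambda>(i, v). G (\<kappa> (i, edge_point s v (v + 1))))"
  have a: "G (\<kappa> (i, x)) = a (i, v)" if x: "x \<in> corner_region s v" for i v x
  proof -
    have "v \<noteq> v + 1" by simp
    then have e: "edge_point s v (v + 1) \<in> corner_region s v" using edge_point(1)[OF s(1,2)] by blast
    show ?thesis unfolding a_def case_prod_conv
      by (rule locally_constant_on_connectedin[OF G connectedin_slice[OF convex_corner_region order_refl s(2), of i v]])
        (use x e s(3) in auto)
  qed
  have "a (adj T i f, glue T i f v) = a (i, v)" if fv: "f \<noteq> v" for i v f
  proof -
    obtain w where w: "w \<noteq> v" "w \<noteq> f" by (rule obtain_other) (rule that, assumption+)
    have bij: "bij (glue T i f)" using fp unfolding face_pairing_def by blast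
    then have gvw: "glue T i f v \<noteq> glue T i f w" using w(1) by (simp add: bij_def inj_eq)
    have "a (i, v) = G (\<kappa> (i, edge_point s v w))"
      using a[OF edge_point(1)[OF s(1,2)]] w(1) by metis
    also have "\<dots> = G (\<kappa> (adj T i f, edge_point s (glue T i f v) (glue T i f w)))"
      using glue_edge_point[OF s(1,2), of v w f i] w fv by metis
    also have "\<dots> = a (adj T i f, glue T i f v)" by (rule a[OF edge_point(1)[OF s(1,2) gvw]])
    finally show ?thesis by simp
  qed
  then have glue: "\<forall>i v f. f \<noteq> v \<longrightarrow> a (adj T i f, glue T i f v) = a (i, v)" by blast
  show thesis
    by (rule that[of s a, OF s(1,2) _ glue]) (intro allI impI, rule a)
qed

text \<open>
  Let \<open>h\<close> trivialize the cocycle. It is constant, say \<open>a (i, v)\<close>, on the interior of each corner,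
  where the section vanishes. Around a vertex of a link triangle, \<open>h\<close> minus the section is a
  constant \<open>b (i, v, w)\<close>, and it is the same in all triangles around that vertex, since triangles
  glued along a side share points near it. At interior points both descriptions apply.
\<close>

lemma trivial_near_end:
  assumes W: "openin N W" "topspace N - M \<subseteq> W"
    and h: "trivializes N U (F c \<epsilon>) (W - (topspace N - M)) h"
  obtains a b where "\<forall>i v w. v \<noteq> w \<longrightarrow> c (i, v, w) = a (i, v) + b (i, v, w)"
    "\<forall>i v w f. v \<noteq> w \<longrightarrow> f \<noteq> v \<longrightarrow> f \<noteq> w \<longrightarrow>
       b (adj T i f, glue T i f v, glue T i f w) = b (i, v, w)"
proof -
  obtain s where s: "0 < s" "s \<le> 1 / 2"
    "\<forall>i v x. x \<in> corner_region s v \<longrightarrow> \<kappa> (i, x) \<in> W - (topspace N - M)"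
    by (rule corners_reach_end[OF W]) (rule that, assumption+)
  define I where "I v = corner_region s v \<inter> {x. \<forall>u. 0 < x $ u}" for v
  define S where "S v w = corner_region s v \<inter> {x. (1 - x $ v) / 2 < x $ w}" for v w
  have L: "locally_constant_on N (U k \<inter> (W - (topspace N - M))) (\<lambda>m. h m - F c \<epsilon> k m)" for k
    using h by (simp only: trivializes_def)
  define a where "a = (\<lambda>(i, v). h (\<kappa> (i, inner_point s v (v + 1))))"
  have IU: "\<kappa> ` ({i} \<times> I v) \<subseteq> U Cell_piece \<inter> (W - (topspace N - M))" for i v
  proof
    fix m assume "m \<in> \<kappa> ` ({i} \<times> I v)"
    then obtain x where x: "m = \<kappa> (i, x)" "x \<in> corner_region s v" "\<forall>u. 0 < x $ u" by (auto simp: I_def)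
    have "(i, x) \<in> piece Cell_piece"
      unfolding mem_piece piece_region.simps using corner_region_punctured(1)[OF x(2) s(2), of i] corner_region_punctured(2)[OF x(2) s(2)] x(3) by blast
    then show "m \<in> U Cell_piece \<inter> (W - (topspace N - M))" using x s(3) by (auto simp: U_def)
  qed
  have a: "h (\<kappa> (i, x)) = a (i, v)" if x: "x \<in> I v" for i v x
  proof -
    have "v \<noteq> v + 1" by simp
    then have e: "inner_point s v (v + 1) \<in> I v" using inner_point[OF s(1,2)] by (auto simp: I_def)
    have cv: "convex (I v)" unfolding I_def by (intro convex_Int convex_corner_region convex_positive)
    have "h (\<kappa> (i, x)) - F c \<epsilon> Cell_piece (\<kappa> (i, x)) =
        h (\<kappa> (i, inner_point s v (v + 1))) - F c \<epsilon> Cell_piece (\<kappa> (i, inner_point s v (v + 1)))"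
      by (rule locally_constant_on_connectedin[OF L connectedin_slice[OF cv _ s(2), of v i] IU])
        (use x e in \<open>auto simp: I_def\<close>)
    moreover have Fc0: "F c \<epsilon> Cell_piece m = 0" for m unfolding F_def by (cases "rep m") simp
    ultimately show ?thesis unfolding Fc0 diff_0_right a_def case_prod_conv by blast
  qed
  have SU: "\<kappa> ` ({i} \<times> S v w) \<subseteq> U Vertex_piece \<inter> (W - (topspace N - M))" if vw: "v \<noteq> w" for i v w
  proof
    fix m assume "m \<in> \<kappa> ` ({i} \<times> S v w)"
    then obtain x where x: "m = \<kappa> (i, x)" "x \<in> corner_region s v" "(1 - x $ v) / 2 < x $ w"
      by (auto simp: S_def)
    have "(i, x) \<in> piece Vertex_piece"
      unfolding mem_piece piece_region.simps using corner_region_punctured(1)[OF x(2) s(2), of i] corner_region_punctured(2)[OF x(2) s(2)] x(3) vw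
      by (intro conjI CollectI exI[of _ v] exI[of _ w]) auto
    then show "m \<in> U Vertex_piece \<inter> (W - (topspace N - M))" using x s(3) by (auto simp: U_def)
  qed
  define B where "B m = h m - F c \<epsilon> Vertex_piece m" for m
  define b where "b = (\<lambda>(i, v, w). B (\<kappa> (i, edge_point s v w)))"
  have b: "B (\<kappa> (i, x)) = b (i, v, w)" if vw: "v \<noteq> w" and x: "x \<in> S v w" for i v w x
  proof -
    have e: "edge_point s v w \<in> S v w" using edge_point[OF s(1,2) vw] by (auto simp: S_def)
    have cv: "convex (S v w)" unfolding S_def by (intro convex_Int convex_corner_region convex_dominant_region)
    show ?thesis unfolding b_def case_prod_conv B_def
      by (rule locally_constant_on_connectedin[OF L connectedin_slice[OF cv _ s(2), of v i] SU[OF vw]])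
        (use x e in \<open>auto simp: S_def\<close>)
  qed
  show thesis
  proof (rule that[of a b]; intro allI impI)
    fix i :: 'n and v w :: 4 assume vw: "v \<noteq> w"
    let ?x = "inner_point s v w"
    note p = inner_point[OF s(1,2) vw]
    have xP: "(i, ?x) \<in> topspace punctured_simplices" "1 / 2 < ?x $ v"
      using corner_region_punctured(1)[OF p(1) s(2), of i] corner_region_punctured(2)[OF p(1) s(2)] by auto
    have cell: "(i, ?x) \<in> piece Cell_piece"
      unfolding mem_piece piece_region.simps using xP p(3) by blast
    have "rep (\<kappa> (i, ?x)) = (i, ?x)"
    proof (rule saturated[of "(i, ?x)" "rep (\<kappa> (i, ?x))" "\<lambda>y. y = (i, ?x)"])
      show "z = (i, ?x)" if "glued T y z" "y = (i, ?x)" for y z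
        using not_glued_cell[OF that(1)] cell that(2) by blast
    qed (use rep[OF xP(1)] xP(1) in auto)
    moreover have "?x \<in> simplex3" using xP(1) by simp
    then have "near_corner ?x = v" "dominant ?x = w"
      using near_corner_eq[of ?x v] dominant_eq[of ?x v w] xP(2) p(2) vw by auto
    ultimately have Fc: "F c \<epsilon> Vertex_piece (\<kappa> (i, ?x)) = c (i, v, w)" by (simp add: F_def)
    have "b (i, v, w) = B (\<kappa> (i, ?x))" using b[OF vw] p by (simp add: S_def)
    also have "\<dots> = a (i, v) - c (i, v, w)" using a[of ?x v i] p Fc by (simp add: B_def I_def)
    finally show "c (i, v, w) = a (i, v) + b (i, v, w)"
      by (cases "a (i, v)"; cases "c (i, v, w)") simp_all
  next
    fix i :: 'n and v w f :: 4 assume vwf: "v \<noteq> w" "f \<noteq> v" "f \<noteq> w"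
    show "b (adj T i f, glue T i f v, glue T i f w) = b (i, v, w)"
      unfolding b_def case_prod_conv using glue_edge_point[OF s(1,2) vwf, of i] by simp
  qed
qed

end

section \<open>Cochains on the vertex links\<close>

lemma card_eq_image_times_kernel:
  fixes f :: "'a::ab_group_add \<Rightarrow> 'b::ab_group_add"
  assumes G: "finite G" "\<And>x y. x \<in> G \<Longrightarrow> y \<in> G \<Longrightarrow> x - y \<in> G" "\<And>x y. x \<in> G \<Longrightarrow> y \<in> G \<Longrightarrow> x + y \<in> G"
    and f: "\<And>x y. x \<in> G \<Longrightarrow> y \<in> G \<Longrightarrow> f (x - y) = f x - f y"
  shows "card G = card (f ` G) * card {x \<in> G. f x = 0}"
proof -
  have fib: "card {x \<in> G. f x = y} = card {x \<in> G. f x = 0}" if y: "y \<in> f ` G" for y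
  proof -
    obtain x0 where x0: "x0 \<in> G" "y = f x0" using y by blast
    have "bij_betw (\<lambda>x. x - x0) {x \<in> G. f x = y} {x \<in> G. f x = 0}"
    proof (rule bij_betwI[of _ _ _ "\<lambda>x. x + x0"])
      show "(\<lambda>x. x - x0) \<in> {x \<in> G. f x = y} \<rightarrow> {x \<in> G. f x = 0}" using G(2) f x0 by auto
      show "(\<lambda>x. x + x0) \<in> {x \<in> G. f x = 0} \<rightarrow> {x \<in> G. f x = y}"
      proof
        fix x assume x: "x \<in> {x \<in> G. f x = 0}"
        then have "x + x0 \<in> G" using G(3) x0(1) by blast
        moreover have "f (x + x0 - x0) = f (x + x0) - f x0" using f calculation x0(1) by blast
        then have "f (x + x0) = f x0" using x by simp
        ultimately show "x + x0 \<in> {x \<in> G. f x = y}" using x0(2) by blast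
      qed
    qed simp_all
    then show ?thesis by (rule bij_betw_same_card)
  qed
  have "G = (\<Union>y\<in>f ` G. {x \<in> G. f x = y})" by blast
  then have "card G = card (\<Union>y\<in>f ` G. {x \<in> G. f x = y})" by (rule arg_cong)
  also have "\<dots> = (\<Sum>y\<in>f ` G. card {x \<in> G. f x = y})"
    using G(1) by (intro card_UN_disjoint) auto
  also have "\<dots> = (\<Sum>y\<in>f ` G. card {x \<in> G. f x = 0})" using fib by (rule sum.cong[OF refl])
  finally show ?thesis by simp
qed

lemma card_le_image_times_fibre:
  assumes "finite A" "\<And>x. x \<in> A \<Longrightarrow> card {y \<in> A. f y = f x} \<le> n"
  shows "card A \<le> card (f ` A) * n"
proof -
  have "card A = card (\<Union>y\<in>f ` A. {x \<in> A. f x = y})" by (rule arg_cong[of _ _ card]) blast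
  also have "\<dots> \<le> (\<Sum>y\<in>f ` A. card {x \<in> A. f x = y})" using assms(1) by (intro card_UN_le) simp
  also have "\<dots> \<le> (\<Sum>y\<in>f ` A. n)" using assms(2) by (intro sum_mono) auto
  finally show ?thesis by simp
qed

lemma card_bit: "card (UNIV :: bit set) = 2"
proof -
  have U: "(UNIV :: bit set) = {0, 1}" using bit_not_one_iff by auto
  show ?thesis unfolding U by simp
qed

instance bit :: finite
proof
  have "(UNIV :: bit set) = {0, 1}" using bit_not_one_iff by auto
  then show "finite (UNIV :: bit set)" by (metis finite.emptyI finite.insertI)
qed

lemma bit_add_self: "x + x = (0 :: bit)"
  by (cases x) simp_all

lemma bit_eq_1_iff_eq_1: "(x = 1) = (y = 1) \<longleftrightarrow> x = (y :: bit)"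
  by (cases x; cases y) simp_all

lemma card_supported_bit_functions:
  fixes S :: "'a::finite set"
  shows "card {c :: 'a \<Rightarrow> bit. \<forall>x. x \<notin> S \<longrightarrow> c x = 0} = 2 ^ card S"
proof -
  have inv1: "(\<lambda>x. if x \<in> {x. c x = 1} then 1 else 0) = c" for c :: "'a \<Rightarrow> bit"
  proof
    show "(if x \<in> {x. c x = 1} then 1 else 0) = c x" for x by (cases "c x") simp_all
  qed
  have inv2: "{x. (if x \<in> A then 1 else 0) = (1 :: bit)} = A" for A :: "'a set" by auto
  have "bij_betw (\<lambda>c. {x. c x = 1}) {c :: 'a \<Rightarrow> bit. \<forall>x. x \<notin> S \<longrightarrow> c x = 0} (Pow S)"
  proof (rule bij_betwI[of _ _ _ "\<lambda>A x. if x \<in> A then 1 else 0"])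
    show "(\<lambda>c. {x. c x = 1}) \<in> {c :: 'a \<Rightarrow> bit. \<forall>x. x \<notin> S \<longrightarrow> c x = 0} \<rightarrow> Pow S"
    proof
      fix c :: "'a \<Rightarrow> bit" assume c: "c \<in> {c. \<forall>x. x \<notin> S \<longrightarrow> c x = 0}"
      have "x \<in> S" if "c x = 1" for x
      proof (rule ccontr)
        assume "x \<notin> S"
        then have "c x = 0" using c by simp
        then show False using that by simp
      qed
      then show "{x. c x = 1} \<in> Pow S" by blast
    qed
    show "(\<lambda>A x. if x \<in> A then 1 else 0) \<in> Pow S \<rightarrow> {c :: 'a \<Rightarrow> bit. \<forall>x. x \<notin> S \<longrightarrow> c x = 0}"
      by auto
  qed (simp_all only: inv1 inv2)
  then have "card {c :: 'a \<Rightarrow> bit. \<forall>x. x \<notin> S \<longrightarrow> c x = 0} = card (Pow S)" by (rule bij_betw_same_card)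
  then show ?thesis by (simp add: card_Pow)
qed

text \<open>
  The elements come in pairs of equal value.
\<close>

lemma sum_free_involution:
  fixes c :: "'a \<Rightarrow> bit"
  assumes "finite A" "\<And>x. x \<in> A \<Longrightarrow> \<tau> x \<in> A" "\<And>x. x \<in> A \<Longrightarrow> \<tau> (\<tau> x) = x"
    "\<And>x. x \<in> A \<Longrightarrow> \<tau> x \<noteq> x" "\<And>x. x \<in> A \<Longrightarrow> c (\<tau> x) = c x"
  shows "sum c A = 0"
  using assms
proof (induction A rule: finite_psubset_induct)
  case (psubset A)
  show ?case
  proof (cases "A = {}")
    case False
    then obtain x where x: "x \<in> A" by blast
    let ?B = "A - {x, \<tau> x}"
    have "sum c ?B = 0"
    proof (rule psubset.IH)
      fix y assume y: "y \<in> ?B"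
      then have yA: "y \<in> A" by blast
      have "\<tau> y \<noteq> x" using y psubset.prems(2)[OF yA] by auto
      moreover have "\<tau> y \<noteq> \<tau> x" using y psubset.prems(2)[OF yA] psubset.prems(2)[OF x] by auto
      ultimately show "\<tau> y \<in> ?B" using psubset.prems(1)[OF yA] by blast
    qed (use x psubset.prems in auto)
    moreover have "sum c A = c x + (c (\<tau> x) + sum c ?B)"
    proof -
      have "\<tau> x \<in> A - {x}" using psubset.prems(1,3)[OF x] by blast
      then have "sum c (A - {x}) = c (\<tau> x) + sum c (A - {x} - {\<tau> x})"
        using psubset.hyps(1) by (intro sum.remove) auto
      moreover have "A - {x} - {\<tau> x} = ?B" by blast
      ultimately show ?thesis using sum.remove[OF psubset.hyps(1) x, of c] by simp
    qed
    ultimately show ?thesis using psubset.prems(4)[OF x] by (simp add: bit_add_self flip: add.assoc)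
  qed simp
qed

lemma power2_cancel: "(2::nat) ^ (2 * a) \<le> b * b \<Longrightarrow> 2 ^ a \<le> b"
proof -
  assume "(2::nat) ^ (2 * a) \<le> b * b"
  then have "(2 ^ a)\<^sup>2 \<le> b\<^sup>2" by (simp only: power_even_eq power2_eq_square)
  then show ?thesis by (rule power2_le_imp_le) simp
qed

text \<open>
  The triple \<open>(i, v, f)\<close> stands for the side in face \<open>f\<close> of the link triangle at the corner \<open>v\<close> of
  the tetrahedron \<open>i\<close>, and by the same token, for \<open>w\<close> in place of \<open>f\<close>, for the vertex of this triangle
  on the edge \<open>{v, w}\<close>. Triples with \<open>f = v\<close> are degenerate, and functions are required to vanish on
  them.
\<close>

definition arc_partner :: "'n gluing \<Rightarrow> 'n \<times> 4 \<times> 4 \<Rightarrow> 'n \<times> 4 \<times> 4" where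
  "arc_partner T = (\<lambda>(i, v, f). (adj T i f, glue T i f v, glue T i f f))"

definition flag_functions :: "('n \<times> 4 \<times> 4 \<Rightarrow> bit) set" where
  "flag_functions = {c. \<forall>i v. c (i, v, v) = 0}"

definition arc_functions :: "'n gluing \<Rightarrow> ('n \<times> 4 \<times> 4 \<Rightarrow> bit) set" where
  "arc_functions T = {c \<in> flag_functions. \<forall>x. c (arc_partner T x) = c x}"

text \<open>
  The cellular 1-cocycles. In a triangle with sides \<open>f\<close>, \<open>w\<close>, \<open>u\<close> the cocycle condition makes
  \<open>c (i, v, f)\<close> the sum of \<open>c (i, v, w)\<close> and \<open>c (i, v, u)\<close>. So, over \<open>\<int>/2\<close>, the values at the sides
  serve as the values at the opposite vertices of a function with coboundary \<open>c\<close>. This is why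
  \<open>piece_section\<close> applies \<open>c\<close> to vertices.
\<close>

definition arc_cocycles :: "'n gluing \<Rightarrow> ('n \<times> 4 \<times> 4 \<Rightarrow> bit) set" where
  "arc_cocycles T = {c \<in> arc_functions T. \<forall>i v. (\<Sum>f\<in>UNIV. c (i, v, f)) = 0}"

text \<open>
  The cellular 0-cocycles of the dual decomposition: one value for each triangle, constant on
  components of the links.
\<close>

definition corner_functions :: "'n gluing \<Rightarrow> ('n \<times> 4 \<Rightarrow> bit) set" where
  "corner_functions T = {a. \<forall>i v f. f \<noteq> v \<longrightarrow> a (adj T i f, glue T i f v) = a (i, v)}"

text \<open>
  The 0-cochains: the vertices of the links are the ends of the edges of the triangulation.
\<close>

definition edge_end_functions :: "'n gluing \<Rightarrow> ('n \<times> 4 \<times> 4 \<Rightarrow> bit) set" where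
  "edge_end_functions T = {b \<in> flag_functions. \<forall>i v w f. v \<noteq> w \<longrightarrow> f \<noteq> v \<longrightarrow> f \<noteq> w \<longrightarrow>
     b (adj T i f, glue T i f v, glue T i f w) = b (i, v, w)}"

text \<open>
  The side in face \<open>f\<close> of the link triangle at \<open>v\<close> ends on the edges from \<open>v\<close> to the two vertices other
  than \<open>v\<close> and \<open>f\<close>.
\<close>

definition coboundary :: "('n \<times> 4 \<times> 4 \<Rightarrow> bit) \<Rightarrow> 'n \<times> 4 \<times> 4 \<Rightarrow> bit" where
  "coboundary b = (\<lambda>(i, v, f). if f = v then 0 else \<Sum>w\<in>- {v, f}. b (i, v, w))"

lemma glue_inj: "face_pairing T \<Longrightarrow> glue T i f a = glue T i f b \<longleftrightarrow> a = b"
  unfolding face_pairing_def by (metis bij_is_inj inj_eq)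

lemma arc_partner_involution:
  assumes "face_pairing T"
  shows "arc_partner T (arc_partner T x) = x"
proof -
  obtain i v f where x: "x = (i, v, f)" by (cases x)
  have "adj T (adj T i f) (glue T i f f) = i" "glue T (adj T i f) (glue T i f f) = inv (glue T i f)"
    "inj (glue T i f)"
    using assms unfolding face_pairing_def by (auto simp: bij_is_inj)
  then show ?thesis by (simp add: x arc_partner_def)
qed

lemma arc_partner_free: "face_pairing T \<Longrightarrow> arc_partner T x \<noteq> x"
proof -
  assume fp: "face_pairing T"
  obtain i v f where x: "x = (i, v, f)" by (cases x)
  have "(adj T i f, glue T i f f) \<noteq> (i, f)" using fp unfolding face_pairing_def by blast
  then show ?thesis by (auto simp: x arc_partner_def)
qed

lemma card_complement_pair: "v \<noteq> f \<Longrightarrow> card (- {v, f} :: 4 set) = 2"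
  by (rule card_Compl_4) simp

lemma card_flag_functions: "card (flag_functions :: ('n::finite \<times> 4 \<times> 4 \<Rightarrow> bit) set) = 2 ^ (12 * CARD('n))"
proof -
  let ?S = "SIGMA i:(UNIV :: 'n set). SIGMA v:(UNIV :: 4 set). - {v}"
  have eq: "(flag_functions :: ('n \<times> 4 \<times> 4 \<Rightarrow> bit) set) = {c. \<forall>x. x \<notin> ?S \<longrightarrow> c x = 0}"
    by (auto simp: flag_functions_def)
  have "card (flag_functions :: ('n \<times> 4 \<times> 4 \<Rightarrow> bit) set) = 2 ^ card ?S"
    unfolding eq by (rule card_supported_bit_functions)
  moreover have "card ?S = 12 * CARD('n)"
    by (simp add: Compl_eq_Diff_UNIV card_Diff_singleton)
  ultimately show ?thesis by simp
qed

text \<open>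
  The map \<open>c + c \<circ> \<tau>\<close>, for \<open>\<tau>\<close> the involution that exchanges glued sides, has the invariant
  functions as its kernel and takes values in them. So the square of their number is at least the
  number \<open>2\<^bsup>12 t\<^esup>\<close> of all functions.
\<close>

lemma arc_functions_large:
  fixes T :: "'n::finite gluing"
  assumes fp: "face_pairing T"
  shows "2 ^ (6 * CARD('n)) \<le> card (arc_functions T)"
proof -
  let ?\<phi> = "\<lambda>c x. c x + c (arc_partner T x) :: bit"
  let ?G = "flag_functions :: ('n \<times> 4 \<times> 4 \<Rightarrow> bit) set"
  have "card ?G = card (?\<phi> ` ?G) * card {c \<in> ?G. ?\<phi> c = 0}"
    by (rule card_eq_image_times_kernel) (auto simp: flag_functions_def fun_eq_iff algebra_simps)
  moreover have "{c \<in> ?G. ?\<phi> c = 0} = arc_functions T"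
    by (auto simp: arc_functions_def fun_eq_iff bit_eq_1_iff_eq_1)
  moreover have "?\<phi> ` ?G \<subseteq> arc_functions T"
    using arc_partner_involution[OF fp]
    by (auto simp: arc_functions_def flag_functions_def arc_partner_def add.commute)
  then have "card (?\<phi> ` ?G) \<le> card (arc_functions T)" by (rule card_mono[OF finite])
  ultimately have "2 ^ (2 * (6 * CARD('n))) \<le> card (arc_functions T) * card (arc_functions T)"
    by (simp add: card_flag_functions)
  then show ?thesis by (rule power2_cancel)
qed

text \<open>
  Link triangles that share a side. The classes generated by this relation are the components of
  the links.
\<close>

definition corner_glued :: "'n gluing \<Rightarrow> 'n \<times> 4 \<Rightarrow> 'n \<times> 4 \<Rightarrow> bool" where
  "corner_glued T = (\<lambda>(i, v) y. \<exists>f. f \<noteq> v \<and> y = (adj T i f, glue T i f v))"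

lemma corner_functions_class:
  assumes "a \<in> corner_functions T" "equivclp (corner_glued T) y z"
  shows "a z = a y"
  using assms(2)
proof (induction rule: equivclp_induct)
  case (step y z)
  have "a q = a p" if "corner_glued T p q" for p q
    using that assms(1) by (cases p) (auto simp: corner_glued_def corner_functions_def)
  then show ?case using step by metis
qed simp

text \<open>
  Functions on triangles that could be sums over the sides of a function on arcs: every arc of a
  component occurs in two triangles of it, so the values add up to 0.
\<close>

definition balanced_functions :: "'n gluing \<Rightarrow> ('n \<times> 4 \<Rightarrow> bit) set" where
  "balanced_functions T = {s. \<forall>y. (\<Sum>z\<in>class_of (corner_glued T) y. s z) = 0}"

text \<open>
  Summing over components maps functions on triangles onto functions on components.
\<close>

lemma corner_balanced_count:
  fixes T :: "'n::finite gluing"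
  shows "card (corner_functions T) * card (balanced_functions T) \<le> 2 ^ (4 * CARD('n))"
proof -
  let ?cl = "class_of (corner_glued T)"
  let ?\<phi> = "\<lambda>s y. \<Sum>z\<in>?cl y. s z :: bit"
  have "card (UNIV :: ('n \<times> 4 \<Rightarrow> bit) set) = card (range ?\<phi>) * card {s \<in> UNIV. ?\<phi> s = 0}"
    by (rule card_eq_image_times_kernel) (auto simp: fun_eq_iff sum_subtractf simp del: minus_bit_def)
  moreover have "{s \<in> UNIV. ?\<phi> s = 0} = balanced_functions T"
    by (auto simp: balanced_functions_def fun_eq_iff)
  moreover have "corner_functions T \<subseteq> range ?\<phi>"
  proof
    fix a assume a: "a \<in> corner_functions T"
    define r where "r y = (SOME z. z \<in> ?cl y)" for y
    define s where "s z = (if z = r z then a z else 0)" for z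
    have "?\<phi> s y = a y" for y
    proof -
      have "y \<in> ?cl y" by (simp add: class_of_def)
      then have ry: "r y \<in> ?cl y" unfolding r_def by (rule someI)
      have "r z = r y" if "z \<in> ?cl y" for z
      proof -
        have "?cl z = ?cl y" using that class_of_eq_iff[of "corner_glued T" y z] by (simp add: class_of_def)
        then show ?thesis by (simp add: r_def)
      qed
      then have "?\<phi> s y = (\<Sum>z\<in>?cl y. if z = r y then a z else 0)"
        unfolding s_def by (intro sum.cong) auto
      also have "\<dots> = a (r y)" using ry by simp
      also have "\<dots> = a y" using corner_functions_class[OF a] ry by (simp add: class_of_def)
      finally show ?thesis .
    qed
    then have "a = ?\<phi> s" by (simp add: fun_eq_iff)
    then show "a \<in> range ?\<phi>" by blast
  qed
  then have "card (corner_functions T) \<le> card (range ?\<phi>)" by (rule card_mono[OF finite])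
  moreover have "card (UNIV :: ('n \<times> 4 \<Rightarrow> bit) set) = 2 ^ (4 * CARD('n))"
    using card_supported_bit_functions[of "UNIV :: ('n \<times> 4) set"] by (simp add: card_prod)
  ultimately show ?thesis by simp
qed

lemma arc_sums_balanced:
  fixes T :: "'n::finite gluing"
  assumes fp: "face_pairing T" and c: "c \<in> arc_functions T"
  shows "(\<lambda>(i, v). \<Sum>f\<in>UNIV. c (i, v, f)) \<in> balanced_functions T"
proof -
  have "(\<Sum>(i, v)\<in>class_of (corner_glued T) y. \<Sum>f\<in>UNIV. c (i, v, f)) = 0" for y
  proof -
    let ?cl = "class_of (corner_glued T) y"
    let ?A = "{(i, v, f). (i, v) \<in> ?cl \<and> f \<noteq> v}"
    have "sum c ?A = 0"
    proof (rule sum_free_involution[of _ "arc_partner T"])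
      fix x assume x: "x \<in> ?A"
      obtain i v f where ivf: "x = (i, v, f)" by (cases x)
      then have "equivclp (corner_glued T) y (i, v)" "f \<noteq> v" using x by (auto simp: class_of_def)
      moreover have "corner_glued T (i, v) (adj T i f, glue T i f v)"
        using \<open>f \<noteq> v\<close> by (auto simp: corner_glued_def)
      ultimately have "equivclp (corner_glued T) y (adj T i f, glue T i f v)"
        by (meson equivclp_trans r_into_equivclp)
      then show "arc_partner T x \<in> ?A"
        using \<open>f \<noteq> v\<close> glue_inj[OF fp] by (auto simp: ivf arc_partner_def class_of_def)
    qed (use c arc_partner_involution[OF fp] arc_partner_free[OF fp] in \<open>auto simp: arc_functions_def\<close>)
    moreover have "sum c ?A = (\<Sum>(i, v)\<in>?cl. \<Sum>f\<in>UNIV. c (i, v, f))"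
    proof -
      have "(\<Sum>(i, v)\<in>?cl. \<Sum>f\<in>UNIV. c (i, v, f)) = (\<Sum>p\<in>?cl. \<Sum>f\<in>UNIV. c (fst p, snd p, f))"
        by (simp add: case_prod_beta)
      also have "\<dots> = (\<Sum>(p, f)\<in>?cl \<times> UNIV. c (fst p, snd p, f))" by (simp add: sum.cartesian_product)
      also have "\<dots> = (\<Sum>(p, f)\<in>{(p, f). p \<in> ?cl \<and> f \<noteq> snd p}. c (fst p, snd p, f))"
        using c by (intro sum.mono_neutral_right) (auto simp: arc_functions_def flag_functions_def)
      also have "\<dots> = sum c ?A"
        by (rule sum.reindex_bij_witness[of _ "\<lambda>(i, v, f). ((i, v), f)" "\<lambda>((i, v), f). (i, v, f)"]) auto
      finally show ?thesis by simp
    qed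
    ultimately show ?thesis by simp
  qed
  then show ?thesis by (simp add: balanced_functions_def)
qed

text \<open>
  The \<open>4 t\<close> cocycle conditions on the functions on \<open>6 t\<close> arcs satisfy one relation for
  each component.
\<close>

lemma arc_cocycles_large:
  fixes T :: "'n::finite gluing"
  assumes fp: "face_pairing T"
  shows "2 ^ (2 * CARD('n)) * card (corner_functions T) \<le> card (arc_cocycles T)"
proof -
  let ?\<phi> = "\<lambda>c. (\<lambda>(i, v). \<Sum>f\<in>UNIV. c (i, v, f)) :: 'n \<times> 4 \<Rightarrow> bit"
  have "card (arc_functions T) = card (?\<phi> ` arc_functions T) * card {c \<in> arc_functions T. ?\<phi> c = 0}"
    by (rule card_eq_image_times_kernel)
      (auto simp: arc_functions_def flag_functions_def fun_eq_iff sum_subtractf simp del: minus_bit_def)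
  also have "{c \<in> arc_functions T. ?\<phi> c = 0} = arc_cocycles T"
    by (auto simp: arc_cocycles_def fun_eq_iff)
  also have "card (?\<phi> ` arc_functions T) * card (arc_cocycles T)
      \<le> card (balanced_functions T) * card (arc_cocycles T)"
    using arc_sums_balanced[OF fp] by (intro mult_le_mono1 card_mono finite) blast
  finally have "2 ^ (6 * CARD('n)) \<le> card (balanced_functions T) * card (arc_cocycles T)"
    using arc_functions_large[OF fp] by (rule le_trans[rotated])
  then have "card (corner_functions T) * 2 ^ (6 * CARD('n))
      \<le> card (corner_functions T) * (card (balanced_functions T) * card (arc_cocycles T))"
    by (rule mult_le_mono2)
  also have "\<dots> = card (corner_functions T) * card (balanced_functions T) * card (arc_cocycles T)"
    by (simp only: mult.assoc)
  also have "\<dots> \<le> 2 ^ (4 * CARD('n)) * card (arc_cocycles T)"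
    using corner_balanced_count by (rule mult_le_mono1)
  also have "card (corner_functions T) * 2 ^ (6 * CARD('n))
      = 2 ^ (4 * CARD('n)) * (2 ^ (2 * CARD('n)) * card (corner_functions T))"
    by (simp flip: power_add mult.assoc)
  finally show ?thesis by simp
qed

text \<open>
  Functions that are constant on the components have coboundary 0.
\<close>

lemma coboundaries_small:
  fixes T :: "'n::finite gluing"
  assumes fp: "face_pairing T"
  shows "card (coboundary ` edge_end_functions T) * card (corner_functions T) \<le> card (edge_end_functions T)"
proof -
  let ?G = "edge_end_functions T"
  have "card ?G = card (coboundary ` ?G) * card {b \<in> ?G. coboundary b = 0}"
    by (rule card_eq_image_times_kernel)
      (auto simp: edge_end_functions_def flag_functions_def coboundary_def fun_eq_iff sum_subtractf simp del: minus_bit_def)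
  moreover have "card (corner_functions T) \<le> card {b \<in> ?G. coboundary b = 0}"
  proof (rule card_inj_on_le[of "\<lambda>a (i, v, w). if w = v then 0 else a (i, v)"])
    show "inj_on (\<lambda>a (i, v, w). if w = v then 0 else a (i, v) :: bit) (corner_functions T)"
    proof (rule inj_onI, rule ext)
      fix a a' :: "'n \<times> 4 \<Rightarrow> bit" and y :: "'n \<times> 4"
      assume eq: "(\<lambda>(i, v, w). if w = v then 0 else a (i, v)) = (\<lambda>(i, v, w). if w = v then 0 else a' (i, v))"
      obtain i v where y: "y = (i, v)" by (cases y)
      obtain w where "w \<noteq> v" using obtain_other[of v v] by blast
      then show "a y = a' y" using fun_cong[OF eq, of "(i, v, w)"] y by simp
    qed
    show "(\<lambda>a (i, v, w). if w = v then 0 else a (i, v)) ` corner_functions T \<subseteq> {b \<in> ?G. coboundary b = 0}"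
    proof
      fix b assume "b \<in> (\<lambda>a (i, v, w). if w = v then 0 else a (i, v)) ` corner_functions T"
      then obtain a where a: "a \<in> corner_functions T" "b = (\<lambda>(i, v, w). if w = v then 0 else a (i, v))" by blast
      have "coboundary b (i, v, f) = 0" for i v f
      proof (cases "f = v")
        case False
        then have "(\<Sum>w\<in>- {v, f}. b (i, v, w)) = (\<Sum>w\<in>- {v, f}. a (i, v))"
          by (intro sum.cong) (auto simp: a(2))
        also have "\<dots> = 0" using card_complement_pair[of v f] False by simp
        finally show ?thesis by (simp add: coboundary_def)
      qed (simp add: coboundary_def)
      moreover have "b \<in> ?G"
        unfolding edge_end_functions_def flag_functions_def
        using a(1) by (auto simp: a(2) corner_functions_def glue_inj[OF fp])
      ultimately show "b \<in> {b \<in> ?G. coboundary b = 0}" by (auto simp: fun_eq_iff)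
    qed
  qed simp
  ultimately show ?thesis by simp
qed

lemma edge_glued_sym:
  assumes fp: "face_pairing T" and g: "edge_glued T y z"
  shows "edge_glued T z y"
proof -
  obtain i A j B where yz: "y = (i, A)" "z = (j, B)" by (cases y; cases z)
  obtain f where f: "f \<notin> A" "j = adj T i f" "B = glue T i f ` A"
    using g by (auto simp: yz edge_glued_def)
  have "inj (glue T i f)" "adj T j (glue T i f f) = i" "glue T j (glue T i f f) = inv (glue T i f)"
    using fp f(2) unfolding face_pairing_def by (auto simp: bij_is_inj)
  moreover have "glue T i f f \<notin> B" using f(1,3) glue_inj[OF fp] by auto
  ultimately show ?thesis unfolding yz edge_glued_def using f(3)
    by (auto intro!: exI[of _ "glue T i f f"] simp: image_image)
qed

text \<open>
  An element is determined by its values at the two ends of one representative of each edge.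
\<close>

lemma edge_end_functions_small:
  fixes T :: "'n::finite gluing"
  assumes fp: "face_pairing T"
  shows "card (edge_end_functions T) \<le> 4 ^ card (edges T)"
proof -
  define r where "r e = (SOME (i, v, w). v \<noteq> w \<and> edge_class T i {v, w} = e)" for e
  define \<phi> where "\<phi> b = (\<lambda>e\<in>edges T. case r e of (i, v, w) \<Rightarrow> (b (i, v, w), b (i, w, v)))"
    for b :: "'n \<times> 4 \<times> 4 \<Rightarrow> bit"
  have "inj_on \<phi> (edge_end_functions T)"
  proof (rule inj_onI, rule ext)
    fix b b' :: "'n \<times> 4 \<times> 4 \<Rightarrow> bit" and y :: "'n \<times> 4 \<times> 4"
    assume b: "b \<in> edge_end_functions T" "b' \<in> edge_end_functions T" and eq: "\<phi> b = \<phi> b'"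
    obtain i v w where y: "y = (i, v, w)" by (cases y)
    show "b y = b' y"
    proof (cases "v = w")
      case True
      then show ?thesis using b y by (simp add: edge_end_functions_def flag_functions_def)
    next
      case False
      define e where "e = edge_class T i {v, w}"
      have eE: "e \<in> edges T" unfolding e_def edges_def using False by (auto intro!: exI[of _ i] exI[of _ "{v, w}"])
      obtain i0 v0 w0 where r: "r e = (i0, v0, w0)" by (cases "r e")
      have "case r e of (i, v, w) \<Rightarrow> v \<noteq> w \<and> edge_class T i {v, w} = e"
        unfolding r_def by (rule someI[of _ "(i, v, w)"]) (use False e_def in simp)
      then have r0: "v0 \<noteq> w0" "edge_class T i0 {v0, w0} = e" using r by auto
      have e0: "b (i0, v0, w0) = b' (i0, v0, w0)" "b (i0, w0, v0) = b' (i0, w0, v0)"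
        using fun_cong[OF eq, of e] eE by (auto simp: \<phi>_def r)
      have "equivclp (edge_glued T) (i0, {v0, w0}) (i, {v, w})"
        using r0(2) unfolding e_def edge_class_def class_of_eq_iff .
      then have "\<exists>v' w'. snd (i, {v, w}) = {v', w'} \<and> v' \<noteq> w' \<and>
          b (fst (i, {v, w}), v', w') = b' (fst (i, {v, w}), v', w') \<and>
          b (fst (i, {v, w}), w', v') = b' (fst (i, {v, w}), w', v')"
      proof (induction rule: equivclp_induct)
        case base
        show ?case using r0(1) e0 by auto
      next
        case (step y z)
        then have g: "edge_glued T y z" using edge_glued_sym[OF fp] by blast
        obtain j A k B where yz: "y = (j, A)" "z = (k, B)" by (cases y; cases z)
        obtain v' w' where vw: "A = {v', w'}" "v' \<noteq> w'" "b (j, v', w') = b' (j, v', w')"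
          "b (j, w', v') = b' (j, w', v')" using step.IH yz by auto
        obtain f where f: "f \<notin> A" "k = adj T j f" "B = glue T j f ` A"
          using g by (auto simp: yz edge_glued_def)
        have "b (k, glue T j f v', glue T j f w') = b (j, v', w')"
          "b (k, glue T j f w', glue T j f v') = b (j, w', v')"
          "b' (k, glue T j f v', glue T j f w') = b' (j, v', w')"
          "b' (k, glue T j f w', glue T j f v') = b' (j, w', v')"
          using b f vw(1,2) by (auto simp: edge_end_functions_def)
        then show ?case using vw f(3) glue_inj[OF fp] yz
          by (intro exI[of _ "glue T j f v'"] exI[of _ "glue T j f w'"]) auto
      qed
      then obtain v' w' where "{v, w} = {v', w'}" "b (i, v', w') = b' (i, v', w')"
        "b (i, w', v') = b' (i, w', v')" by auto
      then show ?thesis unfolding y by (auto simp: doubleton_eq_iff)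
    qed
  qed
  moreover have "\<phi> ` edge_end_functions T \<subseteq> edges T \<rightarrow>\<^sub>E (UNIV :: (bit \<times> bit) set)" by (auto simp: \<phi>_def)
  ultimately have "card (edge_end_functions T) \<le> card (edges T \<rightarrow>\<^sub>E (UNIV :: (bit \<times> bit) set))"
    by (intro card_inj_on_le) (auto intro!: finite_PiE)
  also have "\<dots> = 4 ^ card (edges T)"
    by (simp add: card_PiE card_cartesian_product card_bit flip: UNIV_Times_UNIV)
  finally show ?thesis .
qed

lemma sum_UNIV_4:
  fixes F :: "4 \<Rightarrow> 'a::comm_monoid_add"
  assumes "v \<noteq> f" "w \<noteq> v" "w \<noteq> f" "u \<noteq> v" "u \<noteq> f" "u \<noteq> w"
  shows "(\<Sum>x\<in>UNIV. F x) = F v + F f + F w + F u" and "- {v, f} = {w, u}"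
proof -
  have U: "UNIV = {v, f, w, u}"
    using assms by (intro card_subset_eq[symmetric]) auto
  show "(\<Sum>x\<in>UNIV. F x) = F v + F f + F w + F u"
    unfolding U using assms by (simp add: add.assoc)
  show "- {v, f} = {w, u}" using U assms by blast
qed

lemma arc_cocycle_triangle:
  assumes c: "c \<in> arc_cocycles T" and d: "v \<noteq> f" "w \<noteq> v" "w \<noteq> f" "u \<noteq> v" "u \<noteq> f" "u \<noteq> w"
  shows "c (i, v, f) = c (i, v, w) + c (i, v, u)"
proof -
  have "c (i, v, v) + c (i, v, f) + c (i, v, w) + c (i, v, u) = 0"
    using c sum_UNIV_4(1)[OF d, of "\<lambda>f. c (i, v, f)"] by (auto simp: arc_cocycles_def)
  moreover have "c (i, v, v) = 0"
    using c by (simp add: arc_cocycles_def arc_functions_def flag_functions_def)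
  ultimately show ?thesis
    by (cases "c (i, v, f)"; cases "c (i, v, w)"; cases "c (i, v, u)") simp_all
qed

text \<open>
  The change of \<open>c\<close> across a side is the same at both ends of the side and from both triangles. It is
  assigned to one of the two triangles; an enumeration of all sides is used to choose.
\<close>

lemma edge_splitting_exists:
  fixes T :: "'n::finite gluing"
  assumes fp: "face_pairing T" and c: "c \<in> arc_cocycles T"
  shows "\<exists>\<epsilon>. edge_splitting T c \<epsilon>"
proof -
  define o' where "o' v f = (SOME w. w \<noteq> v \<and> w \<noteq> f)" for v f :: 4
  have o': "o' v f \<noteq> v \<and> o' v f \<noteq> f" for v f
    unfolding o'_def by (rule someI_ex) (metis obtain_other)
  define C where "C = (\<lambda>(i, v, f). c (i, v, o' v f) + c (adj T i f, glue T i f v, glue T i f (o' v f)))"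
  have C: "C (i, v, f) = c (i, v, w) + c (adj T i f, glue T i f v, glue T i f w)"
    if d: "f \<noteq> v" "w \<noteq> v" "w \<noteq> f" for i v f w
  proof (cases "w = o' v f")
    case False
    let ?u = "o' v f" and ?g = "glue T i f" and ?j = "adj T i f"
    have du: "v \<noteq> f" "w \<noteq> v" "w \<noteq> f" "?u \<noteq> v" "?u \<noteq> f" "?u \<noteq> w" using d o' False by auto
    have "c (i, v, f) = c (i, v, w) + c (i, v, ?u)" by (rule arc_cocycle_triangle[OF c du])
    moreover have "c (?j, ?g v, ?g f) = c (?j, ?g v, ?g w) + c (?j, ?g v, ?g ?u)"
      by (rule arc_cocycle_triangle[OF c]) (use du glue_inj[OF fp] in auto)
    moreover have "c (?j, ?g v, ?g f) = c (i, v, f)"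
      using c by (auto simp: arc_cocycles_def arc_functions_def arc_partner_def)
    ultimately have "c (i, v, w) + c (i, v, ?u) = c (?j, ?g v, ?g w) + c (?j, ?g v, ?g ?u)" by simp
    then show ?thesis unfolding C_def
      by (cases "c (i, v, w)"; cases "c (i, v, ?u)"; cases "c (?j, ?g v, ?g w)"; cases "c (?j, ?g v, ?g ?u)") auto
  qed (simp add: C_def)
  (* only serves to single out one side of each glued pair *)
  obtain key :: "'n \<times> 4 \<times> 4 \<Rightarrow> nat" where key: "inj key"
    using finite_imp_inj_to_nat_seg[of "UNIV :: ('n \<times> 4 \<times> 4) set"] by auto
  define \<epsilon> where "\<epsilon> x = (if key x < key (arc_partner T x) then C x else 0)" for x
  have "\<epsilon> (i, v, f) + \<epsilon> (adj T i f, glue T i f v, glue T i f f)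
       = c (i, v, w) + c (adj T i f, glue T i f v, glue T i f w)"
    if d: "f \<noteq> v" "w \<noteq> v" "w \<noteq> f" for i v w f
  proof -
    let ?x = "(i, v, f)" and ?y = "arc_partner T (i, v, f)" and ?g = "glue T i f" and ?j = "adj T i f"
    have y: "?y = (?j, ?g v, ?g f)" by (simp add: arc_partner_def)
    have "C ?y = c (?j, ?g v, ?g w) + c (adj T ?j (?g f), glue T ?j (?g f) (?g v), glue T ?j (?g f) (?g w))"
      unfolding y by (rule C) (use d glue_inj[OF fp] in auto)
    moreover have "adj T ?j (?g f) = i" "glue T ?j (?g f) = inv ?g" "inj ?g"
      using fp unfolding face_pairing_def by (auto simp: bij_is_inj)
    ultimately have "C ?y = c (?j, ?g v, ?g w) + c (i, v, w)" by (simp only: inv_f_f)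
    then have Cy: "C ?y = c (i, v, w) + c (?j, ?g v, ?g w)" by (simp only: add.commute)
    have Cx: "C ?x = c (i, v, w) + c (?j, ?g v, ?g w)" by (rule C[OF d])
    have "key ?x \<noteq> key ?y" using arc_partner_free[OF fp, of ?x] key by (metis injD)
    then have "\<epsilon> ?x + \<epsilon> ?y = c (i, v, w) + c (?j, ?g v, ?g w)"
      unfolding \<epsilon>_def arc_partner_involution[OF fp] using Cx Cy by auto
    then show ?thesis unfolding y .
  qed
  then show ?thesis unfolding edge_splitting_def by blast
qed

section \<open>Comparison of tetrahedra and edges\<close>

text \<open>
  A set of boundary components has a locally constant indicator function. It extends to a
  neighbourhood of the boundary and yields a function that is constant on the corners. Different sets
  give different functions, since every boundary point is a limit of points in corners.
\<close>

lemma (in ideal_end) components_le_corner_functions: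
  "2 ^ card (connected_components_of (subtopology N (topspace N - M))) \<le> card (corner_functions T)"
proof -
  let ?D = "topspace N - M"
  let ?Y = "subtopology N ?D"
  let ?\<C> = "connected_components_of ?Y"
  define f where "f S x = (connected_component_of_set ?Y x \<in> S)" for S x
  have f: "f S x \<longleftrightarrow> C \<in> S" if C: "C \<in> ?\<C>" "x \<in> C" for S C x
  proof -
    have "x \<in> topspace ?Y" using C connected_components_of_subset by blast
    then have "connected_component_of_set ?Y x \<in> ?\<C>" "x \<in> connected_component_of_set ?Y x"
      by (simp_all add: connected_component_in_connected_components_of connected_component_of_refl)
    then have "connected_component_of_set ?Y x = C"
      using C pairwiseD[OF pairwise_disjoint_connected_components_of, of "connected_component_of_set ?Y x" ?Y C]
      by (auto simp: disjnt_def)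
    then show ?thesis by (simp add: f_def)
  qed
  have lc: "locally_constant_on N ?D (f S)" for S
  proof -
    have "locally_constant_on ?Y ?D (f S)"
    proof (rule locally_constant_onI)
      fix x assume x: "x \<in> topspace ?Y" "x \<in> ?D"
      then obtain C where C: "C \<in> ?\<C>" "x \<in> C"
        using Union_connected_components_of[of ?Y] by blast
      have "openin ?Y C" by (rule connected_component_boundary_open[OF boxed C(1)])
      moreover have "\<forall>y\<in>C \<inter> ?D. f S y = f S x" using f[OF C] f[OF C(1)] by blast
      ultimately show "\<exists>V. openin ?Y V \<and> x \<in> V \<and> (\<forall>y\<in>V \<inter> ?D. f S y = f S x)" using C(2) by blast
    qed
    then show ?thesis using locally_constant_on_subtopology[of ?D ?D N] by blast
  qed
  have ex: "\<exists>a s. \<exists>G.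
      (\<forall>p\<in>?D. \<exists>V. openin N V \<and> p \<in> V \<and> (\<forall>y\<in>V - ?D. G y = f S p)) \<and> 0 < s \<and> s \<le> 1 / 2 \<and>
      (\<forall>i v x. x \<in> corner_region s v \<longrightarrow> G (\<kappa> (i, x)) = a (i, v)) \<and>
      (\<forall>i v f. f \<noteq> v \<longrightarrow> a (adj T i f, glue T i f v) = a (i, v))" for S
  proof -
    obtain W G where W: "openin N W" "?D \<subseteq> W" "locally_constant_on N (W - ?D) G"
      "\<forall>p\<in>?D. \<exists>V. openin N V \<and> p \<in> V \<and> V \<subseteq> W \<and> (\<forall>y\<in>V - ?D. G y = f S p)"
      using locally_constant_extends_inward[OF compact Hausdorff boxed lc[of S]]
      by (elim exE conjE) (rule that, assumption+)
    have germ: "\<forall>p\<in>?D. \<exists>V. openin N V \<and> p \<in> V \<and> (\<forall>y\<in>V - ?D. G y = f S p)"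
    proof
      fix p assume p: "p \<in> ?D"
      obtain V where "openin N V" "p \<in> V" "\<forall>y\<in>V - ?D. G y = f S p"
        using bspec[OF W(4) p] by (elim exE conjE) (rule that, assumption+)
      then show "\<exists>V. openin N V \<and> p \<in> V \<and> (\<forall>y\<in>V - ?D. G y = f S p)" by (intro exI conjI)
    qed
    obtain s a where "0 < s" "s \<le> 1 / 2"
      "\<forall>i v x. x \<in> corner_region s v \<longrightarrow> G (\<kappa> (i, x)) = a (i, v)"
      "\<forall>i v f. f \<noteq> v \<longrightarrow> a (adj T i f, glue T i f v) = a (i, v)"
      by (rule locally_constant_near_corners[OF W(1-3)]) (rule that, assumption+)
    then show ?thesis using germ
      by (rule_tac exI[of _ a], rule_tac exI[of _ s], rule_tac exI[of _ G]) (intro conjI)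
  qed
  define A where "A S = (SOME a. \<exists>s. \<exists>G. 
      (\<forall>p\<in>?D. \<exists>V. openin N V \<and> p \<in> V \<and> (\<forall>y\<in>V - ?D. G y = f S p)) \<and> 0 < s \<and> s \<le> 1 / 2 \<and>
      (\<forall>i v x. x \<in> corner_region s v \<longrightarrow> G (\<kappa> (i, x)) = a (i, v)) \<and>
      (\<forall>i v f. f \<noteq> v \<longrightarrow> a (adj T i f, glue T i f v) = a (i, v)))" for S
  have A: "\<exists>s. \<exists>G. 
      (\<forall>p\<in>?D. \<exists>V. openin N V \<and> p \<in> V \<and> (\<forall>y\<in>V - ?D. G y = f S p)) \<and> 0 < s \<and> s \<le> 1 / 2 \<and>
      (\<forall>i v x. x \<in> corner_region s v \<longrightarrow> G (\<kappa> (i, x)) = A S (i, v)) \<and>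
      (\<forall>i v f. f \<noteq> v \<longrightarrow> A S (adj T i f, glue T i f v) = A S (i, v))" for S
    unfolding A_def by (rule someI_ex[OF ex])
  define a where "a S y = (if A S y then 1 else 0 :: bit)" for S y
  have "inj_on a (Pow ?\<C>)"
  proof (rule inj_onI, rule ccontr)
    fix S S' assume S: "S \<in> Pow ?\<C>" "S' \<in> Pow ?\<C>" "a S = a S'" "S \<noteq> S'"
    have AA: "A S y = A S' y" for y using fun_cong[OF S(3), of y] by (auto simp: a_def split: if_splits)
    obtain C where C: "C \<in> ?\<C>" "C \<in> S \<longleftrightarrow> C \<notin> S'" using S by blast
    obtain p where p: "p \<in> C" using nonempty_connected_components_of[OF C(1)] by blast
    have pD: "p \<in> ?D" using p connected_components_of_subset[OF C(1)] by auto
    have fp: "f S p \<noteq> f S' p" using f[OF C(1) p] C(2) by blast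
    obtain s G where G: "\<forall>p\<in>?D. \<exists>V. openin N V \<and> p \<in> V \<and> (\<forall>y\<in>V - ?D. G y = f S p)" "0 < s" "s \<le> 1 / 2"
      "\<forall>i v x. x \<in> corner_region s v \<longrightarrow> G (\<kappa> (i, x)) = A S (i, v)" using A[of S] by (elim exE conjE) (rule that, assumption+)
    obtain s' G' where G': "\<forall>p\<in>?D. \<exists>V. openin N V \<and> p \<in> V \<and> (\<forall>y\<in>V - ?D. G' y = f S' p)" "0 < s'" "s' \<le> 1 / 2"
      "\<forall>i v x. x \<in> corner_region s' v \<longrightarrow> G' (\<kappa> (i, x)) = A S' (i, v)" using A[of S'] by (elim exE conjE) (rule that, assumption+)
    obtain V where V: "openin N V" "p \<in> V" "\<forall>y\<in>V - ?D. G y = f S p" using G(1) pD by blast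
    obtain V' where V': "openin N V'" "p \<in> V'" "\<forall>y\<in>V' - ?D. G' y = f S' p" using G'(1) pD by blast
    define r where "r = min s s'"
    have r: "0 < r" using G(2) G'(2) by (simp add: r_def)
    have "closedin N (\<kappa> ` core r)" by (rule compactin_imp_closedin[OF Hausdorff compactin_core[OF r]])
    then have o: "openin N (V \<inter> V' \<inter> (topspace N - \<kappa> ` core r))" using V(1) V'(1) by blast
    have "p \<notin> \<kappa> ` core r" using pD core_punctured[OF r] kappa_in_M by auto
    then have pV: "p \<in> V \<inter> V' \<inter> (topspace N - \<kappa> ` core r)" using pD V(2) V'(2) by blast
    obtain B where B: "B \<subseteq> V \<inter> V' \<inter> (topspace N - \<kappa> ` core r)" "half_box N ?D B"
      by (rule half_boxedE[OF boxed pD o pV]) (rule that, assumption+)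
    obtain m where m: "m \<in> B - ?D" using half_box_nonempty[OF B(2)] by blast
    then have mM: "m \<in> M" and "m \<notin> \<kappa> ` core r" using B(1) by auto
    obtain i x where ix: "(i, x) \<in> topspace punctured_simplices" "m = \<kappa> (i, x)"
      by (rule point_of_M[OF mM]) (rule that, assumption+)
    then have "(i, x) \<notin> core r" using \<open>m \<notin> \<kappa> ` core r\<close> by blast
    then obtain v where "1 - r < x $ v" using ix(1) by (auto simp: core_def not_le)
    then have "x \<in> corner_region s v" "x \<in> corner_region s' v"
      using ix(1) by (auto simp: corner_region_def r_def)
    then have "G m = A S (i, v)" "G' m = A S' (i, v)" using G(4) G'(4) ix(2) by auto
    moreover have "G m = f S p" "G' m = f S' p" using V(3) V'(3) m B(1) by blast+
    ultimately show False using fp AA by simp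
  qed
  moreover have "a ` Pow ?\<C> \<subseteq> corner_functions T"
  proof
    fix b assume "b \<in> a ` Pow ?\<C>"
    then obtain S where b: "b = a S" by blast
    have "\<forall>i v f. f \<noteq> v \<longrightarrow> A S (adj T i f, glue T i f v) = A S (i, v)"
      using A[of S] by (elim exE conjE)
    then show "b \<in> corner_functions T" by (simp add: b a_def corner_functions_def)
  qed
  ultimately have "card (Pow ?\<C>) \<le> card (corner_functions T)" by (rule card_inj_on_le) simp
  then show ?thesis
    using finite_components_boundary[OF compact boxed] by (simp add: card_Pow)
qed

text \<open>
  Arc cocycles whose extensions to the boundary have the same holonomies differ by a coboundary, and
  there are at most four pairs of holonomies for each boundary component.
\<close>

lemma (in ideal_end) arc_cocycles_small:
  assumes Z: "\<And>C. C \<in> connected_components_of (subtopology N (topspace N - M)) \<Longrightarrow>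
              square_quotient (subtopology (subtopology N (topspace N - M)) C)"
  shows "card (arc_cocycles T) \<le> 4 ^ card (connected_components_of (subtopology N (topspace N - M)))
      * card (coboundary ` edge_end_functions T)"
proof -
  let ?D = "topspace N - M"
  let ?\<C> = "connected_components_of (subtopology N ?D)"
  define \<epsilon> where "\<epsilon> c = (SOME \<epsilon>. edge_splitting T c \<epsilon>)" for c
  have \<epsilon>: "edge_splitting T c (\<epsilon> c)" if "c \<in> arc_cocycles T" for c
    unfolding \<epsilon>_def by (rule someI_ex[OF edge_splitting_exists[OF fp that]])
  obtain \<beta> :: "(piece \<Rightarrow> 'a \<Rightarrow> bit) \<Rightarrow> 'a set \<Rightarrow> bit \<times> bit" where
    \<beta>: "\<forall>F F'. cocycle N U F \<longrightarrow> cocycle N U F' \<longrightarrow> (\<forall>C\<in>?\<C>. \<beta> F C = \<beta> F' C) \<longrightarrow>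
     (\<exists>W h. openin N W \<and> ?D \<subseteq> W \<and> W \<subseteq> end_region \<and> trivializes N U (\<lambda>k x. F k x - F' k x) (W - ?D) h)"
    using end_holonomy[OF compact Hausdorff boxed Z end_region] by (rule exE)
  define \<phi> where "\<phi> c = restrict (\<beta> (F c (\<epsilon> c))) ?\<C>" for c
  let ?B = "coboundary ` edge_end_functions T"
  have diff: "c - c' \<in> ?B"
    if c: "c \<in> arc_cocycles T" "c' \<in> arc_cocycles T" and eq: "\<phi> c = \<phi> c'" for c c'
  proof -
    have "\<beta> (F c (\<epsilon> c)) C = \<beta> (F c' (\<epsilon> c')) C" if "C \<in> ?\<C>" for C
      using fun_cong[OF eq, of C] that by (simp add: \<phi>_def)
    then have "\<forall>C\<in>?\<C>. \<beta> (F c (\<epsilon> c)) C = \<beta> (F c' (\<epsilon> c')) C" by (rule ballI)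
    then have "\<exists>W h. openin N W \<and> ?D \<subseteq> W \<and> W \<subseteq> end_region \<and>
        trivializes N U (\<lambda>k x. F c (\<epsilon> c) k x - F c' (\<epsilon> c') k x) (W - ?D) h"
      using \<beta>[THEN spec, THEN spec, THEN mp, OF end_cocycle[OF \<epsilon>[OF c(1)]],
          THEN mp, OF end_cocycle[OF \<epsilon>[OF c(2)]]] by (rule mp[rotated])
    then obtain W h where W: "openin N W" "?D \<subseteq> W"
      "trivializes N U (\<lambda>k x. F c (\<epsilon> c) k x - F c' (\<epsilon> c') k x) (W - ?D) h"
      by (elim exE conjE) (rule that, assumption+)
    let ?d = "\<lambda>y. c y - c' y"
    have tr: "trivializes N U (F ?d (\<lambda>y. \<epsilon> c y - \<epsilon> c' y)) (W - ?D) h"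
      using W(3) by (simp only: F_diff[symmetric])
    obtain a b where ab: "\<forall>i v w. v \<noteq> w \<longrightarrow> ?d (i, v, w) = a (i, v) + b (i, v, w)"
      "\<forall>i v w f. v \<noteq> w \<longrightarrow> f \<noteq> v \<longrightarrow> f \<noteq> w \<longrightarrow>
         b (adj T i f, glue T i f v, glue T i f w) = b (i, v, w)"
      by (rule trivial_near_end[OF W(1,2) tr]) (rule that, assumption+)
    define b' where "b' = (\<lambda>(i, v, w). if v = w then 0 else b (i, v, w))"
    have "b' \<in> edge_end_functions T"
      using ab(2) glue_inj[OF fp] by (auto simp: edge_end_functions_def flag_functions_def b'_def)
    moreover have "(c - c') y = coboundary b' y" for y
    proof -
      obtain i v f where y: "y = (i, v, f)" by (cases y)
      show ?thesis
      proof (cases "v = f")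
        case True
        have "c (i, v, v) = 0" "c' (i, v, v) = 0"
          using c by (auto simp: arc_cocycles_def arc_functions_def flag_functions_def)
        then show ?thesis using True by (simp add: y coboundary_def)
      next
        case False
        obtain w u where wu: "w \<noteq> u" "- {v, f} = {w, u}"
          using card_complement_pair[OF False] by (auto simp: card_2_iff)
        then have d: "v \<noteq> f" "w \<noteq> v" "w \<noteq> f" "u \<noteq> v" "u \<noteq> f" "u \<noteq> w" using False by auto
        have "coboundary b' y = b (i, v, w) + b (i, v, u)"
          using d wu by (simp add: y coboundary_def b'_def)
        moreover have "c (i, v, f) = c (i, v, w) + c (i, v, u)" "c' (i, v, f) = c' (i, v, w) + c' (i, v, u)"
          using arc_cocycle_triangle[OF c(1) d] arc_cocycle_triangle[OF c(2) d] by auto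
        moreover have "c (i, v, w) - c' (i, v, w) = a (i, v) + b (i, v, w)"
          "c (i, v, u) - c' (i, v, u) = a (i, v) + b (i, v, u)" using ab(1) d by auto
        ultimately have "c (i, v, f) - c' (i, v, f) = coboundary b' y"
          by (cases "c (i, v, w)"; cases "c (i, v, u)"; cases "c' (i, v, w)"; cases "c' (i, v, u)";
              cases "a (i, v)"; cases "b (i, v, w)"; cases "b (i, v, u)") simp_all
        then show ?thesis by (simp add: y)
      qed
    qed
    then have "c - c' = coboundary b'" by (rule ext)
    ultimately show ?thesis by blast
  qed
  have "card (arc_cocycles T) \<le> card (\<phi> ` arc_cocycles T) * card ?B"
  proof (rule card_le_image_times_fibre)
    fix c assume c: "c \<in> arc_cocycles T"
    have "{y \<in> arc_cocycles T. \<phi> y = \<phi> c} \<subseteq> (\<lambda>d. d + c) ` ?B"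
    proof
      fix y assume "y \<in> {y \<in> arc_cocycles T. \<phi> y = \<phi> c}"
      then have "y - c \<in> ?B" using diff c by blast
      then have "(y - c) + c \<in> (\<lambda>d. d + c) ` ?B" by (rule imageI)
      then show "y \<in> (\<lambda>d. d + c) ` ?B" by (simp only: diff_add_cancel)
    qed
    then have "card {y \<in> arc_cocycles T. \<phi> y = \<phi> c} \<le> card ((\<lambda>d. d + c) ` ?B)"
      by (rule card_mono[OF finite])
    also have "\<dots> \<le> card ?B" by (rule card_image_le) simp
    finally show "card {y \<in> arc_cocycles T. \<phi> y = \<phi> c} \<le> card ?B" .
  qed simp
  moreover have "card (\<phi> ` arc_cocycles T) \<le> 4 ^ card ?\<C>"
  proof -
    have fin: "finite ?\<C>" by (rule finite_components_boundary[OF compact boxed])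
    have "\<phi> ` arc_cocycles T \<subseteq> ?\<C> \<rightarrow>\<^sub>E (UNIV :: (bit \<times> bit) set)" by (auto simp: \<phi>_def)
    then have "card (\<phi> ` arc_cocycles T) \<le> card (?\<C> \<rightarrow>\<^sub>E (UNIV :: (bit \<times> bit) set))"
      by (rule card_mono[rotated]) (intro finite_PiE fin finite)
    also have "\<dots> = 4 ^ card ?\<C>" using fin
      by (simp add: card_PiE card_cartesian_product card_bit flip: UNIV_Times_UNIV)
    finally show ?thesis .
  qed
  ultimately show ?thesis by (meson le_trans mult_le_mono1)
qed

text \<open>
  The bounds are multiplied together. As \<open>4\<^sup>n\<close> is at most the square of the number of corner
  functions, both cancel.
\<close>

lemma (in ideal_end) tetrahedra_le_edges:
  assumes Z: "\<And>C. C \<in> connected_components_of (subtopology N (topspace N - M)) \<Longrightarrow>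
              square_quotient (subtopology (subtopology N (topspace N - M)) C)"
  shows "CARD('n) \<le> card (edges T)"
proof -
  define n where "n = card (connected_components_of (subtopology N (topspace N - M)))"
  let ?k = "card (corner_functions T)" and ?B = "card (coboundary ` edge_end_functions T)"
  have "0 < ?k" using components_le_corner_functions by (metis gr0I le_zero_eq power_not_zero zero_neq_numeral)
  have "2 ^ (2 * CARD('n)) * ?k * ?k \<le> card (arc_cocycles T) * ?k"
    by (rule mult_le_mono1[OF arc_cocycles_large[OF fp]])
  also have "\<dots> \<le> 4 ^ n * ?B * ?k"
    using arc_cocycles_small[OF Z] unfolding n_def by (rule mult_le_mono1)
  also have "\<dots> \<le> 4 ^ n * card (edge_end_functions T)"
    using coboundaries_small[OF fp] by (simp add: mult.assoc)
  also have "\<dots> \<le> 4 ^ n * 4 ^ card (edges T)"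
    using edge_end_functions_small[OF fp] by simp
  also have "\<dots> = (2 ^ n * 2 ^ n) * 4 ^ card (edges T)" by (simp flip: power_mult_distrib)
  also have "\<dots> \<le> (?k * ?k) * 4 ^ card (edges T)"
    using components_le_corner_functions unfolding n_def by (intro mult_le_mono1 mult_le_mono)
  finally have "(?k * ?k) * 2 ^ (2 * CARD('n)) \<le> (?k * ?k) * 4 ^ card (edges T)"
    by (simp only: mult_ac)
  then have "(2 :: nat) ^ (2 * CARD('n)) \<le> 4 ^ card (edges T)" using \<open>0 < ?k\<close> by simp
  also have "(4 :: nat) ^ card (edges T) = 2 ^ (2 * card (edges T))" by (simp add: power_mult)
  finally show ?thesis by simp
qed

text \<open>
  The theorem on tetrahedra and edges applies with \<open>M\<close> identified with the interior of \<open>N\<close>, because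
  tori and Klein bottles are quotients of a square.
\<close>

theorem ideal_triangulation_tetrahedra_le_edges:
  fixes T :: "'n::finite gluing"
  assumes N: "compact_3manifold_with_boundary N"
    and M: "M = manifold_interior N"
    and T: "ideal_triangulation M T h"
    and B: "\<And>B. B \<in> connected_components_of (manifold_boundary N) \<Longrightarrow>
           subtopology (manifold_boundary N) B homeomorphic_space torus \<or>
           subtopology (manifold_boundary N) B homeomorphic_space klein_bottle"
  shows "CARD('n) \<le> card (edges T)"
proof -
  have fp: "face_pairing T"
    and h: "homeomorphic_map M
         (subtopology (pseudo_manifold T) (topspace (pseudo_manifold T) - vertex_points T)) h"
    using T by (auto simp: ideal_triangulation_def)
  obtain \<kappa> where \<kappa>: "quotient_map punctured_simplices M \<kappa>"
    "\<And>y z. y \<in> topspace punctured_simplices \<Longrightarrow> z \<in> topspace punctured_simplices \<Longrightarrow>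
       \<kappa> y = \<kappa> z \<longleftrightarrow> equivclp (glued T) y z"
    by (rule punctured_quotient[OF fp h]) (rule that)
  have "compact_space N" "Hausdorff_space N" using N by (auto simp: compact_3manifold_with_boundary_def)
  then interpret ideal_end T N "euclidean3_points N" \<kappa>
    using fp half_boxed_manifold_boundary[OF N] openin_euclidean3_points \<kappa>
    unfolding M manifold_interior_def by unfold_locales
  show ?thesis
  proof (rule tetrahedra_le_edges)
    fix C assume "C \<in> connected_components_of (subtopology N (topspace N - euclidean3_points N))"
    then show "square_quotient (subtopology (subtopology N (topspace N - euclidean3_points N)) C)"
      using B[of C] homeomorphic_square_quotient[OF square_quotient_torus]
        homeomorphic_square_quotient[OF square_quotient_klein_bottle]
      unfolding manifold_boundary_def by blast
  qed
qed

lemma quad_faces_facing_iff: "card A = 2 \<Longrightarrow> quad_faces q A \<longleftrightarrow> q = quad_facing A"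
  using quad_faces_unique quad_faces_quad_facing by blast

lemma Rep_quad_facing: "card A = 2 \<Longrightarrow> Rep_quad (quad_facing A) = {A, - A}"
  using quad_faces_iff[of A "quad_facing A"] quad_faces_quad_facing by blast

lemma quad_meets_iff: "card A = 2 \<Longrightarrow> quad_meets q A \<longleftrightarrow> q \<noteq> quad_facing A"
  using quad_faces_facing_iff[of A q] by (simp add: quad_meets_def quad_faces_def)

section \<open>Edges and quadrilaterals of a tetrahedron\<close>

text \<open>
  Naming the four vertices turns all sums over edges, vertices and quadrilaterals of a tetrahedron
  into explicit finite sums.
\<close>

locale four_vertices =
  fixes v w u f :: 4
  assumes distinct: "v \<noteq> w" "v \<noteq> u" "v \<noteq> f" "w \<noteq> u" "w \<noteq> f" "u \<noteq> f"
begin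

lemma UNIV_eq: "UNIV = {v, w, u, f}"
  using distinct by (intro card_subset_eq[symmetric]) auto

lemma Compl_eq: "- {v, w} = {u, f}" "- {v, u} = {w, f}" "- {v, f} = {w, u}"
  using distinct UNIV_eq by blast+

lemma edges_eq: "{A :: 4 set. card A = 2} = {{v, w}, {v, u}, {v, f}, {w, u}, {w, f}, {u, f}}"
proof
  show "{A :: 4 set. card A = 2} \<subseteq> {{v, w}, {v, u}, {v, f}, {w, u}, {w, f}, {u, f}}"
  proof
    fix A :: "4 set" assume "A \<in> {A. card A = 2}"
    then obtain a b where ab: "A = {a, b}" "a \<noteq> b" by (auto simp: card_2_iff)
    have "a \<in> {v, w, u, f}" "b \<in> {v, w, u, f}" using UNIV_eq by blast+
    then show "A \<in> {{v, w}, {v, u}, {v, f}, {w, u}, {w, f}, {u, f}}"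
      using ab by (auto simp: insert_commute)
  qed
qed (use distinct in auto)

lemma sum_edges:
  fixes F :: "4 set \<Rightarrow> real"
  shows "(\<Sum>A | card A = 2. F A) = F {v, w} + F {v, u} + F {v, f} + F {w, u} + F {w, f} + F {u, f}"
  unfolding edges_eq using distinct by (simp add: doubleton_eq_iff)

lemma edges_at_eq: "{A :: 4 set. card A = 2 \<and> v \<in> A} = {{v, w}, {v, u}, {v, f}}"
proof -
  have "{A :: 4 set. card A = 2 \<and> v \<in> A} = {A. card A = 2} \<inter> {A. v \<in> A}" by auto
  then show ?thesis unfolding edges_eq using distinct by auto
qed

lemma sum_edges_at:
  fixes F :: "4 set \<Rightarrow> real"
  shows "(\<Sum>A | card A = 2 \<and> v \<in> A. F A) = F {v, w} + F {v, u} + F {v, f}"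
  unfolding edges_at_eq using distinct by (simp add: doubleton_eq_iff)

lemma sum_vertices:
  fixes F :: "4 \<Rightarrow> real"
  shows "(\<Sum>x\<in>UNIV. F x) = F v + F w + F u + F f"
  unfolding UNIV_eq using distinct by simp

lemma quad_distinct: "quad_facing {v, w} \<noteq> quad_facing {v, u}"
  "quad_facing {v, w} \<noteq> quad_facing {v, f}" "quad_facing {v, u} \<noteq> quad_facing {v, f}"
  using distinct by (auto simp: quad_facing_eq_iff Compl_eq doubleton_eq_iff)

lemma quads_eq: "UNIV = {quad_facing {v, w}, quad_facing {v, u}, quad_facing {v, f}}"
  using quad_distinct by (intro card_subset_eq[symmetric]) (auto simp: card_quad)

lemma sum_quads:
  fixes F :: "quad \<Rightarrow> real"
  shows "(\<Sum>q\<in>UNIV. F q) = F (quad_facing {v, w}) + F (quad_facing {v, u}) + F (quad_facing {v, f})"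
  unfolding quads_eq using quad_distinct by simp

lemma quad_opposite: "quad_facing {u, f} = quad_facing {v, w}" "quad_facing {w, f} = quad_facing {v, u}"
  "quad_facing {w, u} = quad_facing {v, f}"
  using distinct by (auto simp: quad_facing_eq_iff Compl_eq)

lemma quads_meeting: "{q. quad_meets q {v, w}} = {quad_facing {v, u}, quad_facing {v, f}}"
proof -
  have "{q. quad_meets q {v, w}} = UNIV - {quad_facing {v, w}}"
    using distinct by (auto simp: quad_meets_iff)
  also have "\<dots> = {quad_facing {v, u}, quad_facing {v, f}}"
    unfolding quads_eq using quad_distinct by auto
  finally show ?thesis .
qed

lemma sum_quads_meeting:
  fixes F :: "quad \<Rightarrow> real"
  shows "(\<Sum>q | quad_meets q {v, w}. F q) = F (quad_facing {v, u}) + F (quad_facing {v, f})"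
  unfolding quads_meeting using quad_distinct by simp

lemma sum_Rep_quad:
  fixes F :: "4 set \<Rightarrow> real"
  shows "(\<Sum>A\<in>Rep_quad (quad_facing {v, w}). F A) = F {v, w} + F {u, f}"
    "(\<Sum>A\<in>Rep_quad (quad_facing {v, u}). F A) = F {v, u} + F {w, f}"
    "(\<Sum>A\<in>Rep_quad (quad_facing {v, f}). F A) = F {v, f} + F {w, u}"
  using distinct by (simp_all add: Rep_quad_facing Compl_eq doubleton_eq_iff)

end

lemma four_vertices_exist:
  assumes "v \<noteq> w"
  obtains u f where "four_vertices v w u f"
proof -
  have "card (- {v, w} :: 4 set) = 2" by (rule card_Compl_4) (use assms in simp)
  then obtain u f where "- {v, w} = {u, f}" "u \<noteq> f" by (auto simp: card_2_iff)
  then have "four_vertices v w u f" using assms unfolding four_vertices_def by auto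
  then show thesis by (rule that)
qed

text \<open>
  Every edge of a tetrahedron is faced by exactly one quadrilateral type.
\<close>

lemma sum_quad_swap:
  fixes F :: "quad \<Rightarrow> 4 set \<Rightarrow> real"
  shows "(\<Sum>q\<in>UNIV. \<Sum>A\<in>Rep_quad q. F q A) = (\<Sum>A | card A = 2. F (quad_facing A) A)"
proof -
  interpret four_vertices 1 2 3 4 by unfold_locales auto
  show ?thesis by (simp add: sum_quads sum_Rep_quad sum_edges quad_opposite)
qed

section \<open>Weights of solutions\<close>

text \<open>
  For a normal surface, this is the number of its points of intersection with the edge.
\<close>

definition edge_weight :: "'n::finite normal_coords \<Rightarrow> 'n \<times> 4 set \<Rightarrow> real" where
  "edge_weight s = (\<lambda>(i, A). (\<Sum>q | quad_meets q A. fst s $ (i, q)) + (\<Sum>v\<in>A. snd s $ (i, v)))"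

text \<open>
  The contribution of the tetrahedron to the negative of \<open>\<chi>\<^sup>*\<close> apart from the terms with degrees.
\<close>

definition tet_weight :: "'n::finite normal_coords \<Rightarrow> 'n \<Rightarrow> real" where
  "tet_weight s i = (\<Sum>q\<in>UNIV. fst s $ (i, q)) + (\<Sum>v\<in>UNIV. snd s $ (i, v)) / 2"

definition tet_edges :: "('n \<times> 4 set) set" where
  "tet_edges = {(i, A). card A = 2}"

lemma sum_tet_edges:
  fixes F :: "'n::finite \<times> 4 set \<Rightarrow> real"
  shows "(\<Sum>p\<in>tet_edges. F p) = (\<Sum>i\<in>UNIV. \<Sum>A | card A = 2. F (i, A))"
proof -
  have "tet_edges = (UNIV :: 'n set) \<times> {A :: 4 set. card A = 2}" by (auto simp: tet_edges_def)
  then show ?thesis by (simp add: sum.cartesian_product)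
qed

lemma sum_pairs:
  fixes F :: "'n::finite \<times> 'b::finite \<Rightarrow> real"
  shows "(\<Sum>k\<in>UNIV. F k) = (\<Sum>i\<in>UNIV. \<Sum>q\<in>UNIV. F (i, q))"
  by (simp add: sum.cartesian_product flip: UNIV_Times_UNIV)

text \<open>
  In a face containing the edge, the edge weight is the sum of the coordinates of the two arc types
  that meet the edge, and the compatibility equations identify these with those of the other side.
\<close>

lemma edge_weight_glued:
  assumes fp: "face_pairing T" and s: "s \<in> C_space T" and A: "card A = 2" and g: "edge_glued T (i, A) (j, B)"
  shows "edge_weight s (j, B) = edge_weight s (i, A)"
proof -
  obtain x y where xy: "s = (x, y)" by (cases s)
  obtain f where f: "f \<notin> A" "j = adj T i f" "B = glue T i f ` A" using g by (auto simp: edge_glued_def)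
  let ?g = "glue T i f"
  have inj: "?g a = ?g b \<longleftrightarrow> a = b" for a b
    using fp unfolding face_pairing_def by (metis bij_is_inj inj_eq)
  obtain v w where vw: "A = {v, w}" "v \<noteq> w" using A by (auto simp: card_2_iff)
  have fvw: "f \<noteq> v" "f \<noteq> w" using f(1) vw(1) by auto
  have "card (- {v, w} :: 4 set) = 2" by (rule card_Compl_4) (use vw in simp)
  then obtain a b where ab: "- {v, w} = {a, b}" "a \<noteq> b" by (auto simp: card_2_iff)
  define u where "u = (if f = a then b else a)"
  have "f \<in> {a, b}" using fvw ab(1) by blast
  then have "- {v, w} = {u, f}" "u \<noteq> f" using ab by (auto simp: u_def)
  then interpret four_vertices v w u f using vw fvw unfolding four_vertices_def by auto
  interpret g: four_vertices "?g v" "?g w" "?g u" "?g f"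
    using distinct unfolding four_vertices_def by (simp add: inj)
  have eq: "x $ (i, quad_facing {a, f}) + y $ (i, a) = x $ (j, quad_facing {?g a, ?g f}) + y $ (j, ?g a)"
    if "a \<noteq> f" for a
  proof -
    have "x $ (i, arc_quad f a) + y $ (i, a) = x $ (adj T i f, arc_quad (?g f) (?g a)) + y $ (adj T i f, ?g a)"
      using s that unfolding xy C_space_def by blast
    then show ?thesis using that f(2) by (simp add: arc_quad_eq inj)
  qed
  show ?thesis
    using eq[of v] eq[of w] distinct g.distinct quad_opposite(2) g.quad_opposite(2)
    unfolding edge_weight_def xy f(3) vw(1) by (simp add: sum_quads_meeting g.sum_quads_meeting)
qed

text \<open>
  Exchange the order of summation: an edge of a tetrahedron contributes \<open>1 / d(e)\<close> for every disc that
  meets it.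
\<close>

lemma chi_star_weights:
  fixes s :: "'n::finite normal_coords"
  shows "chi_star T s = - (\<Sum>i\<in>UNIV. tet_weight s i)
    + (\<Sum>p\<in>tet_edges. edge_weight s p / degree (edge_class T (fst p) (snd p)))"
proof -
  obtain x y where xy: "s = (x, y)" by (cases s)
  let ?d = "\<lambda>i A. 1 / real (degree (edge_class T i A))"
  have "(\<Sum>k\<in>UNIV. x $ k * chi_quad T k) = (\<Sum>i\<in>UNIV. - (\<Sum>q\<in>UNIV. x $ (i, q))
      + (\<Sum>q\<in>UNIV. \<Sum>A | quad_meets q A. x $ (i, q) * ?d i A))"
    by (simp add: sum_pairs chi_quad_def algebra_simps sum_distrib_left sum_negf sum.distrib sum_subtractf)
  moreover have "(\<Sum>q\<in>UNIV. \<Sum>A | quad_meets q A. x $ (i, q) * ?d i A)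
      = (\<Sum>A | card A = 2. \<Sum>q | quad_meets q A. x $ (i, q) * ?d i A)" for i
  proof -
    have "(\<Sum>q\<in>UNIV. \<Sum>A | quad_meets q A. x $ (i, q) * ?d i A)
        = (\<Sum>q\<in>UNIV. \<Sum>A | A \<in> {A. card A = 2} \<and> quad_meets q A. x $ (i, q) * ?d i A)"
      by (intro sum.cong) (auto simp: quad_meets_def)
    also have "\<dots> = (\<Sum>A | card A = 2. \<Sum>q | q \<in> UNIV \<and> quad_meets q A. x $ (i, q) * ?d i A)"
      by (rule sum.swap_restrict) auto
    finally show ?thesis by simp
  qed
  ultimately have quads: "(\<Sum>k\<in>UNIV. x $ k * chi_quad T k) = (\<Sum>i\<in>UNIV. - (\<Sum>q\<in>UNIV. x $ (i, q))
      + (\<Sum>A | card A = 2. \<Sum>q | quad_meets q A. x $ (i, q) * ?d i A))" by simp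
  have "(\<Sum>k\<in>UNIV. y $ k * chi_tri T k) = (\<Sum>i\<in>UNIV. - (\<Sum>v\<in>UNIV. y $ (i, v)) / 2
      + (\<Sum>v\<in>UNIV. \<Sum>A | card A = 2 \<and> v \<in> A. y $ (i, v) * ?d i A))"
    by (simp add: sum_pairs chi_tri_def algebra_simps sum_distrib_left sum_negf sum.distrib sum_subtractf
        sum_divide_distrib)
  moreover have "(\<Sum>v\<in>UNIV. \<Sum>A | card A = 2 \<and> v \<in> A. y $ (i, v) * ?d i A)
      = (\<Sum>A | card A = 2. \<Sum>v\<in>A. y $ (i, v) * ?d i A)" for i
  proof -
    have "(\<Sum>v\<in>UNIV. \<Sum>A | A \<in> {A. card A = 2} \<and> v \<in> A. y $ (i, v) * ?d i A)
        = (\<Sum>A | card A = 2. \<Sum>v | v \<in> UNIV \<and> v \<in> A. y $ (i, v) * ?d i A)"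
      by (rule sum.swap_restrict) auto
    then show ?thesis by simp
  qed
  ultimately have tris: "(\<Sum>k\<in>UNIV. y $ k * chi_tri T k) = (\<Sum>i\<in>UNIV. - (\<Sum>v\<in>UNIV. y $ (i, v)) / 2
      + (\<Sum>A | card A = 2. \<Sum>v\<in>A. y $ (i, v) * ?d i A))" by simp
  have "(\<Sum>p\<in>tet_edges. edge_weight s p / degree (edge_class T (fst p) (snd p)))
      = (\<Sum>i\<in>UNIV. (\<Sum>A | card A = 2. \<Sum>q | quad_meets q A. x $ (i, q) * ?d i A)
          + (\<Sum>A | card A = 2. \<Sum>v\<in>A. y $ (i, v) * ?d i A))"
    by (simp add: sum_tet_edges edge_weight_def xy add_divide_distrib sum.distrib sum_divide_distrib)
  then show ?thesis unfolding xy chi_star_def case_prod_conv quads tris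
    by (simp add: tet_weight_def sum.distrib sum_negf sum_subtractf sum_divide_distrib)
qed

lemma edge_class_eq_iff: "edge_class T i A = edge_class T j B \<longleftrightarrow> equivclp (edge_glued T) (i, A) (j, B)"
proof -
  have "equivclp (edge_glued T) (i, A) c \<longleftrightarrow> equivclp (edge_glued T) (j, B) c"
    if "equivclp (edge_glued T) (i, A) (j, B)" for c
    using that equivclp_sym equivclp_trans by metis
  moreover have "(j, B) \<in> edge_class T j B" by (simp add: edge_class_def class_of_def)
  ultimately show ?thesis by (auto simp: edge_class_def class_of_def)
qed

lemma edge_glued_card:
  assumes "face_pairing T" "edge_glued T (i, A) (j, B)"
  shows "card A = card B"
proof -
  obtain f where "B = glue T i f ` A" using assms(2) by (auto simp: edge_glued_def)
  moreover have "inj (glue T i f)" using assms(1) unfolding face_pairing_def by (simp add: bij_is_inj)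
  ultimately show ?thesis by (metis card_image inj_on_subset subset_UNIV)
qed

lemma edge_class_invariant:
  assumes fp: "face_pairing T" and A: "card A = 2" and m: "(j, B) \<in> edge_class T i A"
    and n: "\<And>i A j B. card A = 2 \<Longrightarrow> edge_glued T (i, A) (j, B) \<Longrightarrow> n (j, B) = n (i, A)"
  shows "card B = 2" "n (j, B) = n (i, A)" "edge_class T j B = edge_class T i A"
proof -
  have e: "equivclp (edge_glued T) (i, A) (j, B)" using m by (simp add: edge_class_def class_of_def)
  then have "card (snd (j, B)) = 2 \<and> n (j, B) = n (i, A)"
  proof (induction rule: equivclp_induct)
    case base
    then show ?case using A by simp
  next
    case (step y z)
    obtain k D l E where yz: "y = (k, D)" "z = (l, E)" by (cases y; cases z)
    show ?case
      using step n[of D k l E] n[of E l k D] edge_glued_card[OF fp, of k D l E] edge_glued_card[OF fp, of l E k D]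
      unfolding yz by auto
  qed
  then show "card B = 2" "n (j, B) = n (i, A)" by auto
  show "edge_class T j B = edge_class T i A" using e edge_class_eq_iff equivclp_sym by metis
qed

lemma tet_edges_partition:
  fixes T :: "'n::finite gluing"
  assumes fp: "face_pairing T"
  shows "tet_edges = \<Union>(edges T)" "\<And>e e'. e \<in> edges T \<Longrightarrow> e' \<in> edges T \<Longrightarrow> e \<noteq> e' \<Longrightarrow> e \<inter> e' = {}"
    "\<And>e p. e \<in> edges T \<Longrightarrow> p \<in> e \<Longrightarrow> edge_class T (fst p) (snd p) = e"
    "\<And>e. e \<in> edges T \<Longrightarrow> e \<noteq> {}"
proof -
  note inv = edge_class_invariant[OF fp, where n = "\<lambda>_. 0"]
  show cl: "edge_class T (fst p) (snd p) = e" if "e \<in> edges T" "p \<in> e" for e p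
    using that inv(3) by (cases p) (auto simp: edges_def)
  show "e \<inter> e' = {}" if "e \<in> edges T" "e' \<in> edges T" "e \<noteq> e'" for e e'
    using cl[OF that(1)] cl[OF that(2)] that(3) by blast
  have self: "(i, A) \<in> edge_class T i A" for i A by (simp add: edge_class_def class_of_def)
  show "tet_edges = \<Union>(edges T)"
  proof
    show "tet_edges \<subseteq> \<Union>(edges T)" using self by (fastforce simp: tet_edges_def edges_def)
    show "\<Union>(edges T) \<subseteq> tet_edges" using inv(1) by (fastforce simp: tet_edges_def edges_def)
  qed
  show "e \<noteq> {}" if "e \<in> edges T" for e using that self by (fastforce simp: edges_def)
qed

lemma sum_over_edges:
  fixes T :: "'n::finite gluing" and F :: "'n \<times> 4 set \<Rightarrow> real"
  assumes fp: "face_pairing T"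
  shows "(\<Sum>p\<in>tet_edges. F p) = (\<Sum>e\<in>edges T. \<Sum>p\<in>e. F p)"
  unfolding tet_edges_partition(1)[OF fp]
  using tet_edges_partition(2)[OF fp] by (subst sum.Union_disjoint) auto

text \<open>
  Each edge of the triangulation consists of as many edges of tetrahedra as its degree says.
\<close>

lemma sum_edge_average:
  fixes T :: "'n::finite gluing"
  assumes fp: "face_pairing T" and n: "\<And>p. p \<in> tet_edges \<Longrightarrow> n p = m (edge_class T (fst p) (snd p))"
  shows "(\<Sum>p\<in>tet_edges. n p / degree (edge_class T (fst p) (snd p))) = (\<Sum>e\<in>edges T. m e)"
  unfolding sum_over_edges[OF fp]
proof (rule sum.cong[OF refl])
  fix e assume e: "e \<in> edges T"
  have "n p / degree (edge_class T (fst p) (snd p)) = m e / card e" if "p \<in> e" for p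
    using n[of p] tet_edges_partition(1,3)[OF fp] that e by (auto simp: degree_def)
  then have "(\<Sum>p\<in>e. n p / degree (edge_class T (fst p) (snd p))) = (\<Sum>p\<in>e. m e / card e)"
    by (rule sum.cong[OF refl])
  also have "\<dots> = m e" using tet_edges_partition(4)[OF fp e] by simp
  finally show "(\<Sum>p\<in>e. n p / degree (edge_class T (fst p) (snd p))) = m e" .
qed

text \<open>
  Some edge of a tetrahedron in the class \<open>e\<close>; it is used only to name the common weight of all of them.
\<close>

definition edge_rep :: "('n \<times> 4 set) set \<Rightarrow> 'n \<times> 4 set" where
  "edge_rep e = (SOME p. p \<in> e)"

lemma edge_weight_rep:
  assumes fp: "face_pairing T" and s: "s \<in> C_space T" and p: "p \<in> tet_edges"
  shows "edge_weight s p = edge_weight s (edge_rep (edge_class T (fst p) (snd p)))"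
proof -
  obtain i A where iA: "p = (i, A)" "card A = 2" using p by (auto simp: tet_edges_def)
  have "(i, A) \<in> edge_class T i A" by (simp add: edge_class_def class_of_def)
  then have r: "edge_rep (edge_class T i A) \<in> edge_class T i A" unfolding edge_rep_def by (rule someI)
  obtain j B where jB: "edge_rep (edge_class T i A) = (j, B)" by (cases "edge_rep (edge_class T i A)")
  have "edge_weight s (j, B) = edge_weight s (i, A)"
    by (rule edge_class_invariant(2)[OF fp iA(2) r[unfolded jB]]) (rule edge_weight_glued[OF fp s])
  then show ?thesis by (simp add: iA jB)
qed

lemma chi_star_edges:
  fixes T :: "'n::finite gluing"
  assumes fp: "face_pairing T" and s: "s \<in> C_space T"
  shows "chi_star T s = - (\<Sum>i\<in>UNIV. tet_weight s i) + (\<Sum>e\<in>edges T. edge_weight s (edge_rep e))"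
  unfolding chi_star_weights
  using sum_edge_average[OF fp, of "edge_weight s" "\<lambda>e. edge_weight s (edge_rep e)"] edge_weight_rep[OF fp s]
  by simp

text \<open>
  A disc of type \<open>q\<close> misses the two edges that \<open>q\<close> faces, any other quadrilateral meets both of
  them, and a triangle meets exactly one of them.
\<close>

lemma quad_coordinate_weights:
  fixes s :: "'n::finite normal_coords"
  shows "fst s $ (i, q) = tet_weight s i - (\<Sum>A\<in>Rep_quad q. edge_weight s (i, A)) / 2"
proof -
  obtain v w where vw: "quad_faces q {v, w}" "w \<noteq> v" using quad_obtain_edge[of 1 q] by metis
  obtain u f where "four_vertices v w u f" using four_vertices_exist[of v w] vw(2) by metis
  then interpret four_vertices v w u f .
  have q: "q = quad_facing {v, w}" using vw by (simp add: quad_faces_facing_iff)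
  interpret o': four_vertices u f v w using distinct by unfold_locales auto
  have "edge_weight s (i, {u, f}) = fst s $ (i, quad_facing {v, u}) + fst s $ (i, quad_facing {v, f})
      + snd s $ (i, u) + snd s $ (i, f)"
  proof -
    have "quad_facing {u, v} = quad_facing {v, u}" "quad_facing {u, w} = quad_facing {v, f}"
      using quad_opposite(3) by (simp_all add: insert_commute)
    then show ?thesis unfolding edge_weight_def using distinct by (simp add: o'.sum_quads_meeting)
  qed
  moreover have "edge_weight s (i, {v, w}) = fst s $ (i, quad_facing {v, u}) + fst s $ (i, quad_facing {v, f})
      + snd s $ (i, v) + snd s $ (i, w)"
    unfolding edge_weight_def using distinct by (simp add: sum_quads_meeting)
  ultimately show ?thesis unfolding q tet_weight_def
    by (simp add: sum_Rep_quad sum_quads sum_vertices field_simps)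
qed

lemma semi_angle_pairing:
  fixes T :: "'n::finite gluing"
  assumes fp: "face_pairing T" and s: "s \<in> C_space T" and \<alpha>: "semi_angle_structure T \<alpha>"
  shows "(\<Sum>i\<in>UNIV. \<Sum>q\<in>UNIV. \<alpha> (i, q) * fst s $ (i, q)) = - pi * chi_star T s"
proof -
  have "(\<Sum>i\<in>UNIV. \<Sum>q\<in>UNIV. \<alpha> (i, q) * fst s $ (i, q))
      = (\<Sum>i\<in>UNIV. (\<Sum>q\<in>UNIV. \<alpha> (i, q)) * tet_weight s i)
        - (\<Sum>i\<in>UNIV. \<Sum>q\<in>UNIV. \<Sum>A\<in>Rep_quad q. \<alpha> (i, q) * edge_weight s (i, A)) / 2"
    by (subst quad_coordinate_weights)
      (simp add: right_diff_distrib sum_subtractf sum_distrib_left sum_distrib_right sum_divide_distrib)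
  also have "(\<Sum>i\<in>UNIV. \<Sum>q\<in>UNIV. \<Sum>A\<in>Rep_quad q. \<alpha> (i, q) * edge_weight s (i, A))
      = (\<Sum>p\<in>tet_edges. \<alpha> (fst p, quad_facing (snd p)) * edge_weight s p)"
    by (simp add: sum_quad_swap sum_tet_edges)
  also have "\<dots> = (\<Sum>e\<in>edges T. \<Sum>p\<in>e. \<alpha> (fst p, quad_facing (snd p)) * edge_weight s p)"
    by (rule sum_over_edges[OF fp])
  also have "\<dots> = (\<Sum>e\<in>edges T. 2 * pi * edge_weight s (edge_rep e))"
  proof (rule sum.cong[OF refl])
    fix e assume e: "e \<in> edges T"
    have "(\<Sum>p\<in>e. \<alpha> (fst p, quad_facing (snd p)) * edge_weight s p)
        = (\<Sum>p\<in>e. \<alpha> (fst p, quad_facing (snd p)) * edge_weight s (edge_rep e))"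
    proof (rule sum.cong[OF refl])
      fix p assume p: "p \<in> e"
      then have "p \<in> tet_edges" using e tet_edges_partition(1)[OF fp] by blast
      then show "\<alpha> (fst p, quad_facing (snd p)) * edge_weight s p
          = \<alpha> (fst p, quad_facing (snd p)) * edge_weight s (edge_rep e)"
        using edge_weight_rep[OF fp s] tet_edges_partition(3)[OF fp e p] by simp
    qed
    also have "\<dots> = 2 * pi * edge_weight s (edge_rep e)"
      using \<alpha> e by (simp add: semi_angle_structure_def case_prod_beta flip: sum_distrib_right)
    finally show "(\<Sum>p\<in>e. \<alpha> (fst p, quad_facing (snd p)) * edge_weight s p) = 2 * pi * edge_weight s (edge_rep e)" .
  qed
  also have "\<dots> = 2 * pi * (\<Sum>e\<in>edges T. edge_weight s (edge_rep e))" by (simp add: sum_distrib_left)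
  also have "(\<Sum>i\<in>UNIV. (\<Sum>q\<in>UNIV. \<alpha> (i, q)) * tet_weight s i) = pi * (\<Sum>i\<in>UNIV. tet_weight s i)"
    using \<alpha> by (simp add: semi_angle_structure_def sum_distrib_left)
  finally show ?thesis unfolding chi_star_edges[OF fp s]
    by (simp add: algebra_simps)
qed

text \<open>
  The solution with edge weights \<open>- 2 z\<close> and tetrahedron weights \<open>w\<close>. It is the linear combination,
  with coefficients \<open>w\<close> and \<open>z\<close>, of the tetrahedral solutions and edge solutions of Kang and
  Rubinstein.
\<close>

definition weights_solution ::
  "'n gluing \<Rightarrow> ('n \<Rightarrow> real) \<Rightarrow> (('n \<times> 4 set) set \<Rightarrow> real) \<Rightarrow> 'n::finite normal_coords" where
  "weights_solution T w z =
    ((\<chi> k. w (fst k) + (\<Sum>A\<in>Rep_quad (snd k). z (edge_class T (fst k) A))),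
     (\<chi> k. - w (fst k) - (\<Sum>A | card A = 2 \<and> snd k \<in> A. z (edge_class T (fst k) A))))"

lemma weights_solution_weights:
  fixes T :: "'n::finite gluing"
  shows "tet_weight (weights_solution T w z) i = w i"
    and "card A = 2 \<Longrightarrow> edge_weight (weights_solution T w z) (i, A) = - 2 * z (edge_class T i A)"
proof -
  let ?z = "\<lambda>A. z (edge_class T i A)"
  interpret four_vertices 1 2 3 4 by unfold_locales auto
  interpret two: four_vertices 2 1 3 4 by unfold_locales auto
  interpret three: four_vertices 3 1 2 4 by unfold_locales auto
  interpret four: four_vertices 4 1 2 3 by unfold_locales auto
  show "tet_weight (weights_solution T w z) i = w i"
    unfolding tet_weight_def weights_solution_def
    by (simp add: sum_quads sum_Rep_quad sum_vertices sum_edges_at two.sum_edges_at three.sum_edges_at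
        four.sum_edges_at insert_commute field_simps)
next
  assume "card A = 2"
  then obtain v w' where vw: "A = {v, w'}" "v \<noteq> w'" by (auto simp: card_2_iff)
  obtain u f where "four_vertices v w' u f" using four_vertices_exist[of v w'] vw(2) by metis
  then interpret four_vertices v w' u f .
  interpret two: four_vertices w' v u f using distinct by unfold_locales auto
  have "{w', v} = {v, w'}" by blast
  then show "edge_weight (weights_solution T w z) (i, A) = - 2 * z (edge_class T i A)"
    unfolding edge_weight_def weights_solution_def vw(1)
    using distinct by (simp add: sum_quads_meeting sum_Rep_quad sum_edges_at two.sum_edges_at)
qed

lemma weights_solution_C_space:
  fixes T :: "'n::finite gluing"
  assumes fp: "face_pairing T"
  shows "weights_solution T w z \<in> C_space T"
proof -
  let ?x = "fst (weights_solution T w z)" and ?y = "snd (weights_solution T w z)"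
  have arc: "?x $ (i, quad_facing {v, f}) + ?y $ (i, v) =
      z (edge_class T i {a, b}) - z (edge_class T i {v, a}) - z (edge_class T i {v, b})"
    if "four_vertices v f a b" for i v f a b
  proof -
    interpret four_vertices v f a b by (rule that)
    show ?thesis unfolding weights_solution_def by (simp add: sum_Rep_quad sum_edges_at)
  qed
  have "?x $ (i, arc_quad f v) + ?y $ (i, v) =
     ?x $ (adj T i f, arc_quad (glue T i f f) (glue T i f v)) + ?y $ (adj T i f, glue T i f v)"
    if vf: "v \<noteq> f" for i f v
  proof -
    let ?g = "glue T i f" and ?j = "adj T i f"
    have inj: "?g a = ?g b \<longleftrightarrow> a = b" for a b
      using fp unfolding face_pairing_def by (metis bij_is_inj inj_eq)
    obtain a b where "four_vertices v f a b" using four_vertices_exist[OF vf] by metis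
    then interpret four_vertices v f a b .
    have g: "four_vertices (?g v) (?g f) (?g a) (?g b)"
      using distinct unfolding four_vertices_def by (simp add: inj)
    have cls: "edge_class T ?j (?g ` A) = edge_class T i A" if "f \<notin> A" for A
    proof -
      have "edge_glued T (i, A) (?j, ?g ` A)" using that by (auto simp: edge_glued_def)
      then have "equivclp (edge_glued T) (?j, ?g ` A) (i, A)"
        by (intro equivclp_sym[OF r_into_equivclp])
      then show ?thesis by (simp add: edge_class_eq_iff)
    qed
    have "edge_class T ?j {?g c, ?g d} = edge_class T i {c, d}" if "c \<noteq> f" "d \<noteq> f" for c d
      using cls[of "{c, d}"] that by simp
    then show ?thesis
      using arc[OF four_vertices_axioms, of i] arc[OF g, of ?j] vf distinct inj
      by (simp add: arc_quad_eq)
  qed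
  then show ?thesis unfolding C_space_def by (cases "weights_solution T w z") auto
qed

lemma chi_star_weights_solution:
  fixes T :: "'n::finite gluing"
  assumes fp: "face_pairing T"
  shows "chi_star T (weights_solution T w z) = - (\<Sum>i\<in>UNIV. w i) - 2 * (\<Sum>e\<in>edges T. z e)"
proof -
  have "(\<Sum>p\<in>tet_edges. edge_weight (weights_solution T w z) p / degree (edge_class T (fst p) (snd p)))
      = (\<Sum>e\<in>edges T. - 2 * z e)"
    by (rule sum_edge_average[OF fp]) (auto simp: tet_edges_def weights_solution_weights)
  then show ?thesis unfolding chi_star_weights
    by (simp add: weights_solution_weights sum_distrib_left sum_negf)
qed


section \<open>The equivalences\<close>

lemma chi_star_add: "chi_star T (s + t) = chi_star T s + chi_star T t"
  by (cases s; cases t) (simp add: chi_star_def sum.distrib distrib_right)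

lemma chi_star_scale: "chi_star T (c *\<^sub>R s) = c * chi_star T s"
  by (cases s) (simp add: chi_star_def sum_distrib_left distrib_left mult.assoc)

lemma C_space_scale: "s \<in> C_space T \<Longrightarrow> c *\<^sub>R s \<in> C_space T"
  by (cases s) (auto simp: C_space_def simp flip: distrib_left)

lemma C_space_add: "s \<in> C_space T \<Longrightarrow> t \<in> C_space T \<Longrightarrow> s + t \<in> C_space T"
proof -
  have eq: "a + c + (b + d) = a' + c' + (b' + d')"
    if "a + b = a' + b'" "c + d = c' + d'" for a b c d a' b' c' d' :: real
    using that by simp
  assume "s \<in> C_space T" "t \<in> C_space T"
  then show ?thesis by (cases s; cases t) (auto simp: C_space_def intro!: eq)
qed

definition angle_polytope :: "(real ^ ('n::finite \<times> quad)) set" where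
  "angle_polytope = {\<alpha>. (\<forall>k. 0 \<le> \<alpha> $ k) \<and> (\<forall>i. (\<Sum>q\<in>UNIV. \<alpha> $ (i, q)) = pi)}"

lemma compact_angle_polytope: "compact (angle_polytope :: (real ^ ('n::finite \<times> quad)) set)"
proof -
  have "bounded (angle_polytope :: (real ^ ('n \<times> quad)) set)"
  proof (rule boundedI)
    fix \<alpha> :: "real ^ ('n \<times> quad)" assume \<alpha>: "\<alpha> \<in> angle_polytope"
    have "norm \<alpha> \<le> (\<Sum>k\<in>UNIV. \<bar>\<alpha> $ k\<bar>)" by (rule norm_le_l1_cart)
    also have "\<dots> = (\<Sum>i\<in>(UNIV :: 'n set). pi)"
      using \<alpha> by (simp add: sum_pairs angle_polytope_def)
    finally show "norm \<alpha> \<le> CARD('n) * pi" by simp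
  qed
  moreover have "closed (angle_polytope :: (real ^ ('n \<times> quad)) set)"
    unfolding angle_polytope_def
    by (intro closed_Collect_conj closed_Collect_all closed_Collect_le closed_Collect_eq continuous_intros)
  ultimately show ?thesis by (simp add: compact_eq_bounded_closed)
qed

lemma convex_angle_polytope: "convex (angle_polytope :: (real ^ ('n::finite \<times> quad)) set)"
  unfolding convex_def
proof (intro ballI allI impI)
  fix \<alpha> \<beta> :: "real ^ ('n \<times> quad)" and a b :: real
  assume h: "\<alpha> \<in> angle_polytope" "\<beta> \<in> angle_polytope" "0 \<le> a" "0 \<le> b" "a + b = 1"
  have "(\<Sum>q\<in>UNIV. (a *\<^sub>R \<alpha> + b *\<^sub>R \<beta>) $ (i, q)) = a * (\<Sum>q\<in>UNIV. \<alpha> $ (i, q)) + b * (\<Sum>q\<in>UNIV. \<beta> $ (i, q))" for i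
    by (simp add: sum.distrib sum_distrib_left)
  then have "(\<Sum>q\<in>UNIV. (a *\<^sub>R \<alpha> + b *\<^sub>R \<beta>) $ (i, q)) = (a + b) * pi" for i
    using h(1,2) by (simp add: angle_polytope_def distrib_right)
  then show "a *\<^sub>R \<alpha> + b *\<^sub>R \<beta> \<in> angle_polytope"
    using h by (simp add: angle_polytope_def)
qed

definition edge_sums :: "'n gluing \<Rightarrow> real ^ ('n::finite \<times> quad) \<Rightarrow> real ^ (('n \<times> 4 set) set)" where
  "edge_sums T \<alpha> = (\<chi> e. if e \<in> edges T then \<Sum>p\<in>e. \<alpha> $ (fst p, quad_facing (snd p)) else 0)"

lemma linear_edge_sums: "linear (edge_sums T)"
  by (rule linearI) (simp_all add: edge_sums_def vec_eq_iff sum.distrib sum_distrib_left)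

lemma inner_edge_sums:
  fixes T :: "'n::finite gluing"
  assumes fp: "face_pairing T"
  shows "z \<bullet> edge_sums T \<alpha>
    = (\<Sum>i\<in>UNIV. \<Sum>q\<in>UNIV. \<alpha> $ (i, q) * (\<Sum>A\<in>Rep_quad q. z $ edge_class T i A))"
proof -
  have "z \<bullet> edge_sums T \<alpha> = (\<Sum>e\<in>UNIV. if e \<in> edges T
      then z $ e * (\<Sum>p\<in>e. \<alpha> $ (fst p, quad_facing (snd p))) else 0)"
    unfolding inner_vec_def edge_sums_def by (intro sum.cong) auto
  also have "\<dots> = (\<Sum>e\<in>edges T. z $ e * (\<Sum>p\<in>e. \<alpha> $ (fst p, quad_facing (snd p))))"
    by (simp add: sum.If_cases)
  also have "\<dots> = (\<Sum>e\<in>edges T. \<Sum>p\<in>e. z $ edge_class T (fst p) (snd p) * \<alpha> $ (fst p, quad_facing (snd p)))"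
    using tet_edges_partition(3)[OF fp] by (intro sum.cong refl) (simp add: sum_distrib_left)
  also have "\<dots> = (\<Sum>p\<in>tet_edges. z $ edge_class T (fst p) (snd p) * \<alpha> $ (fst p, quad_facing (snd p)))"
    by (rule sum_over_edges[OF fp, symmetric])
  also have "\<dots> = (\<Sum>i\<in>UNIV. \<Sum>q\<in>UNIV. \<Sum>A\<in>Rep_quad q. \<alpha> $ (i, q) * z $ edge_class T i A)"
    by (simp add: sum_tet_edges sum_quad_swap mult.commute)
  finally show ?thesis by (simp add: sum_distrib_left)
qed

text \<open>
  A functional \<open>z\<close> separating \<open>b\<close> from the compact convex set of edge sums is used as edge
  coefficients of a solution. In each tetrahedron the coefficient \<open>w\<close> is the least number that makes
  the quadrilateral coordinates non-negative. Evaluating \<open>z\<close> at the edge sums of the function \<open>\<alpha>\<close> that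
  puts the whole angle \<open>\<pi>\<close> on a quadrilateral with coordinate 0 shows that \<open>\<chi>\<^sup>*\<close> is positive on
  this solution.
\<close>

lemma semi_angle_structure_exists:
  fixes T :: "'n::finite gluing"
  assumes fp: "face_pairing T"
    and neg: "\<forall>s\<in>C_space T. (\<forall>k. 0 \<le> fst s $ k) \<longrightarrow> chi_star T s \<le> 0"
  shows "\<exists>\<alpha>. semi_angle_structure T \<alpha>"
proof -
  define b :: "real ^ (('n \<times> 4 set) set)" where "b = (\<chi> e. if e \<in> edges T then 2 * pi else 0)"
  let ?P = "angle_polytope :: (real ^ ('n \<times> quad)) set"
  have "b \<in> edge_sums T ` ?P"
  proof (rule ccontr)
    assume nb: "b \<notin> edge_sums T ` ?P"
    have "compact (edge_sums T ` ?P)"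
      by (rule compact_continuous_image[OF linear_continuous_on compact_angle_polytope])
        (simp add: linear_edge_sums linear_linear)
    then have "closed (edge_sums T ` ?P)" by (rule compact_imp_closed)
    moreover have "convex (edge_sums T ` ?P)"
      by (rule convex_linear_image[OF linear_edge_sums convex_angle_polytope])
    ultimately obtain z c where z: "z \<bullet> b < c" "\<forall>y\<in>edge_sums T ` ?P. c < z \<bullet> y"
      using separating_hyperplane_closed_point nb by metis
    define m where "m i q = (\<Sum>A\<in>Rep_quad q. z $ edge_class T i A)" for i q
    define w where "w i = - Min (range (m i))" for i
    have ge: "- w i \<le> m i q" for i q unfolding w_def minus_minus by (rule Min_le) auto
    have "\<exists>q. m i q = - w i" for i
    proof -
      have "Min (range (m i)) \<in> range (m i)" by (rule Min_in) auto
      then obtain q where "Min (range (m i)) = m i q" by (rule imageE)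
      then show ?thesis unfolding w_def minus_minus by metis
    qed
    then obtain best where best: "\<And>i. m i (best i) = - w i" by metis
    define \<alpha> :: "real ^ ('n \<times> quad)" where "\<alpha> = (\<chi> k. if snd k = best (fst k) then pi else 0)"
    have "\<alpha> \<in> ?P" by (simp add: angle_polytope_def \<alpha>_def)
    then have "c < z \<bullet> edge_sums T \<alpha>" using z(2) by blast
    also have "\<dots> = (\<Sum>i\<in>UNIV. \<Sum>q\<in>UNIV. if q = best i then pi * m i q else 0)"
      unfolding inner_edge_sums[OF fp] m_def[symmetric] by (intro sum.cong) (auto simp: \<alpha>_def)
    also have "\<dots> = - pi * (\<Sum>i\<in>UNIV. w i)" by (simp add: best sum_distrib_left sum_negf)
    finally have "z \<bullet> b < - pi * (\<Sum>i\<in>UNIV. w i)" using z(1) by simp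
    moreover have "z \<bullet> b = (\<Sum>e\<in>UNIV. if e \<in> edges T then z $ e * (2 * pi) else 0)"
      unfolding inner_vec_def b_def by (intro sum.cong) auto
    then have "z \<bullet> b = 2 * pi * (\<Sum>e\<in>edges T. z $ e)"
      by (simp add: sum.If_cases sum_distrib_left mult.commute)
    ultimately have "0 < pi * (- (\<Sum>i\<in>UNIV. w i) - 2 * (\<Sum>e\<in>edges T. z $ e))"
      by (simp add: algebra_simps)
    then have "0 < chi_star T (weights_solution T w (\<lambda>e. z $ e))"
      unfolding chi_star_weights_solution[OF fp] by (simp add: zero_less_mult_iff)
    moreover have "0 \<le> fst (weights_solution T w (\<lambda>e. z $ e)) $ k" for k
      using ge[of "fst k" "snd k"] by (simp add: weights_solution_def m_def)
    ultimately show False using neg weights_solution_C_space[OF fp, of w "\<lambda>e. z $ e"] by fastforce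
  qed
  then obtain \<alpha> where \<alpha>: "\<alpha> \<in> ?P" "b = edge_sums T \<alpha>" by blast
  have "(\<Sum>p\<in>e. \<alpha> $ (fst p, quad_facing (snd p))) = 2 * pi" if "e \<in> edges T" for e
    using arg_cong[OF \<alpha>(2), of "\<lambda>v. v $ e"] that by (simp add: b_def edge_sums_def)
  then have "semi_angle_structure T (\<lambda>k. \<alpha> $ k)"
    using \<alpha>(1) by (simp add: semi_angle_structure_def angle_polytope_def case_prod_beta)
  then show ?thesis by blast
qed

lemma compact_PC_space: "compact (PC_space (T :: 'n::finite gluing))"
proof -
  have "bounded (PC_space T)"
  proof (rule boundedI)
    fix s assume s: "s \<in> PC_space T"
    obtain x y where xy: "s = (x, y)" by (cases s)
    have "norm s \<le> norm x + norm y" unfolding xy by (rule norm_Pair_le)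
    also have "\<dots> \<le> (\<Sum>k\<in>UNIV. \<bar>x $ k\<bar>) + (\<Sum>k\<in>UNIV. \<bar>y $ k\<bar>)"
      by (intro add_mono norm_le_l1_cart)
    also have "\<dots> = 1"
    proof -
      have "\<forall>k. 0 \<le> x $ k" "\<forall>k. 0 \<le> y $ k" "(\<Sum>k\<in>UNIV. x $ k) + (\<Sum>k\<in>UNIV. y $ k) = 1"
        using s unfolding xy PC_space_def by blast+
      then show ?thesis by (simp del: split_paired_All)
    qed
    finally show "norm s \<le> 1" .
  qed
  moreover have "PC_space T = {s. (\<forall>i f v. v \<noteq> f \<longrightarrow>
     fst s $ (i, arc_quad f v) + snd s $ (i, v) =
     fst s $ (adj T i f, arc_quad (glue T i f f) (glue T i f v)) + snd s $ (adj T i f, glue T i f v)) \<and>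
     (\<forall>k. 0 \<le> fst s $ k) \<and> (\<forall>k. 0 \<le> snd s $ k) \<and>
     (\<Sum>k\<in>UNIV. fst s $ k) + (\<Sum>k\<in>UNIV. snd s $ k) = 1}"
    by (auto simp: PC_space_def C_space_def)
  moreover have "closed \<dots>"
    by (intro closed_Collect_conj closed_Collect_all closed_Collect_imp open_Collect_const
        closed_Collect_le closed_Collect_eq continuous_intros)
  ultimately show ?thesis by (simp add: compact_eq_bounded_closed)
qed

lemma convex_PC_space: "convex (PC_space (T :: 'n::finite gluing))"
  unfolding convex_def
proof (intro ballI allI impI)
  fix s t and a b :: real
  assume h: "s \<in> PC_space T" "t \<in> PC_space T" "0 \<le> a" "0 \<le> b" "a + b = 1"
  obtain x y x' y' where st: "s = (x, y)" "t = (x', y')" by (cases s; cases t)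
  have "a *\<^sub>R s + b *\<^sub>R t \<in> C_space T"
    using h(1,2) by (intro C_space_add C_space_scale) (auto simp: PC_space_def)
  moreover have "(\<Sum>k\<in>UNIV. (a *\<^sub>R x + b *\<^sub>R x') $ k) + (\<Sum>k\<in>UNIV. (a *\<^sub>R y + b *\<^sub>R y') $ k)
      = a * ((\<Sum>k\<in>UNIV. x $ k) + (\<Sum>k\<in>UNIV. y $ k)) + b * ((\<Sum>k\<in>UNIV. x' $ k) + (\<Sum>k\<in>UNIV. y' $ k))"
    by (simp add: sum.distrib sum_distrib_left algebra_simps)
  then have "(\<Sum>k\<in>UNIV. (a *\<^sub>R x + b *\<^sub>R x') $ k) + (\<Sum>k\<in>UNIV. (a *\<^sub>R y + b *\<^sub>R y') $ k) = 1"
    using h st by (simp add: PC_space_def)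
  ultimately show "a *\<^sub>R s + b *\<^sub>R t \<in> PC_space T"
    using h(1-4) by (auto simp: PC_space_def st)
qed

lemma vertex_solutions_suffice:
  fixes T :: "'n::finite gluing"
  assumes "\<forall>V\<in>vertex_solutions T. chi_star T V \<le> 0"
  shows "\<forall>s\<in>PC_space T. chi_star T s \<le> 0"
proof -
  have "convex {s. chi_star T s \<le> 0}"
    unfolding convex_def
  proof (intro ballI allI impI CollectI)
    fix s t and a b :: real
    assume "s \<in> {s. chi_star T s \<le> 0}" "t \<in> {s. chi_star T s \<le> 0}" "0 \<le> a" "0 \<le> b"
    then have "a * chi_star T s \<le> 0" "b * chi_star T t \<le> 0" by (auto simp: mult_nonneg_nonpos)
    then show "chi_star T (a *\<^sub>R s + b *\<^sub>R t) \<le> 0" by (simp add: chi_star_add chi_star_scale)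
  qed
  then have "convex hull (vertex_solutions T) \<subseteq> {s. chi_star T s \<le> 0}"
    using assms by (intro hull_minimal) auto
  moreover have "PC_space T = convex hull (vertex_solutions T)"
    unfolding vertex_solutions_def by (rule Krein_Milman_Minkowski[OF compact_PC_space convex_PC_space])
  ultimately show ?thesis by blast
qed

text \<open>
  The sum of the links of all ideal vertices.
\<close>

definition total_link :: "'n::finite normal_coords" where
  "total_link = (0, \<chi> k. 1)"

lemma total_link_C_space: "total_link \<in> C_space T"
  by (auto simp: total_link_def C_space_def)

lemma chi_star_total_link:
  fixes T :: "'n::finite gluing"
  assumes fp: "face_pairing T"
  shows "chi_star T total_link = 2 * real (card (edges T)) - 2 * real CARD('n)"
proof -
  have "(\<Sum>p\<in>tet_edges. edge_weight total_link p / degree (edge_class T (fst p) (snd p)))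
      = (\<Sum>e\<in>edges T. 2)"
    by (rule sum_edge_average[OF fp]) (auto simp: tet_edges_def edge_weight_def total_link_def)
  then show ?thesis unfolding chi_star_weights
    by (simp add: tet_weight_def total_link_def)
qed

text \<open>
  Adding a multiple of the total link keeps the quadrilateral coordinates, makes the triangle
  coordinates non-negative and does not decrease \<open>\<chi>\<^sup>*\<close>. The result can be scaled into the polytope.
\<close>

lemma nonnegative_solutions_suffice:
  fixes T :: "'n::finite gluing"
  assumes link: "0 \<le> chi_star T total_link" and PC: "\<forall>s\<in>PC_space T. chi_star T s \<le> 0"
    and s: "s \<in> C_space T" "\<forall>k. 0 \<le> fst s $ k"
  shows "chi_star T s \<le> 0"
proof -
  (* any number that exceeds the absolute values of all triangle coordinates would do *)
  define c where "c = (\<Sum>k\<in>UNIV. \<bar>snd s $ k\<bar>)"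
  define t where "t = s + c *\<^sub>R total_link"
  have tC: "t \<in> C_space T"
    unfolding t_def using s(1) total_link_C_space by (intro C_space_add C_space_scale)
  have c0: "0 \<le> c" by (simp add: c_def sum_nonneg)
  have "\<bar>snd s $ k\<bar> \<le> c" for k
    unfolding c_def by (rule member_le_sum[of k UNIV "\<lambda>k. \<bar>snd s $ k\<bar>"]) auto
  then have "0 \<le> snd s $ k + c" for k by (metis abs_le_D2 add.commute le_minus_iff diff_ge_0_iff_ge diff_minus_eq_add minus_le_iff)
  then have t0: "\<forall>k. 0 \<le> fst t $ k" "\<forall>k. 0 \<le> snd t $ k"
    using s(2) by (simp_all add: t_def total_link_def)
  define S where "S = (\<Sum>k\<in>UNIV. fst t $ k) + (\<Sum>k\<in>UNIV. snd t $ k)"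
  have "chi_star T t \<le> 0"
  proof (cases "S = 0")
    case True
    have "(\<Sum>k\<in>UNIV. fst t $ k) = 0" "(\<Sum>k\<in>UNIV. snd t $ k) = 0"
      using True t0 by (simp_all add: S_def add_nonneg_eq_0_iff sum_nonneg)
    then have "fst t $ k = 0" "snd t $ k' = 0" for k k'
      using t0 by (simp_all add: sum_nonneg_eq_0_iff del: split_paired_All)
    then show ?thesis by (cases t) (simp add: chi_star_def)
  next
    case False
    moreover have "0 \<le> (\<Sum>k\<in>UNIV. fst t $ k)" "0 \<le> (\<Sum>k\<in>UNIV. snd t $ k)"
      using t0 by (intro sum_nonneg; blast)+
    ultimately have S: "0 < S" by (simp add: S_def)
    have "inverse S *\<^sub>R t \<in> PC_space T"
      using C_space_scale[OF tC, of "inverse S"] t0 S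
      by (cases t) (auto simp: PC_space_def S_def simp flip: sum_distrib_left distrib_left)
    then have "inverse S * chi_star T t \<le> 0" using PC by (metis chi_star_scale)
    then show ?thesis using S by (simp add: mult_le_0_iff)
  qed
  moreover have "0 \<le> c * chi_star T total_link" using c0 link by simp
  ultimately show ?thesis by (simp add: t_def chi_star_add chi_star_scale)
qed

theorem theorem2:
  fixes N :: "'a topology"
    and M :: "'a topology"
    and T :: "'n::finite gluing"
    and h :: "'a \<Rightarrow> ('n \<times> (real^4)) set"
  assumes "compact_3manifold_with_boundary N"
    and "topspace (manifold_boundary N) \<noteq> {}"
    and "M = manifold_interior N"
    and "ideal_triangulation M T h"
    and "\<And>B. B \<in> connected_components_of (manifold_boundary N) \<Longrightarrow>
           subtopology (manifold_boundary N) B homeomorphic_space torus \<or>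
           subtopology (manifold_boundary N) B homeomorphic_space klein_bottle"
  shows "((\<exists>\<alpha>. semi_angle_structure T \<alpha>) \<longleftrightarrow>
            (\<forall>s\<in>C_space T. (\<forall>k. 0 \<le> fst s $ k) \<longrightarrow> chi_star T s \<le> 0)) \<and>
         ((\<exists>\<alpha>. semi_angle_structure T \<alpha>) \<longleftrightarrow>
            (\<forall>s\<in>PC_space T. chi_star T s \<le> 0)) \<and>
         ((\<exists>\<alpha>. semi_angle_structure T \<alpha>) \<longleftrightarrow>
            (\<forall>V\<in>vertex_solutions T. chi_star T V \<le> 0))"
proof -
  have fp: "face_pairing T" using assms(4) by (simp add: ideal_triangulation_def)
  have "CARD('n) \<le> card (edges T)"
    by (rule ideal_triangulation_tetrahedra_le_edges[OF assms(1,3,4,5)])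
  then have link: "0 \<le> chi_star T total_link" by (simp add: chi_star_total_link[OF fp])
  let ?A = "\<exists>\<alpha>. semi_angle_structure T \<alpha>"
  let ?Q = "\<forall>s\<in>C_space T. (\<forall>k. 0 \<le> fst s $ k) \<longrightarrow> chi_star T s \<le> 0"
  let ?P = "\<forall>s\<in>PC_space T. chi_star T s \<le> 0"
  let ?V = "\<forall>V\<in>vertex_solutions T. chi_star T V \<le> 0"
  have "?A \<Longrightarrow> ?Q"
  proof (intro ballI impI)
    fix s assume "?A" and s: "s \<in> C_space T" "\<forall>k. 0 \<le> fst s $ k"
    then obtain \<alpha> where \<alpha>: "semi_angle_structure T \<alpha>" by blast
    have "\<forall>k. 0 \<le> \<alpha> k" using \<alpha> unfolding semi_angle_structure_def by blast
    then have "0 \<le> (\<Sum>i\<in>UNIV. \<Sum>q\<in>UNIV. \<alpha> (i, q) * fst s $ (i, q))"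
      using s(2) by (intro sum_nonneg mult_nonneg_nonneg) blast+
    then have "0 \<le> - pi * chi_star T s" unfolding semi_angle_pairing[OF fp s(1) \<alpha>] .
    then show "chi_star T s \<le> 0" using pi_gt_zero by (simp add: mult_le_0_iff)
  qed
  moreover have "?Q \<Longrightarrow> ?A" by (rule semi_angle_structure_exists[OF fp])
  moreover have "?P \<Longrightarrow> ?Q" using nonnegative_solutions_suffice[OF link] by blast
  moreover have "?V \<Longrightarrow> ?P" by (rule vertex_solutions_suffice)
  moreover have "?Q \<Longrightarrow> ?P"
  proof
    fix s assume Q: "?Q" and s: "s \<in> PC_space T"
    then have "s \<in> C_space T" "\<forall>k. 0 \<le> fst s $ k" unfolding PC_space_def by auto
    then show "chi_star T s \<le> 0" using Q by blast
  qed
  moreover have "?P \<Longrightarrow> ?V"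
    unfolding vertex_solutions_def extreme_point_of_def by blast
  ultimately show ?thesis by argo
qed

end
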